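(* Let $\rho>0$ be a constant independent of $h$ and $\lambda$, and let $$\mathcal{A}_e=\begin{bmatrix} A_1 & -(B^{\circ})^T\\ -B^{\circ} & -\epsilon M_p^{\circ}-\rho\,\mathbf{w}\mathbf{w}^T\end{bmatrix},\qquad \mathcal{P}_{t,e}=\begin{bmatrix} A_1 & 0\\ -B^{\circ} & -\hat S_e\end{bmatrix},\qquad \hat S_e=\rho\,\mathbf{w}\mathbf{w}^T+M_p^{\circ}.$$ Let $\mathbf{r}_k$ denote the residual after $k\ge1$ steps of GMRES applied to a preconditioned linear system associated with the coefficient matrix $\mathcal{P}_{t,e}^{-1}\mathcal{A}_e$, with $\mathbf r_0\neq 0$. Then $$\frac{\|\mathbf{r}_k\|}{\|\mathbf{r}_0\|}\le 2\left(1+\left(\frac{d\,\lambda_{\max}(M_p^{\circ})}{\lambda_{\min}(A_1)}\right)^{\frac12}+d+\epsilon\right)\left(\frac{\sqrt{d+\epsilon}-\sqrt{C_3}}{\sqrt{d+\epsilon}+\sqrt{C_3}}+\mathcal{O}(h^d)\right)^{k-1},$$ where $$C_3=\beta^2\,\frac{\lambda_{\min}(M_p^{\circ})}{\lambda_{\max}(M_p^{\circ})}\,\gamma^2,\qquad \gamma=\mathbf{1}^T\mathbf{w}=\frac{|\Omega|}{\sqrt{N}\sqrt{\sum_{K\in\mathcal{T}_h}|K|^2}}.$$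
   Context: $\Omega\subset\mathbb{R}^d$ ($d\ge1$) is a bounded domain with Lipschitz boundary, $\{\mathcal{T}_h\}$ is a family of quasi-uniform simplicial meshes of $\Omega$, $h$ is the maximum element diameter, and $N$ is the number of elements $K_1,\dots,K_N$ of $\mathcal{T}_h$. $\lambda,\mu>0$ are the Lamé constants and $\epsilon=\mu/(\lambda+\mu)$. $\mathcal{O}(h^d)$ denotes a quantity bounded in absolute value by $Ch^d$ with $C$ independent of $h$ and $\lambda$. $\lambda_{\min},\lambda_{\max}$ denote smallest and largest eigenvalues; $\|\cdot\|$ is the Euclidean norm, and the residual is that of the (left-)preconditioned system. Discrete space: $\mathbf{V}_h^0$ is the space of $\mathbf{u}_h=\{\mathbf{u}_h^\circ,\mathbf{u}_h^\partial\}$ with $\mathbf{u}_h^\circ$ a constant vector in $\mathbb{R}^d$ on each element interior, $\mathbf{u}_h^\partial$ a constant vector in $\mathbb{R}^d$ on each facet (single-valued), and $\mathbf{u}_h^\partial=0$ on facets on $\partial\Omega$. For a scalar weak function $u_h=\{u_h^\circ,u_h^\partial\}$, the weak gradient $\nabla_w u_h$ satisfies, on each $K$, $\nabla_w u_h|_K\in RT_0(K)=(P_0(K))^d+\mathbf{x}P_0(K)$ and $(\nabla_w u_h,\mathbf{v})_K=(u_h^\partial,\mathbf{v}\cdot\mathbf{n})_{\partial K}-(u_h^\circ,\nabla\cdot\mathbf{v})_K$ for all $\mathbf{v}\in RT_0(K)$, with $\mathbf{n}$ the unit outward normal; for vector-valued functions $\nabla_w$ is applied to each component (as rows of a matrix).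 The weak divergence $\nabla_w\cdot\mathbf{u}_h$ is the piecewise constant with $\nabla_w\cdot\mathbf{u}_h|_K=\frac{1}{|K|}\int_{\partial K}\mathbf{u}_h^\partial\cdot\mathbf{n}$. Functions are identified with their vectors of degrees of freedom. Matrices: $\mathbf{v}_h^TA_1\mathbf{u}_h=\sum_{K}(\nabla_w\mathbf{u}_h,\nabla_w\mathbf{v}_h)_K$ for $\mathbf{u}_h,\mathbf{v}_h\in\mathbf{V}_h^0$ ($A_1$ is symmetric positive definite); $\mathbf{q}^TB^\circ\mathbf{u}_h=\sum_K(\nabla_w\cdot\mathbf{u}_h,q)_K$ for $\mathbf{u}_h\in\mathbf{V}_h^0$ and $q$ piecewise constant on $\mathcal{T}_h$ (so $\mathbf{q}\in\mathbb{R}^N$); $M_p^\circ=\mathrm{diag}(|K_1|,\dots,|K_N|)$. Vectors: $\mathbf{1}=N^{-1/2}(1,\dots,1)^T\in\mathbb{R}^N$, $\mathbf{w}=M_p^\circ\mathbf{1}/\|M_p^\circ\mathbf{1}\|$. $0<\beta<1$ is the discrete inf-sup constant, independent of $h$: $\sup_{\mathbf{v}_h\in\mathbf{V}_h^0\setminus\{0\}}\frac{\mathbf{p}^TB^\circ\mathbf{v}_h}{(\mathbf{v}_h^TA_1\mathbf{v}_h)^{1/2}}\ge\beta\,(\mathbf{p}^TM_p^\circ\mathbf{p})^{1/2}$ for all $\mathbf{p}\in\mathbb{R}^N$ with $\mathbf{1}^TM_p^\circ\mathbf{p}=0$. *)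

theory Defs
  imports "HOL-Analysis.Analysis" "Jordan_Normal_Form.Spectral_Radius"
    "Jordan_Normal_Form.Gauss_Jordan_Elimination"
begin

unbundle no vec_syntax
no_notation scalar_prod (infix "\<bullet>" 70)

subsection \<open>Domains and meshes\<close>

text \<open>Near each boundary point, and after a rotation taking \<open>e\<close> to the last coordinate direction,
  \<open>\<Omega>\<close> is the set of points strictly above the graph of a Lipschitz function \<open>g\<close>, whose argument is
  the component of the point orthogonal to \<open>e\<close>.\<close>
definition lipschitz_boundary :: "'a::euclidean_space set \<Rightarrow> bool" where
  "lipschitz_boundary \<Omega> \<longleftrightarrow>
     (\<forall>x\<in>frontier \<Omega>. \<exists>e r L g. norm e = 1 \<and> 0 < r \<and> L-lipschitz_on {z. z \<bullet> e = 0} g \<and>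
        \<Omega> \<inter> ball x r = {y \<in> ball x r. g (y - (y \<bullet> e) *\<^sub>R e) < y \<bullet> e})"

definition bounded_lipschitz_domain :: "'a::euclidean_space set \<Rightarrow> bool" where
  "bounded_lipschitz_domain \<Omega> \<longleftrightarrow>
     open \<Omega> \<and> connected \<Omega> \<and> \<Omega> \<noteq> {} \<and> bounded \<Omega> \<and> lipschitz_boundary \<Omega>"

text \<open>Elements are closed simplices; \<^const>\<open>triangulation\<close> makes the mesh finite and conforming.\<close>
definition simplicial_mesh :: "'a::euclidean_space set \<Rightarrow> 'a set set \<Rightarrow> bool" where
  "simplicial_mesh \<Omega> T \<longleftrightarrow>
     triangulation T \<and> (\<forall>K\<in>T. int DIM('a) simplex K) \<and> \<Union>T = closure \<Omega>"

definition mesh_size :: "'a::euclidean_space set set \<Rightarrow> real" where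
  "mesh_size T = Max (diameter ` T)"

text \<open>Every element contains a ball of size comparable to the global mesh size, uniformly over the
  family; this comprises shape regularity.\<close>
definition quasi_uniform_family :: "'a::euclidean_space set \<Rightarrow> 'a set set set \<Rightarrow> bool" where
  "quasi_uniform_family \<Omega> \<T> \<longleftrightarrow>
     (\<forall>T\<in>\<T>. simplicial_mesh \<Omega> T) \<and>
     (\<exists>\<sigma>>0. \<forall>T\<in>\<T>. \<forall>K\<in>T. \<exists>x. cball x (\<sigma> * mesh_size T) \<subseteq> K)"

abbreviation lvol :: "'a::euclidean_space set \<Rightarrow> real" where
  "lvol S \<equiv> measure lebesgue S"

subsection \<open>Facets\<close>

definition outward_normal :: "'a::euclidean_space set \<Rightarrow> 'a set \<Rightarrow> 'a" where
  "outward_normal K F =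
     (THE n. norm n = 1 \<and> (\<exists>c. (\<forall>x\<in>F. n \<bullet> x = c) \<and> (\<forall>x\<in>K. n \<bullet> x \<le> c)))"

text \<open>Integration of \<open>g\<close> over the flat facet \<open>F\<close> with unit normal \<open>n\<close> against the
  \<open>(d-1)\<close>-dimensional measure: by Fubini it is the integral, over the right cylinder of height one
  with base \<open>F\<close>, of \<open>g\<close> evaluated at the foot point in \<open>F\<close>. For \<open>d = 1\<close> it is evaluation at the
  point \<open>F\<close>.\<close>
definition facet_integral :: "'a::euclidean_space set \<Rightarrow> 'a \<Rightarrow> ('a \<Rightarrow> real) \<Rightarrow> real" where
  "facet_integral F n g =
     integral {x + t *\<^sub>R n |x t. x \<in> F \<and> t \<in> {0..1}} (\<lambda>y. g (closest_point F y))"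

definition boundary_integral ::
    "'a::euclidean_space set \<Rightarrow> ('a set \<Rightarrow> 'a \<Rightarrow> 'a \<Rightarrow> real) \<Rightarrow> real" where
  "boundary_integral K g =
     (\<Sum>F | F facet_of K. facet_integral F (outward_normal K F) (g F (outward_normal K F)))"

subsection \<open>Weak gradient and weak divergence\<close>

definition divergence :: "('a::euclidean_space \<Rightarrow> 'a) \<Rightarrow> 'a \<Rightarrow> real" where
  "divergence v x = (\<Sum>i\<in>Basis. frechet_derivative v (at x) i \<bullet> i)"

text \<open>An element of \<open>RT\<^sub>0(K)\<close> is represented by its unique extension to a polynomial field on the
  whole space.\<close>
definition RT0 :: "('a::euclidean_space \<Rightarrow> 'a) set" where
  "RT0 = {v. \<exists>a c. v = (\<lambda>x. a + c *\<^sub>R x)}"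

text \<open>Weak gradient on \<open>K\<close> of the scalar weak function with interior value \<open>u0\<close> and value \<open>ub F\<close> on
  each facet \<open>F\<close> of \<open>K\<close>.\<close>
definition weak_gradient ::
    "'a::euclidean_space set \<Rightarrow> real \<Rightarrow> ('a set \<Rightarrow> real) \<Rightarrow> 'a \<Rightarrow> 'a" where
  "weak_gradient K u0 ub =
     (THE g. g \<in> RT0 \<and>
        (\<forall>v\<in>RT0. integral K (\<lambda>x. g x \<bullet> v x) =
           boundary_integral K (\<lambda>F n x. ub F * (v x \<bullet> n)) - integral K (\<lambda>x. u0 * divergence v x)))"

text \<open>A vector-valued weak function: one vector per element interior and one per facet.\<close>
type_synonym 'a weak_fun = "('a set \<Rightarrow> 'a) \<times> ('a set \<Rightarrow> 'a)"

text \<open>Row \<open>i\<close> of the weak gradient is the weak gradient of the \<open>i\<close>-th component.\<close>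
definition weak_gradient_row ::
    "'a::euclidean_space set \<Rightarrow> 'a weak_fun \<Rightarrow> 'a \<Rightarrow> 'a \<Rightarrow> 'a" where
  "weak_gradient_row K u i = weak_gradient K (fst u K \<bullet> i) (\<lambda>F. snd u F \<bullet> i)"

definition weak_divergence :: "'a::euclidean_space set \<Rightarrow> 'a weak_fun \<Rightarrow> real" where
  "weak_divergence K u = boundary_integral K (\<lambda>F n x. snd u F \<bullet> n) / lvol K"

definition gradient_form ::
    "'a::euclidean_space set set \<Rightarrow> 'a weak_fun \<Rightarrow> 'a weak_fun \<Rightarrow> real" where
  "gradient_form T u v =
     (\<Sum>K\<in>T. integral K (\<lambda>x. \<Sum>i\<in>Basis. weak_gradient_row K u i x \<bullet> weak_gradient_row K v i x))"

definition divergence_form ::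
    "'a::euclidean_space set set \<Rightarrow> 'a weak_fun \<Rightarrow> ('a set \<Rightarrow> real) \<Rightarrow> real" where
  "divergence_form T u q = (\<Sum>K\<in>T. integral K (\<lambda>x. weak_divergence K u * q K))"

subsection \<open>Degrees of freedom\<close>

datatype 'a dof = Elem_Dof "'a set" 'a | Facet_Dof "'a set" 'a

text \<open>The degrees of freedom of \<open>V\<^sub>h\<^sup>0\<close>: the components of the values on the element interiors and on
  the facets not lying on the boundary of \<open>\<Omega>\<close>.\<close>
definition dofs :: "'a::euclidean_space set \<Rightarrow> 'a set set \<Rightarrow> 'a dof set" where
  "dofs \<Omega> T = {Elem_Dof K i |K i. K \<in> T \<and> i \<in> Basis} \<union>
     {Facet_Dof F i |F i. (\<exists>K\<in>T. F facet_of K) \<and> \<not> F \<subseteq> frontier \<Omega> \<and> i \<in> Basis}"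

text \<open>\<open>Ks\<close> numbers the elements of a mesh and \<open>ds\<close> numbers the degrees of freedom of \<open>V\<^sub>h\<^sup>0\<close>.\<close>
definition numbering ::
    "'a::euclidean_space set \<Rightarrow> 'a set set \<Rightarrow> 'a set list \<Rightarrow> 'a dof list \<Rightarrow> bool" where
  "numbering \<Omega> T Ks ds \<longleftrightarrow>
     distinct Ks \<and> set Ks = T \<and> distinct ds \<and> set ds = dofs \<Omega> T"

definition dof_value :: "'a dof list \<Rightarrow> real vec \<Rightarrow> 'a dof \<Rightarrow> real" where
  "dof_value ds x p = (\<Sum>j<length ds. if ds ! j = p then x $ j else 0)"

text \<open>The weak function with a given vector of degrees of freedom; it vanishes on boundary facets
  because these carry no degree of freedom.\<close>
definition weak_fun_of :: "'a::euclidean_space dof list \<Rightarrow> real vec \<Rightarrow> 'a weak_fun" where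
  "weak_fun_of ds x =
     (\<lambda>K. \<Sum>i\<in>Basis. dof_value ds x (Elem_Dof K i) *\<^sub>R i,
      \<lambda>F. \<Sum>i\<in>Basis. dof_value ds x (Facet_Dof F i) *\<^sub>R i)"

definition basis_fun :: "'a::euclidean_space dof list \<Rightarrow> nat \<Rightarrow> 'a weak_fun" where
  "basis_fun ds j = weak_fun_of ds (unit_vec (length ds) j)"

subsection \<open>Matrices and vectors\<close>

text \<open>\<open>A1_mat\<close> and \<open>B_mat\<close> are the matrices of the bilinear forms above in the bases given by the
  degrees of freedom.\<close>
definition A1_mat :: "'a::euclidean_space set list \<Rightarrow> 'a dof list \<Rightarrow> real mat" where
  "A1_mat Ks ds = mat (length ds) (length ds)
     (\<lambda>(i, j). gradient_form (set Ks) (basis_fun ds j) (basis_fun ds i))"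

definition B_mat :: "'a::euclidean_space set list \<Rightarrow> 'a dof list \<Rightarrow> real mat" where
  "B_mat Ks ds = mat (length Ks) (length ds)
     (\<lambda>(i, j). divergence_form (set Ks) (basis_fun ds j) (\<lambda>K. if K = Ks ! i then 1 else 0))"

definition Mp_mat :: "'a::euclidean_space set list \<Rightarrow> real mat" where
  "Mp_mat Ks = mat_diag (length Ks) (\<lambda>i. lvol (Ks ! i))"

definition vnorm :: "real vec \<Rightarrow> real" where
  "vnorm x = sqrt (scalar_prod x x)"

definition one_vec :: "nat \<Rightarrow> real vec" where
  "one_vec N = vec N (\<lambda>i. 1 / sqrt (real N))"

definition w_vec :: "'a::euclidean_space set list \<Rightarrow> real vec" where
  "w_vec Ks = (1 / vnorm (Mp_mat Ks *\<^sub>v one_vec (length Ks))) \<cdot>\<^sub>v (Mp_mat Ks *\<^sub>v one_vec (length Ks))"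

definition outer_prod :: "real vec \<Rightarrow> real vec \<Rightarrow> real mat" where
  "outer_prod x y = mat (dim_vec x) (dim_vec y) (\<lambda>(i, j). x $ i * y $ j)"

text \<open>Used for symmetric matrices only, whose eigenvalues are all real.\<close>
definition lambda_min :: "real mat \<Rightarrow> real" where
  "lambda_min A = Min (spectrum A)"

definition lambda_max :: "real mat \<Rightarrow> real" where
  "lambda_max A = Max (spectrum A)"

definition S_hat :: "real \<Rightarrow> 'a::euclidean_space set list \<Rightarrow> real mat" where
  "S_hat \<rho> Ks = \<rho> \<cdot>\<^sub>m outer_prod (w_vec Ks) (w_vec Ks) + Mp_mat Ks"

definition system_mat ::
    "real \<Rightarrow> real \<Rightarrow> 'a::euclidean_space set list \<Rightarrow> 'a dof list \<Rightarrow> real mat" where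
  "system_mat \<epsilon> \<rho> Ks ds = four_block_mat
     (A1_mat Ks ds)    (- transpose_mat (B_mat Ks ds))
     (- B_mat Ks ds)   (- (\<epsilon> \<cdot>\<^sub>m Mp_mat Ks) - \<rho> \<cdot>\<^sub>m outer_prod (w_vec Ks) (w_vec Ks))"

definition precond_mat ::
    "real \<Rightarrow> 'a::euclidean_space set list \<Rightarrow> 'a dof list \<Rightarrow> real mat" where
  "precond_mat \<rho> Ks ds = four_block_mat
     (A1_mat Ks ds)    (0\<^sub>m (length ds) (length Ks))
     (- B_mat Ks ds)   (- S_hat \<rho> Ks)"

definition preconditioned_mat ::
    "real \<Rightarrow> real \<Rightarrow> 'a::euclidean_space set list \<Rightarrow> 'a dof list \<Rightarrow> real mat" where
  "preconditioned_mat \<epsilon> \<rho> Ks ds =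
     the (mat_inverse (precond_mat \<rho> Ks ds)) * system_mat \<epsilon> \<rho> Ks ds"

definition inf_sup_condition ::
    "real \<Rightarrow> 'a::euclidean_space set list \<Rightarrow> 'a dof list \<Rightarrow> bool" where
  "inf_sup_condition \<beta> Ks ds \<longleftrightarrow>
     (\<forall>p\<in>carrier_vec (length Ks).
        scalar_prod (one_vec (length Ks)) (Mp_mat Ks *\<^sub>v p) = 0 \<longrightarrow>
        \<beta> * sqrt (scalar_prod p (Mp_mat Ks *\<^sub>v p)) \<le>
          (SUP v\<in>carrier_vec (length ds) - {0\<^sub>v (length ds)}.
             scalar_prod p (B_mat Ks ds *\<^sub>v v) / sqrt (scalar_prod v (A1_mat Ks ds *\<^sub>v v))))"

definition gamma_const :: "'a::euclidean_space set list \<Rightarrow> real" where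
  "gamma_const Ks = scalar_prod (one_vec (length Ks)) (w_vec Ks)"

definition C3_const :: "real \<Rightarrow> 'a::euclidean_space set list \<Rightarrow> real" where
  "C3_const \<beta> Ks =
     \<beta>\<^sup>2 * (lambda_min (Mp_mat Ks) / lambda_max (Mp_mat Ks)) * (gamma_const Ks)\<^sup>2"

subsection \<open>GMRES\<close>

definition krylov_space :: "real mat \<Rightarrow> real vec \<Rightarrow> nat \<Rightarrow> real vec set" where
  "krylov_space Z r k =
     LinearCombinations.module.span class_ring (module_vec TYPE(real) (dim_vec r))
       ((\<lambda>j. (Z ^\<^sub>m j) *\<^sub>v r) ` {..<k})"

text \<open>\<open>x\<close> is the iterate after \<open>k\<close> steps (in exact arithmetic, without restart) of GMRES for
  \<open>Z x = b\<close> with initial guess \<open>x0\<close>.\<close>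
definition gmres_iterate :: "real mat \<Rightarrow> real vec \<Rightarrow> real vec \<Rightarrow> nat \<Rightarrow> real vec \<Rightarrow> bool" where
  "gmres_iterate Z b x0 k x \<longleftrightarrow>
     (let X = (\<lambda>z. x0 + z) ` krylov_space Z (b - Z *\<^sub>v x0) k
      in x \<in> X \<and> (\<forall>y\<in>X. vnorm (b - Z *\<^sub>v x) \<le> vnorm (b - Z *\<^sub>v y)))"

end

theory Submission
  imports Defs
begin

text \<open>The preconditioned matrix \<open>Z\<close> is block upper triangular with diagonal blocks \<open>I\<close> and \<open>G\<close>,
  the preconditioned Schur complement. Applying the polynomial \<open>(1 - z) p(z)\<close>, with \<open>p\<close> a scaled
  Chebyshev polynomial of degree \<open>k - 1\<close>, to the initial residual annihilates the first block
  and leaves a vector controlled by \<open>p(G)\<close>.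

  Since \<open>B\<^sup>T\<close> annihilates constants, \<open>G\<close> is self-adjoint not only for the preconditioner but
  also for the diagonal mass matrix \<open>M\<close>. Its spectrum consists of \<open>1 - O(h\<^sup>d)\<close>, with the constant
  eigenvector, and a part in \<open>[\<beta>\<^sup>2, d + \<epsilon>]\<close>, by the inf-sup condition and by
  \<open>(\<nabla>\<^sub>w \<cdot> u)\<^sup>2 \<le> d \<bar>\<nabla>\<^sub>w u\<bar>\<^sup>2\<close>. So for small \<open>h\<close> the Chebyshev rate for \<open>[\<beta>\<^sup>2, d + \<epsilon>]\<close>
  is available in the \<open>M\<close>-norm. Passing to the Euclidean norm costs the square root of the
  condition number of \<open>M\<close>, which is absorbed because this condition number also enters \<open>C\<^sub>3\<close> and
  makes the claimed rate slower. For the remaining \<open>h\<close>, which are bounded below, the perturbation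
  of order \<open>h\<^sup>d\<close> makes the bound exceed \<open>1\<close>.\<close>

subsection \<open>Scalar inequalities\<close>

text \<open>The inner product of the preconditioner would cost, on return to the Euclidean norm, a
  condition number involving \<open>\<rho>\<close>. The mass matrix costs exactly
  \<open>lambda_max M / lambda_min M\<close>, the ratio inside \<open>C3\<close>; only because the
  two match can the loss be absorbed, as the stated prefactor has no room for it. No spectral
  decomposition of \<open>G\<close> is used: the pair \<open>T_(j+1)(L) x\<close>,
  \<open>U_j(L) x\<close> is carried by a coupled recursion whose quadratic invariant bounds the
  first member, so two-sided bounds on the quadratic form of \<open>G\<close> are all that has to be
  proved. The line between small and remaining h is drawn by \<open>\<beta>\<^sup>2 * nrm \<le>
  \<rho> * gam * (1 - \<beta>\<^sup>2)\<close>. It keeps the eigenvalue of the constants above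
  \<open>\<beta>\<^sup>2\<close> for every \<epsilon> between 0 and 1, so the constant in the
  perturbation does not depend on the Lame parameter. Accordingly the perturbation of the rate is 0
  or 1 for a given mesh, never the size of an eigenvalue shift.\<close>

lemma quadratic_nonneg_discriminant:
  fixes a b c :: real
  assumes "\<And>t. 0 \<le> a + 2 * t * b + t\<^sup>2 * c"
  shows "b\<^sup>2 \<le> a * c"
proof (cases "c = 0")
  case True
  have "b = 0"
  proof (rule ccontr)
    assume "b \<noteq> 0"
    then show False using assms[of "- (a + 1) / (2 * b)"] True by (simp add: field_simps)
  qed
  then show ?thesis using True by simp
next
  case False
  have "c \<ge> 0"
  proof (rule ccontr)
    assume "\<not> c \<ge> 0"
    then have c: "c < 0" by simp
    define t where "t = (\<bar>a\<bar> + 2 * \<bar>b\<bar> + 1) / (- c) + 1"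
    have t1: "t \<ge> 1" using c by (simp add: t_def divide_simps)
    have tc: "t * c \<le> - (\<bar>a\<bar> + 2 * \<bar>b\<bar> + 1)" using c by (simp add: t_def field_simps)
    have "a + 2 * t * b + t\<^sup>2 * c = a + t * (2 * b + t * c)"
        by (simp add: power2_eq_square algebra_simps)
    also have "\<dots> \<le> a + t * (- \<bar>a\<bar> - 1)"
      using tc t1 by (intro add_left_mono mult_left_mono) auto
    also have "\<dots> \<le> a + 1 * (- \<bar>a\<bar> - 1)"
      using t1 by (intro add_left_mono mult_right_mono_neg) auto
    also have "\<dots> < 0" by simp
    finally show False using assms[of t] by simp
  qed
  with False have "c > 0" by simp
  then show ?thesis using assms[of "- b / c"] by (simp add: field_simps power2_eq_square)
qed

text \<open>With \<open>g x = ln (1 - x) - ln (1 + x)\<close> concave on \<open>[0, 1)\<close> and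
  \<open>g 0 = 0\<close>, the chord from 0 to \<open>s\<close> lies below the graph at
  \<open>s * t\<close>.\<close>

lemma ln_mobius_scale:
  fixes s t :: real
  assumes s: "0 < s" "s < 1" and t: "0 < t" "t \<le> 1"
  shows "t * ln ((1 - s) / (1 + s)) \<le> ln ((1 - s * t) / (1 + s * t))"
proof -
  define g where "g x = ln (1 - x) - ln (1 + x)" for x :: real
  define g' where "g' x = - (1 / (1 - x)) - 1 / (1 + x)" for x :: real
  define g'' where "g'' x = - (1 / (1 - x)\<^sup>2) + 1 / (1 + x)\<^sup>2" for x :: real
  have "concave_on {0..<1} g"
  proof (rule f''_le0_imp_concave)
    show "convex {0..<1::real}" by simp
    fix x :: real assume x: "x \<in> {0..<1}"
    show "(g has_real_derivative g' x) (at x)"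
      unfolding g_def g'_def using x by (auto intro!: derivative_eq_intros)
    show "(g' has_real_derivative g'' x) (at x)"
      unfolding g'_def g''_def using x by (auto intro!: derivative_eq_intros simp: power2_eq_square)
    have "(1 - x)\<^sup>2 \<le> (1 + x)\<^sup>2" using x by (intro power_mono) auto
    then show "g'' x \<le> 0" using x by (simp add: g''_def frac_le)
  qed
  then have "(1 - t) * g 0 + t * g s \<le> g ((1 - t) *\<^sub>R 0 + t *\<^sub>R s)"
    using s t by (intro concave_onD[where A = "{0..<1}"]) auto
  moreover have "s * t < 1" using le_less_trans[OF mult_left_le s(2), of t] s t by simp
  moreover have "0 < s * t" using s t by simp
  then have "1 + s * t \<noteq> 0" by linarith
  ultimately show ?thesis using s t by (simp add: g_def ln_div mult.commute)
qed

text \<open>The condition number \<open>1 / t\<^sup>2\<close> of the change of norm is absorbed by the slower rate: either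
  the right-hand side still exceeds \<open>1\<close>, or the gain \<open>(q / y)\<^sup>j\<close> is at most \<open>t\<close>.\<close>
lemma residual_rate_absorb:
  fixes s t R D q y :: real
  assumes s: "0 < s" "s < 1" and t: "0 < t" "t \<le> 1" and D: "2 \<le> D" and R: "R \<le> 1"
    and q: "q = (1 - s) / (1 + s)" and y: "(1 - s * t) / (1 + s * t) \<le> y"
    and RD: "R \<le> D * (1 / t) * (2 * q ^ j)"
  shows "R \<le> 2 * D * y ^ j"
proof -
  define z where "z = (1 - s * t) / (1 + s * t)"
  have st: "0 < s * t" "s * t < 1" using le_less_trans[OF mult_left_le s(2), of t] s t by simp_all
  have z: "0 < z" using st by (simp add: z_def)
  have q0: "0 < q" using s by (simp add: q)
  have zy: "z ^ j \<le> y ^ j" using y z by (intro power_mono) (auto simp: z_def)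
  show ?thesis
  \<comment> \<open>The threshold serves both cases: \<open>D \<ge> 2\<close> gives
    \<open>2 * D / 4 \<ge> 1\<close>, and below it \<open>j * ln z < - ln 4 \<le> - 1\<close>, which
    turns the gain \<open>(1 / t - 1) * (j * ln z)\<close> into at most
    \<open>- (1 / t - 1) \<le> ln t\<close>.\<close>
  proof (cases "z ^ j \<ge> 1 / 4")
    case True
    then have "1 / 4 \<le> y ^ j" using zy by simp
    then have "2 * D * (1 / 4) \<le> 2 * D * y ^ j" using D by (intro mult_left_mono) auto
    moreover have "1 \<le> 2 * D * (1 / 4)" using D by simp
    ultimately show ?thesis using R by linarith
  next
    case False
    then have "ln (z ^ j) < ln (1 / 4)" using z by (subst ln_less_cancel_iff) auto
    then have jz: "j * ln z < - ln 4" using z by (simp add: ln_realpow ln_div)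
    have "ln (4::real) \<ge> 1"
    proof -
      have "exp (1::real) \<le> 4" using exp_le by simp
      then show ?thesis using ln_ge_iff[of "4::real" 1] by simp
    qed
    with jz have jz1: "j * ln z \<le> - 1" by simp
    have "ln q \<le> (1 / t) * ln z"
      using ln_mobius_scale[OF s t] t by (simp add: q z_def field_simps)
    then have "j * ln q \<le> j * ((1 / t) * ln z)" by (intro mult_left_mono) auto
    then have "j * ln q - j * ln z \<le> (1 / t - 1) * (j * ln z)" by (simp add: algebra_simps)
    also have "\<dots> \<le> (1 / t - 1) * (- 1)"
      using t jz1 by (intro mult_left_mono) (auto simp: divide_simps)
    also have "\<dots> = - (1 / t - 1)" by simp
    also have "\<dots> \<le> - ln (1 / t)"
      using ln_le_minus_one[of "1 / t"] t by simp
    also have "\<dots> = ln t" using t by (simp add: ln_div)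
    finally have "ln (q ^ j) \<le> ln (t * z ^ j)"
      using q0 z t by (simp add: ln_realpow ln_mult)
    then have "q ^ j \<le> t * z ^ j" using q0 z t by (subst (asm) ln_le_cancel_iff) auto
    also have "\<dots> \<le> t * y ^ j" using zy t by simp
    finally have "D * (1 / t) * (2 * q ^ j) \<le> D * (1 / t) * (2 * (t * y ^ j))"
      using D t by (intro mult_left_mono) auto
    then show ?thesis using RD t by simp
  qed
qed

subsection \<open>Real symmetric matrices\<close>

lemma scalar_prod_self_nonneg: "0 \<le> scalar_prod x (x::real vec)"
  unfolding scalar_prod_def by (rule sum_nonneg) simp

lemma scalar_prod_self_eq_0:
  assumes "(x::real vec) \<in> carrier_vec n" "scalar_prod x x = 0" shows "x = 0\<^sub>v n"
proof -
  have "\<forall>i\<in>{0..<n}. x $ i * x $ i = 0"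
    using assms unfolding scalar_prod_def by (subst (asm) sum_nonneg_eq_0_iff) auto
  then show ?thesis using assms by (intro eq_vecI) auto
qed

lemma vnorm_power2: "(vnorm x)\<^sup>2 = scalar_prod x x"
  by (simp add: vnorm_def scalar_prod_self_nonneg)

lemma vnorm_pos: "x \<in> carrier_vec n \<Longrightarrow> x \<noteq> 0\<^sub>v n \<Longrightarrow> 0 < vnorm x"
  using scalar_prod_self_eq_0[of x n] scalar_prod_self_nonneg[of x]
      by (auto simp: vnorm_def less_le)

lemma scalar_prod_Cauchy_Schwarz:
  assumes "(x::real vec) \<in> carrier_vec n" "y \<in> carrier_vec n"
  shows "(scalar_prod x y)\<^sup>2 \<le> scalar_prod x x * scalar_prod y y"
  using Cauchy_Schwarz_ineq_sum[of "\<lambda>i. x $ i" "\<lambda>i. y $ i" "{0..<n}"] assms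
  by (simp add: scalar_prod_def power2_eq_square)

lemma mult_mat_vec_bound:
  assumes A: "(A::real mat) \<in> carrier_mat n n"
  obtains k where "0 < k" "\<And>x. x \<in> carrier_vec n \<Longrightarrow> scalar_prod (A *\<^sub>v x) (A *\<^sub>v x) \<le> k *
      scalar_prod x x"
proof
  let ?k = "\<Sum>i<n. scalar_prod (row A i) (row A i)"
  have k0: "?k \<ge> 0" by (intro sum_nonneg scalar_prod_self_nonneg)
  then show "0 < ?k + 1" by simp
  fix x :: "real vec" assume x: "x \<in> carrier_vec n"
  have "scalar_prod (A *\<^sub>v x) (A *\<^sub>v x) = (\<Sum>i<n. (scalar_prod (row A i) x)\<^sup>2)"
    using A by (simp add: scalar_prod_def[of "A *\<^sub>v x"] power2_eq_square lessThan_atLeast0)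
  also have "\<dots> \<le> (\<Sum>i<n. scalar_prod (row A i) (row A i) * scalar_prod x x)"
    using A x by (intro sum_mono scalar_prod_Cauchy_Schwarz) auto
  also have "\<dots> \<le> (?k + 1) * scalar_prod x x"
    by (simp add: sum_distrib_right distrib_right scalar_prod_self_nonneg)
  finally show "scalar_prod (A *\<^sub>v x) (A *\<^sub>v x) \<le> (?k + 1) * scalar_prod x x" .
qed

lemma sym_scalar_prod:
  assumes A: "(A::real mat) \<in> carrier_mat n n" "transpose_mat A = A"
    and x: "x \<in> carrier_vec n" and y: "y \<in> carrier_vec n"
  shows "scalar_prod x (A *\<^sub>v y) = scalar_prod y (A *\<^sub>v x)"
  using transpose_vec_mult_scalar[OF A(1) y x] A x y
      by (metis comm_scalar_prod mult_mat_vec_carrier)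

lemma psd_Cauchy_Schwarz:
  assumes A: "(A::real mat) \<in> carrier_mat n n" "transpose_mat A = A"
    and psd: "\<And>x. x \<in> carrier_vec n \<Longrightarrow> 0 \<le> scalar_prod x (A *\<^sub>v x)"
    and x: "x \<in> carrier_vec n" and y: "y \<in> carrier_vec n"
  shows "(scalar_prod x (A *\<^sub>v y))\<^sup>2 \<le> scalar_prod x (A *\<^sub>v x) * scalar_prod y (A *\<^sub>v y)"
proof (rule quadratic_nonneg_discriminant)
  fix t :: real
  have "0 \<le> scalar_prod (x + t \<cdot>\<^sub>v y) (A *\<^sub>v (x + t \<cdot>\<^sub>v y))"
    using x y by (intro psd) auto
  also have "A *\<^sub>v (x + t \<cdot>\<^sub>v y) = A *\<^sub>v x + t \<cdot>\<^sub>v (A *\<^sub>v y)"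
    using A x y by (simp add: mult_add_distrib_mat_vec[of _ n n] mult_mat_vec[of _ n n])
  also have "scalar_prod (x + t \<cdot>\<^sub>v y) (A *\<^sub>v x + t \<cdot>\<^sub>v (A *\<^sub>v y)) =
      scalar_prod x (A *\<^sub>v x) + 2 * t * scalar_prod x (A *\<^sub>v y) + t\<^sup>2 * scalar_prod y (A *\<^sub>v y)"
    using A x y sym_scalar_prod[OF A y x]
    by (simp add: scalar_prod_add_distrib[of _ n] add_scalar_prod_distrib[of _ n] power2_eq_square
        algebra_simps)
  finally show "0 \<le> scalar_prod x (A *\<^sub>v x) + 2 * t * scalar_prod x (A *\<^sub>v y) + t\<^sup>2 * scalar_prod
      y (A *\<^sub>v y)" .
qed

text \<open>\<open>mat_inverse\<close> is partial; a trivial kernel is what makes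
  \<open>the (mat_inverse A)\<close> in the definition of the preconditioned matrix a genuine
  inverse.\<close>

lemma det_nonzero_inverse:
  assumes A: "(A::real mat) \<in> carrier_mat n n"
    and ker: "\<And>v. v \<in> carrier_vec n \<Longrightarrow> A *\<^sub>v v = 0\<^sub>v n \<Longrightarrow> v = 0\<^sub>v n"
  obtains D where "mat_inverse A = Some D" "A * D = 1\<^sub>m n" "D * A = 1\<^sub>m n" "D \<in> carrier_mat n n"
proof -
  have "det A \<noteq> 0" using det_0_iff_vec_prod_zero_field[OF A] ker by blast
  then have "A \<in> Units (ring_mat TYPE(real) n ())" by (rule det_non_zero_imp_unit[OF A])
  then have "mat_inverse A \<noteq> None"
    using mat_inverse(1)[OF A, of "()"] by blast
  then obtain D where "mat_inverse A = Some D" by blast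
  then show thesis using that mat_inverse(2)[OF A] by blast
qed

text \<open>Shifting by the infimum of the Rayleigh quotient leaves a semidefinite matrix which, if
  it were regular, would be coercive by Cauchy--Schwarz; so that infimum is an eigenvalue.\<close>
lemma lambda_min_Rayleigh:
  assumes A: "(A::real mat) \<in> carrier_mat n n" "transpose_mat A = A" and n: "0 < n"
    and pd: "\<And>x. x \<in> carrier_vec n \<Longrightarrow> x \<noteq> 0\<^sub>v n \<Longrightarrow> 0 < scalar_prod x (A *\<^sub>v x)"
  shows "0 < lambda_min A"
    and "x \<in> carrier_vec n \<Longrightarrow> lambda_min A * scalar_prod x x \<le> scalar_prod x (A *\<^sub>v x)"
proof -
  define S where "S = {scalar_prod x (A *\<^sub>v x) |x. x \<in> carrier_vec n \<and> scalar_prod x x = 1}"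
  have unit: "scalar_prod (unit_vec n 0) (unit_vec n 0 :: real vec) = 1" using n by simp
  have neS: "S \<noteq> {}" using unit n by (auto simp: S_def intro!: exI[of _ "unit_vec n 0"])
  have psd: "0 \<le> scalar_prod x (A *\<^sub>v x)" if "x \<in> carrier_vec n" for x
    using pd[OF that] A that by (cases "x = 0\<^sub>v n") auto
  have bdd: "bdd_below S" by (rule bdd_belowI[of _ 0]) (auto simp: S_def psd)
  define c where "c = Inf S"
  have c_le: "c * scalar_prod x x \<le> scalar_prod x (A *\<^sub>v x)" if x: "x \<in> carrier_vec n" for x
  proof (cases "x = 0\<^sub>v n")
    case False
    define k where "k = vnorm x"
    have k: "k > 0" using vnorm_pos[OF x False] by (simp add: k_def)
    have k2: "scalar_prod x x = k\<^sup>2" by (simp add: k_def vnorm_power2)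
    have "scalar_prod ((1/k) \<cdot>\<^sub>v x) ((1/k) \<cdot>\<^sub>v x) = 1"
      using x k k2 by (simp add: power2_eq_square)
    moreover have "scalar_prod ((1/k) \<cdot>\<^sub>v x) (A *\<^sub>v ((1/k) \<cdot>\<^sub>v x)) = scalar_prod x (A *\<^sub>v x) / k\<^sup>2"
      using x A by (simp add: mult_mat_vec[of _ n n] power2_eq_square)
    ultimately have "scalar_prod x (A *\<^sub>v x) / k\<^sup>2 \<in> S"
      using x unfolding S_def by (intro CollectI exI[of _ "(1/k) \<cdot>\<^sub>v x"]) auto
    then have "c \<le> scalar_prod x (A *\<^sub>v x) / k\<^sup>2" unfolding c_def using bdd by (rule cInf_lower)
    then show ?thesis using k k2 by (simp add: field_simps)
  qed (use A in auto)
  define C where "C = A - c \<cdot>\<^sub>m 1\<^sub>m n"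
  have C: "C \<in> carrier_mat n n" unfolding C_def by (rule minus_carrier_mat) simp
  have Ct: "transpose_mat C = C"
  proof (rule eq_matI)
    fix i j assume ij: "i < dim_row C" "j < dim_col C"
    have "A $$ (j, i) = A $$ (i, j)" using A ij C by (metis carrier_matD index_transpose_mat(1))
    then show "transpose_mat C $$ (i, j) = C $$ (i, j)" using ij A C by (simp add: C_def)
  qed (use C in auto)
  have Cx: "C *\<^sub>v x = A *\<^sub>v x - c \<cdot>\<^sub>v x" if x: "x \<in> carrier_vec n" for x
  proof -
    have "(c \<cdot>\<^sub>m 1\<^sub>m n) *\<^sub>v x = c \<cdot>\<^sub>v x" using x by (intro eq_vecI) auto
    then show ?thesis using A x by (simp add: C_def minus_mult_distrib_mat_vec[of _ n n])
  qed
  have xCx: "scalar_prod x (C *\<^sub>v x) = scalar_prod x (A *\<^sub>v x) - c * scalar_prod x x"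
      if "x \<in> carrier_vec n" for x
    using that A by (simp add: Cx scalar_prod_minus_distrib[of _ n])
  have Cpsd: "0 \<le> scalar_prod x (C *\<^sub>v x)" if "x \<in> carrier_vec n" for x
    using xCx[OF that] c_le[OF that] by simp
  have "\<exists>v. v \<in> carrier_vec n \<and> v \<noteq> 0\<^sub>v n \<and> C *\<^sub>v v = 0\<^sub>v n"
  proof (rule ccontr)
    assume "\<not> ?thesis"
    then obtain D where D: "D * C = 1\<^sub>m n" "D \<in> carrier_mat n n"
      using det_nonzero_inverse[OF C] by metis
    obtain k where k: "0 < k" "\<And>x. x \<in> carrier_vec n \<Longrightarrow> scalar_prod (D *\<^sub>v x) (D *\<^sub>v x) \<le> k *
        scalar_prod x x"
      using mult_mat_vec_bound[OF D(2)] by metis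
    obtain k' where k': "0 < k'" "\<And>x. x \<in> carrier_vec n \<Longrightarrow> scalar_prod (C *\<^sub>v x) (C *\<^sub>v x) \<le> k' *
        scalar_prod x x"
      using mult_mat_vec_bound[OF C] by metis
    \<comment> \<open>For \<open>y = C x\<close>, the inverse \<open>D\<close> bounds the square of
      \<open>x\<close> by that of \<open>y\<close>. Cauchy--Schwarz for the semidefinite form bounds
      the squared product of \<open>y\<close> with \<open>C x\<close> by the forms of
      \<open>C\<close> at \<open>y\<close> and at \<open>x\<close>; the bound for \<open>C\<close>
      then cancels one square of \<open>y\<close>.\<close>
    have coercive: "scalar_prod x x \<le> k * sqrt k' * scalar_prod x (C *\<^sub>v x)" if x: "x \<in>
        carrier_vec n" for x
    proof -
      let ?y = "C *\<^sub>v x"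
      have y: "?y \<in> carrier_vec n" using C x by simp
      have "x = D *\<^sub>v ?y" using D C x by (metis assoc_mult_mat_vec one_mult_mat_vec)
      then have 1: "scalar_prod x x \<le> k * scalar_prod ?y ?y" using k(2)[OF y] by simp
      have "(scalar_prod ?y (C *\<^sub>v ?y))\<^sup>2 \<le> scalar_prod ?y ?y * (k' * scalar_prod ?y ?y)"
        using scalar_prod_Cauchy_Schwarz[of ?y n "C *\<^sub>v ?y"] C y k'(2)[OF y]
        by (meson mult_left_mono mult_mat_vec_carrier order_trans scalar_prod_self_nonneg)
      also have "\<dots> = (sqrt k' * scalar_prod ?y ?y)\<^sup>2"
        using k' by (simp add: power_mult_distrib power2_eq_square)
      finally have yCy: "scalar_prod ?y (C *\<^sub>v ?y) \<le> sqrt k' * scalar_prod ?y ?y"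
        using k' by (meson abs_le_square_iff abs_ge_self order_trans power2_le_imp_le
            mult_nonneg_nonneg real_sqrt_ge_zero less_imp_le scalar_prod_self_nonneg)
      have "(scalar_prod ?y ?y)\<^sup>2 \<le> scalar_prod ?y (C *\<^sub>v ?y) * scalar_prod x (C *\<^sub>v x)"
        by (rule psd_Cauchy_Schwarz[OF C Ct Cpsd y x])
      also have "\<dots> \<le> (sqrt k' * scalar_prod ?y ?y) * scalar_prod x (C *\<^sub>v x)"
        using yCy Cpsd[OF x] by (rule mult_right_mono)
      finally have "scalar_prod ?y ?y * scalar_prod ?y ?y \<le> scalar_prod ?y ?y * (sqrt k' *
          scalar_prod x (C *\<^sub>v x))"
        by (simp add: power2_eq_square algebra_simps)
      moreover have "0 \<le> sqrt k' * scalar_prod x (C *\<^sub>v x)" using k' Cpsd[OF x] by simp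
      ultimately have "scalar_prod ?y ?y \<le> sqrt k' * scalar_prod x (C *\<^sub>v x)"
        using scalar_prod_self_nonneg[of ?y]
            by (cases "scalar_prod ?y ?y = 0") (auto simp: mult_le_cancel_left)
      then have "k * scalar_prod ?y ?y \<le> k * (sqrt k' * scalar_prod x (C *\<^sub>v x))" using k(1) by simp
      then show ?thesis using 1 by (simp add: mult.assoc)
    qed
    \<comment> \<open>The coercivity constant of \<open>C\<close>; it would lift all Rayleigh
      quotients to at least \<open>c + \<eta>\<close>, above their infimum.\<close>
    define \<eta> where "\<eta> = 1 / (k * sqrt k')"
    have \<eta>: "\<eta> > 0" using k k' by (simp add: \<eta>_def)
    have "c + \<eta> \<le> Inf S"
    proof (rule cInf_greatest[OF neS])
      fix r assume "r \<in> S"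
      then obtain x where x: "x \<in> carrier_vec n" "scalar_prod x x = 1" "r = scalar_prod x (A *\<^sub>v x)"
        by (auto simp: S_def)
      have "\<eta> \<le> scalar_prod x (C *\<^sub>v x)"
        using coercive[OF x(1)] x(2) k k' by (simp add: \<eta>_def field_simps)
      then show "c + \<eta> \<le> r" using xCx[OF x(1)] x by simp
    qed
    then show False using \<eta> by (simp add: c_def)
  qed
  then obtain v where v: "v \<in> carrier_vec n" "v \<noteq> 0\<^sub>v n" "C *\<^sub>v v = 0\<^sub>v n" by blast
  have "A *\<^sub>v v = c \<cdot>\<^sub>v v"
  proof (rule eq_vecI)
    fix i assume i: "i < dim_vec (c \<cdot>\<^sub>v v)"
    have "(A *\<^sub>v v - c \<cdot>\<^sub>v v) $ i = 0" using v(3) Cx[OF v(1)] i v(1) by simp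
    then show "(A *\<^sub>v v) $ i = (c \<cdot>\<^sub>v v) $ i" using i v(1) A by simp
  qed (use A v in auto)
  then have "eigenvector A v c" using A v by (simp add: eigenvector_def)
  then have spec: "c \<in> spectrum A" by (auto simp: spectrum_def eigenvalue_def)
  have fin: "finite (spectrum A)" using A(1) by (rule card_finite_spectrum)
  have min_le: "lambda_min A \<le> c" unfolding lambda_min_def using fin spec by simp
  have "lambda_min A \<in> spectrum A" unfolding lambda_min_def using fin spec by (intro Min_in) auto
  then obtain u where u: "u \<in> carrier_vec n" "u \<noteq> 0\<^sub>v n" "A *\<^sub>v u = lambda_min A \<cdot>\<^sub>v u"
    using A by (auto simp: spectrum_def eigenvalue_def eigenvector_def)
  have "0 < scalar_prod u (A *\<^sub>v u)" using pd u by blast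
  also have "\<dots> = lambda_min A * scalar_prod u u" using u by simp
  finally show "0 < lambda_min A"
    using scalar_prod_self_nonneg[of u] by (simp add: zero_less_mult_iff)
  show "lambda_min A * scalar_prod x x \<le> scalar_prod x (A *\<^sub>v x)" if "x \<in> carrier_vec n"
    using mult_right_mono[OF min_le scalar_prod_self_nonneg[of x]] c_le[OF that] by simp
qed

lemma mat_diag_mult_vec:
  assumes p: "p \<in> carrier_vec N" and i: "i < N"
  shows "(mat_diag N m *\<^sub>v p) $ i = m i * (p $ i :: real)"
proof -
  have "(mat_diag N m *\<^sub>v p) $ i = (\<Sum>j<N. (if i = j then m j else 0) * p $ j)"
    using i p by (auto simp: mat_diag_def scalar_prod_def lessThan_atLeast0 row_def)
  also have "\<dots> = (\<Sum>j<N. if i = j then m j * p $ j else 0)"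
    by (rule sum.cong) auto
  finally show ?thesis using i by simp
qed

lemma mat_diag_form:
  assumes p: "p \<in> carrier_vec N" and q: "q \<in> carrier_vec N"
  shows "scalar_prod q (mat_diag N m *\<^sub>v p) = (\<Sum>i<N. m i * q $ i * (p $ i :: real))"
proof -
  have "scalar_prod q (mat_diag N m *\<^sub>v p) = (\<Sum>i = 0..<N. q $ i * (mat_diag N m *\<^sub>v p) $ i)"
    unfolding scalar_prod_def using carrier_matD(1)[OF mat_diag_dim[of N m]] by simp
  also have "\<dots> = (\<Sum>i<N. m i * q $ i * p $ i)"
    by (auto simp: lessThan_atLeast0 mat_diag_mult_vec[OF p] simp del: index_mult_mat_vec intro!:
        sum.cong)
  finally show ?thesis .
qed

lemma spectrum_mat_diag: "spectrum (mat_diag N m :: real mat) = m ` {..<N}"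
proof (intro equalityI subsetI)
  fix k assume "k \<in> spectrum (mat_diag N m)"
  then obtain v where v: "v \<in> carrier_vec N" "v \<noteq> 0\<^sub>v N" "mat_diag N m *\<^sub>v v = k \<cdot>\<^sub>v v"
    using carrier_matD(1)[OF mat_diag_dim[of N m]]
        by (auto simp: spectrum_def eigenvalue_def eigenvector_def)
  then obtain i where i: "i < N" "v $ i \<noteq> 0" by (metis carrier_vecD eq_vecI index_zero_vec)
  then have "m i * v $ i = k * v $ i"
    using mat_diag_mult_vec[OF v(1) i(1), of m] v by simp
  then show "k \<in> m ` {..<N}" using i by auto
next
  fix k assume "k \<in> m ` {..<N}"
  then obtain i where i: "i < N" "k = m i" by auto
  have "mat_diag N m *\<^sub>v unit_vec N i = k \<cdot>\<^sub>v unit_vec N i"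
  proof (rule eq_vecI)
    fix j assume "j < dim_vec (k \<cdot>\<^sub>v unit_vec N i)"
    then have j: "j < N" by simp
    show "(mat_diag N m *\<^sub>v unit_vec N i) $ j = (k \<cdot>\<^sub>v unit_vec N i) $ j"
      using mat_diag_mult_vec[OF unit_vec_carrier j, of m i] i j
          by (auto simp: unit_vec_def simp del: index_mult_mat_vec)
  qed (use carrier_matD(1)[OF mat_diag_dim[of N m]] in simp)
  moreover have "unit_vec N i \<noteq> (0\<^sub>v N :: real vec)"
    using i by (metis index_unit_vec(2) index_zero_vec(1) zero_neq_one)
  ultimately have "eigenvector (mat_diag N m) (unit_vec N i) k"
    using carrier_matD(1)[OF mat_diag_dim[of N m]] by (auto simp: eigenvector_def)
  then show "k \<in> spectrum (mat_diag N m)" by (auto simp: spectrum_def eigenvalue_def)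
qed

subsection \<open>Chebyshev polynomials of a self-adjoint contraction\<close>

text \<open>The form is abstract because \<open>L\<close> will be self-adjoint for the mass form and
  in general not for the Euclidean product. \<open>L_bound\<close> confines the numerical range,
  which is what the bounds on \<open>G\<close> give directly; \<open>contraction\<close> sharpens it
  to a bound on \<open>L x\<close> itself.\<close>

locale self_adjoint_op =
  fixes N :: nat and ip :: "real vec \<Rightarrow> real vec \<Rightarrow> real" and L :: "real vec \<Rightarrow> real vec"
  assumes ip_add: "\<lbrakk>x \<in> carrier_vec N; y \<in> carrier_vec N; z \<in> carrier_vec N\<rbrakk> \<Longrightarrow> ip (x + y) z = ip x
      z + ip y z"
    and ip_smult: "\<lbrakk>x \<in> carrier_vec N; z \<in> carrier_vec N\<rbrakk> \<Longrightarrow> ip (c \<cdot>\<^sub>v x) z = c * ip x z"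
    and ip_sym: "\<lbrakk>x \<in> carrier_vec N; z \<in> carrier_vec N\<rbrakk> \<Longrightarrow> ip x z = ip z x"
    and L_closed [simp]: "x \<in> carrier_vec N \<Longrightarrow> L x \<in> carrier_vec N"
    and L_add: "\<lbrakk>x \<in> carrier_vec N; y \<in> carrier_vec N\<rbrakk> \<Longrightarrow> L (x + y) = L x + L y"
    and L_smult: "x \<in> carrier_vec N \<Longrightarrow> L (c \<cdot>\<^sub>v x) = c \<cdot>\<^sub>v L x"
    and L_sa: "\<lbrakk>x \<in> carrier_vec N; y \<in> carrier_vec N\<rbrakk> \<Longrightarrow> ip (L x) y = ip x (L y)"
    and L_bound: "x \<in> carrier_vec N \<Longrightarrow> \<bar>ip (L x) x\<bar> \<le> ip x x"

text \<open>The pair is \<open>(T_(j+1)(L) x, U_j(L) x)\<close>; the index is one below the degree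
  of the first member. The rules are \<open>T_(j+2) = X T_(j+1) - (1 - X^2) U_j\<close> and
  \<open>U_(j+1) = X U_j + T_(j+1)\<close>, preferred to the three-term recursion because one pair
  determines the next and carries the Pell identity.\<close>

fun chebyshev_vec :: "(real vec \<Rightarrow> real vec) \<Rightarrow> real vec \<Rightarrow> nat \<Rightarrow> real vec \<times> real vec" where
  "chebyshev_vec L x 0 = (L x, x)"
| "chebyshev_vec L x (Suc j) = (case chebyshev_vec L x j of (t, u) \<Rightarrow>
     (L t + (- 1) \<cdot>\<^sub>v u + L (L u), L u + t))"

context self_adjoint_op
begin

lemma ip_add_right: "\<lbrakk>x \<in> carrier_vec N; y \<in> carrier_vec N; z \<in> carrier_vec N\<rbrakk> \<Longrightarrow> ip z (x + y) = ip
    z x + ip z y"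
  using ip_add ip_sym by (metis add_carrier_vec)

lemma ip_smult_right: "\<lbrakk>x \<in> carrier_vec N; z \<in> carrier_vec N\<rbrakk> \<Longrightarrow> ip z (c \<cdot>\<^sub>v x) = c * ip z x"
  using ip_smult ip_sym by (metis smult_carrier_vec)

text \<open>From \<open>2 (1 - L\<^sup>2) = (1 - L) (1 + L) (1 - L) + (1 + L) (1 - L) (1 + L)\<close>.\<close>
lemma contraction:
  assumes x: "x \<in> carrier_vec N"
  shows "ip (L x) (L x) \<le> ip x x"
proof -
  let ?y = "x + (- 1) \<cdot>\<^sub>v L x" and ?z = "x + L x"
  note simps = ip_add ip_add_right ip_smult ip_smult_right L_add L_smult L_sa
  have y: "0 \<le> ip ?y ?y + ip (L ?y) ?y" and z: "0 \<le> ip ?z ?z - ip (L ?z) ?z"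
    using L_bound[of ?y] L_bound[of ?z] x by auto
  have "ip x (L (L x)) = ip (L x) (L x)" using x by (simp add: L_sa)
  then show ?thesis using y z x by (simp add: simps algebra_simps)
qed

lemma chebyshev_vec_closed:
  assumes x: "x \<in> carrier_vec N"
  shows "fst (chebyshev_vec L x j) \<in> carrier_vec N" "snd (chebyshev_vec L x j) \<in> carrier_vec N"
  by (induction j) (use x in \<open>auto split: prod.splits\<close>)

text \<open>The Pell identity \<open>T\<^sub>j\<^sup>2 + (1 - X\<^sup>2) U\<^sub>j\<^sub>-\<^sub>1\<^sup>2 = 1\<close>.\<close>
lemma chebyshev_vec_Pell:
  assumes x: "x \<in> carrier_vec N"
  shows "case chebyshev_vec L x j of (t, u) \<Rightarrow> ip t t + ip u u - ip (L u) (L u) = ip x x"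
proof (induction j)
  case (Suc j)
  obtain t u where tu: "chebyshev_vec L x j = (t, u)" by (cases "chebyshev_vec L x j") auto
  have c: "t \<in> carrier_vec N" "u \<in> carrier_vec N" using chebyshev_vec_closed[OF x, of j] tu by auto
  note simps = ip_add ip_add_right ip_smult ip_smult_right L_add L_smult L_sa
  \<comment> \<open>Once \<open>L_sa\<close> has moved every \<open>L\<close> into the right
    argument, the mixed terms differ only in the order of \<open>t\<close> and \<open>u\<close>;
    these three identities align them.\<close>
  have eqs: "ip u (L t) = ip t (L u)" using c ip_sym[of "L t" u] by (simp add: L_sa)
  have eqs2: "ip u (L (L (L t))) = ip t (L (L (L u)))"
    using c ip_sym[of "L (L (L t))" u] by (simp add: L_sa)
  have eqs3: "ip u t = ip t u" using c ip_sym by blast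
  show ?case using Suc c by (simp add: tu simps eqs eqs2 eqs3 algebra_simps)
qed simp

lemma chebyshev_vec_bound:
  assumes x: "x \<in> carrier_vec N"
  shows "ip (fst (chebyshev_vec L x j)) (fst (chebyshev_vec L x j)) \<le> ip x x"
proof -
  obtain t u where tu: "chebyshev_vec L x j = (t, u)" by (cases "chebyshev_vec L x j") auto
  have "u \<in> carrier_vec N" using chebyshev_vec_closed[OF x, of j] tu by auto
  then show ?thesis using chebyshev_vec_Pell[OF x, of j] contraction[of u] tu by simp
qed

end

text \<open>The same recursion at the number \<open>l\<close>. As \<open>L\<close> will be
  \<open>c1 G + l\<close>, this is the value at 0 of the corresponding polynomial in
  \<open>G\<close>, by which a residual polynomial is normalised.\<close>

definition chebyshev_scalar :: "real \<Rightarrow> nat \<Rightarrow> real \<times> real" where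
  "chebyshev_scalar l j = rec_nat (l, 1) (\<lambda>_ (t, u). (l * t - u + l * (l * u), l * u + t)) j"

lemma chebyshev_scalar_simps [simp]:
  "chebyshev_scalar l 0 = (l, 1)"
  "chebyshev_scalar l (Suc j) = (case chebyshev_scalar l j of (t, u) \<Rightarrow> (l * t - u + l * (l * u), l
      * u + t))"
  by (simp_all add: chebyshev_scalar_def)

text \<open>With \<open>p * q = 1\<close> the point \<open>- (p + q) / 2\<close> is a Joukowski
  image, at which \<open>T\<close> becomes a sum and \<open>U\<close> a difference quotient of
  powers. The factor \<open>p - q\<close> stays on the left to avoid a division.\<close>

lemma chebyshev_scalar_closed_form:
  fixes p q :: real
  assumes "p * q = 1"
  shows "fst (chebyshev_scalar (- (p + q) / 2) j) = (- 1) ^ Suc j * (p ^ Suc j + q ^ Suc j) / 2"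
    "(p - q) * snd (chebyshev_scalar (- (p + q) / 2) j) = (- 1) ^ j * (p ^ Suc j - q ^ Suc j)"
proof (induction j)
  case (Suc j)
  let ?l = "- (p + q) / 2"
  obtain t u where tu: "chebyshev_scalar ?l j = (t, u)" by (cases "chebyshev_scalar ?l j") auto
  have t: "t = (- 1) ^ Suc j * (p ^ Suc j + q ^ Suc j) / 2"
    and u: "(p - q) * u = (- 1) ^ j * (p ^ Suc j - q ^ Suc j)"
    using Suc tu by auto
  {
    case 1
    \<comment> \<open>Here \<open>l^2 - 1 = ((p - q) / 2)^2\<close> by \<open>p * q = 1\<close>; one
      factor \<open>p - q\<close> is kept next to \<open>u\<close>, where the induction hypothesis
      applies.\<close>
    have "?l * t - u + ?l * (?l * u) = ?l * t + (p - q) / 4 * ((p - q) * u)"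
    proof -
      have "?l * (?l * u) - u = ?l * (?l * u) - (p * q) * u" by (simp add: assms)
      also have "\<dots> = (p - q) / 4 * ((p - q) * u)" by (simp add: field_simps)
      finally have eq: "?l * (?l * u) - u = (p - q) / 4 * ((p - q) * u)" .
      have "a - u + c = a + (c - u)" for a c :: real by simp
      then show ?thesis unfolding eq[symmetric] .
    qed
    also have "\<dots> = (- 1) ^ Suc (Suc j) * (p ^ Suc (Suc j) + q ^ Suc (Suc j)) / 2"
      unfolding t u by (simp add: field_simps)
    finally show ?case unfolding chebyshev_scalar_simps tu prod.case fst_conv .
  next
    case 2
    have "(p - q) * (?l * u + t) = ?l * ((p - q) * u) + (p - q) * t" by (simp add: algebra_simps)
    also have "\<dots> = (- 1) ^ Suc j * (p ^ Suc (Suc j) - q ^ Suc (Suc j))"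
      unfolding t u by (simp add: field_simps)
    finally show ?case unfolding chebyshev_scalar_simps tu prod.case snd_conv .
  }
qed (simp_all add: algebra_simps)

lemma chebyshev_scalar_lower_bound:
  fixes q :: real
  assumes q: "0 < q"
  shows "1 / \<bar>fst (chebyshev_scalar (- (1 / q + q) / 2) j)\<bar> \<le> 2 * q ^ Suc j"
    "fst (chebyshev_scalar (- (1 / q + q) / 2) j) \<noteq> 0"
proof -
  have pos: "(1 / q) ^ Suc j > 0" "q ^ Suc j > 0" using q by (intro zero_less_power; simp)+
  have eq: "\<bar>fst (chebyshev_scalar (- (1 / q + q) / 2) j)\<bar> = ((1 / q) ^ Suc j + q ^ Suc j) / 2"
    using chebyshev_scalar_closed_form(1)[of "1 / q" q j] q pos
        by (simp add: abs_mult power_abs del: power_Suc)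
  then show "fst (chebyshev_scalar (- (1 / q + q) / 2) j) \<noteq> 0" using pos by fastforce
  have "1 / \<bar>fst (chebyshev_scalar (- (1 / q + q) / 2) j)\<bar> \<le> 1 / ((1 / q) ^ Suc j / 2)"
  proof -
    have "1 / ((a + b) / 2) \<le> 1 / (a / 2)" if "a > 0" "b > 0" for a b :: real
      using that by (simp add: frac_le)
    then show ?thesis unfolding eq using pos by blast
  qed
  also have "\<dots> = 2 * q ^ Suc j" using q by (simp add: power_one_over del: power_Suc)
  finally show "1 / \<bar>fst (chebyshev_scalar (- (1 / q + q) / 2) j)\<bar> \<le> 2 * q ^ Suc j" .
qed

subsection \<open>Krylov spaces and GMRES\<close>

locale krylov =
  fixes Z :: "real mat" and r :: "real vec" and nn :: nat
  assumes Z: "Z \<in> carrier_mat nn nn" and r: "r \<in> carrier_vec nn"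
begin

text \<open>Explicit coefficients make closure under sums, scaling and \<open>Z\<close> a matter of
  rearranging sums; the linear span of the definition enters only in
  \<open>kry_krylov_space\<close>.\<close>

definition kry :: "nat \<Rightarrow> real vec \<Rightarrow> bool" where
  "kry k z \<longleftrightarrow> (\<exists>c. z = vec nn (\<lambda>i. \<Sum>j<k. c j * ((Z ^\<^sub>m j) *\<^sub>v r) $ i))"

lemma pow_carrier: "(Z ^\<^sub>m j) *\<^sub>v x \<in> carrier_vec nn"
proof -
  have "Z ^\<^sub>m j \<in> carrier_mat nn nn" using Z by (rule pow_carrier_mat)
  then show ?thesis by (metis carrier_matD(1) carrier_vec_dim_vec dim_mult_mat_vec)
qed

text \<open>\<open>Z ^\<^sub>m Suc j\<close> unfolds with the new factor on the right, whereas
  Krylov vectors are extended from the left; the induction therefore runs over all vectors at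
  once.\<close>

lemma mult_pow: "Z *\<^sub>v ((Z ^\<^sub>m j) *\<^sub>v r) = (Z ^\<^sub>m Suc j) *\<^sub>v r"
proof -
  have "Z *\<^sub>v ((Z ^\<^sub>m j) *\<^sub>v x) = (Z ^\<^sub>m Suc j) *\<^sub>v x" if "x \<in> carrier_vec nn" for x
    using that
  proof (induction j arbitrary: x)
    case 0
    then show ?case using Z by simp
  next
    case (Suc j)
    have pj: "Z ^\<^sub>m j \<in> carrier_mat nn nn" for j using Z by (rule pow_carrier_mat)
    have "Z *\<^sub>v ((Z ^\<^sub>m Suc j) *\<^sub>v x) = Z *\<^sub>v ((Z ^\<^sub>m j) *\<^sub>v (Z *\<^sub>v x))"
      using assoc_mult_mat_vec[OF pj Z Suc.prems] by simp
    also have "\<dots> = (Z ^\<^sub>m Suc j) *\<^sub>v (Z *\<^sub>v x)"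
      by (rule Suc.IH) (use Z Suc.prems in simp)
    also have "\<dots> = (Z ^\<^sub>m Suc (Suc j)) *\<^sub>v x"
      using assoc_mult_mat_vec[OF pj[of "Suc j"] Z Suc.prems] by simp
    finally show ?case .
  qed
  then show ?thesis using r by blast
qed

lemma kryI: "z = vec nn (\<lambda>i. \<Sum>j<k. c j * ((Z ^\<^sub>m j) *\<^sub>v r) $ i) \<Longrightarrow> kry k z"
  by (auto simp: kry_def)

lemma kry_carrier: "kry k z \<Longrightarrow> z \<in> carrier_vec nn"
  by (auto simp: kry_def)

lemma kry_0: "kry k (0\<^sub>v nn)"
  unfolding kry_def by (rule exI[of _ "\<lambda>_. 0"]) (auto intro: eq_vecI)

lemma kry_r: "kry (Suc k) r"
  unfolding kry_def
proof (rule exI[of _ "\<lambda>j. if j = 0 then 1 else 0"], rule eq_vecI)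
  fix i assume "i < dim_vec (vec nn (\<lambda>i. \<Sum>j<Suc k. (if j = 0 then 1 else 0) * ((Z ^\<^sub>m j) *\<^sub>v r) $
      i))"
  then have i: "i < nn" by simp
  have "(\<Sum>j<Suc k. (if j = 0 then 1 else 0) * ((Z ^\<^sub>m j) *\<^sub>v r) $ i) = (\<Sum>j<Suc k. if j = 0 then r
      $ i else 0)"
    by (rule sum.cong) (use Z r in auto)
  then show "r $ i = vec nn (\<lambda>i. \<Sum>j<Suc k. (if j = 0 then 1 else 0) * ((Z ^\<^sub>m j) *\<^sub>v r) $ i) $ i"
    using i by simp
qed (use r in auto)

lemma kry_add: "kry k x \<Longrightarrow> kry k y \<Longrightarrow> kry k (x + y)"
proof -
  assume "kry k x" "kry k y"
  then obtain c c' where "x = vec nn (\<lambda>i. \<Sum>j<k. c j * ((Z ^\<^sub>m j) *\<^sub>v r) $ i)"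
    "y = vec nn (\<lambda>i. \<Sum>j<k. c' j * ((Z ^\<^sub>m j) *\<^sub>v r) $ i)" by (auto simp: kry_def)
  then have "x + y = vec nn (\<lambda>i. \<Sum>j<k. (c j + c' j) * ((Z ^\<^sub>m j) *\<^sub>v r) $ i)"
    by (intro eq_vecI) (auto simp: distrib_right sum.distrib)
  then show ?thesis by (rule kryI)
qed

lemma kry_smult: "kry k x \<Longrightarrow> kry k (a \<cdot>\<^sub>v x)"
proof -
  assume "kry k x"
  then obtain c where "x = vec nn (\<lambda>i. \<Sum>j<k. c j * ((Z ^\<^sub>m j) *\<^sub>v r) $ i)" by (auto simp: kry_def)
  then have "a \<cdot>\<^sub>v x = vec nn (\<lambda>i. \<Sum>j<k. (a * c j) * ((Z ^\<^sub>m j) *\<^sub>v r) $ i)"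
    by (intro eq_vecI) (auto simp: sum_distrib_left mult.assoc)
  then show ?thesis by (rule kryI)
qed

lemma kry_Suc: "kry k x \<Longrightarrow> kry (Suc k) x"
proof -
  assume "kry k x"
  then obtain c where "x = vec nn (\<lambda>i. \<Sum>j<k. c j * ((Z ^\<^sub>m j) *\<^sub>v r) $ i)" by (auto simp: kry_def)
  then have "x = vec nn (\<lambda>i. \<Sum>j<Suc k. (if j < k then c j else 0) * ((Z ^\<^sub>m j) *\<^sub>v r) $ i)"
    by (intro eq_vecI) auto
  then show ?thesis by (rule kryI)
qed

lemma kry_mult: "kry k x \<Longrightarrow> kry (Suc k) (Z *\<^sub>v x)"
proof -
  assume "kry k x"
  then obtain c where x: "x = vec nn (\<lambda>i. \<Sum>j<k. c j * ((Z ^\<^sub>m j) *\<^sub>v r) $ i)"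
      by (auto simp: kry_def)
  \<comment> \<open>Multiplication by \<open>Z\<close> shifts the coefficients by one place and
    leaves 0 at power 0.\<close>
  define c' where "c' j = (case j of 0 \<Rightarrow> 0 | Suc j \<Rightarrow> c j)" for j
  have "Z *\<^sub>v x = vec nn (\<lambda>i. \<Sum>j<Suc k. c' j * ((Z ^\<^sub>m j) *\<^sub>v r) $ i)"
  proof (rule eq_vecI)
    fix i assume "i < dim_vec (vec nn (\<lambda>i. \<Sum>j<Suc k. c' j * ((Z ^\<^sub>m j) *\<^sub>v r) $ i))"
    then have i: "i < nn" by simp
    have pw: "(Z *\<^sub>v y) $ i = (\<Sum>l<nn. Z $$ (i, l) * y $ l)" if "y \<in> carrier_vec nn" for y
      using i Z that by (auto simp: scalar_prod_def lessThan_atLeast0 row_def)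
    have "(Z *\<^sub>v x) $ i = (\<Sum>l<nn. \<Sum>j<k. Z $$ (i, l) * (c j * ((Z ^\<^sub>m j) *\<^sub>v r) $ l))"
      by (subst pw) (auto simp: x sum_distrib_left)
    also have "\<dots> = (\<Sum>j<k. \<Sum>l<nn. Z $$ (i, l) * (c j * ((Z ^\<^sub>m j) *\<^sub>v r) $ l))" by (rule sum.swap)
    also have "\<dots> = (\<Sum>j<k. c j * (Z *\<^sub>v ((Z ^\<^sub>m j) *\<^sub>v r)) $ i)"
      by (intro sum.cong refl) (simp add: pw[OF pow_carrier] sum_distrib_left mult_ac)
    also have "\<dots> = (\<Sum>j<Suc k. c' j * ((Z ^\<^sub>m j) *\<^sub>v r) $ i)"
      by (subst sum.lessThan_Suc_shift) (simp add: c'_def mult_pow del: pow_mat.simps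
          index_mult_mat_vec)
    finally show "(Z *\<^sub>v x) $ i = vec nn (\<lambda>i. \<Sum>j<Suc k. c' j * ((Z ^\<^sub>m j) *\<^sub>v r) $ i) $ i"
      using i by simp
  qed (use Z in auto)
  then show ?thesis by (rule kryI)
qed

text \<open>This direction makes the explicitly built candidates admissible competitors of the GMRES
  minimiser.\<close>

lemma kry_krylov_space:
  assumes "kry k z" shows "z \<in> krylov_space Z r k"
proof -
  interpret vec_space "TYPE(real)" nn .
  let ?S = "\<lambda>k. (\<lambda>j. (Z ^\<^sub>m j) *\<^sub>v r) ` {..<k}"
  have S: "?S k \<subseteq> carrier_vec nn" for k using pow_carrier by auto
  have "vec nn (\<lambda>i. \<Sum>j<k. c j * ((Z ^\<^sub>m j) *\<^sub>v r) $ i) \<in> span (?S k)" for c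
  proof (induction k)
    case 0
    have "vec nn (\<lambda>i. \<Sum>j<0. c j * ((Z ^\<^sub>m j) *\<^sub>v r) $ i) = 0\<^sub>v nn" by (intro eq_vecI) auto
    then show ?case using span_zero by simp
  next
    case (Suc k)
    have eq: "vec nn (\<lambda>i. \<Sum>j<Suc k. c j * ((Z ^\<^sub>m j) *\<^sub>v r) $ i) =
        vec nn (\<lambda>i. \<Sum>j<k. c j * ((Z ^\<^sub>m j) *\<^sub>v r) $ i) + c k \<cdot>\<^sub>v ((Z ^\<^sub>m k) *\<^sub>v r)"
      using carrier_vecD[OF pow_carrier[of k r]] by (intro eq_vecI) auto
    have 1: "vec nn (\<lambda>i. \<Sum>j<k. c j * ((Z ^\<^sub>m j) *\<^sub>v r) $ i) \<in> span (?S (Suc k))"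
      using Suc span_is_monotone[of "?S k" "?S (Suc k)"] by (auto simp: lessThan_Suc)
    have "(Z ^\<^sub>m k) *\<^sub>v r \<in> span (?S (Suc k))"
      using in_own_span[OF S, of "Suc k"] by auto
    then have 2: "c k \<cdot>\<^sub>v ((Z ^\<^sub>m k) *\<^sub>v r) \<in> span (?S (Suc k))" by (rule smult_in_span[OF S])
    show ?case unfolding eq by (rule span_add1[OF _ 1 2, unfolded module_vec_simps]) (rule S)
  qed
  then show ?thesis using assms r by (auto simp: krylov_space_def kry_def)
qed

text \<open>\<open>kres k s v\<close>: \<open>v = p(Z) r\<close> for a polynomial \<open>p\<close> of degree at most \<open>k\<close> with \<open>p(0) = s\<close>.\<close>
definition kres :: "nat \<Rightarrow> real \<Rightarrow> real vec \<Rightarrow> bool" where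
  "kres k s v \<longleftrightarrow> (\<exists>z. kry k z \<and> v = s \<cdot>\<^sub>v r + (- 1) \<cdot>\<^sub>v (Z *\<^sub>v z))"

lemma kres_carrier: "kres k s v \<Longrightarrow> v \<in> carrier_vec nn"
  using r Z by (auto simp: kres_def dest: kry_carrier)

lemma kres_kry: "kres k s v \<Longrightarrow> kry (Suc k) v"
  by (auto simp: kres_def intro!: kry_add kry_smult kry_mult kry_r)

lemma kres_Suc: "kres k s v \<Longrightarrow> kres (Suc k) s v"
  by (auto simp: kres_def intro: kry_Suc)

lemma kres_add: "kres k s v \<Longrightarrow> kres k s' v' \<Longrightarrow> kres k (s + s') (v + v')"
proof -
  assume "kres k s v" "kres k s' v'"
  then obtain z z' where z: "kry k z" "v = s \<cdot>\<^sub>v r + (- 1) \<cdot>\<^sub>v (Z *\<^sub>v z)" "kry k z'" "v' = s' \<cdot>\<^sub>v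
      r + (- 1) \<cdot>\<^sub>v (Z *\<^sub>v z')"
    by (auto simp: kres_def)
  have c: "z \<in> carrier_vec nn" "z' \<in> carrier_vec nn" using z kry_carrier by auto
  have "Z *\<^sub>v (z + z') = Z *\<^sub>v z + Z *\<^sub>v z'"
    using mult_add_distrib_mat_vec[OF Z c] .
  then have "v + v' = (s + s') \<cdot>\<^sub>v r + (- 1) \<cdot>\<^sub>v (Z *\<^sub>v (z + z'))"
    using z(2,4) r Z by (intro eq_vecI) (auto simp: algebra_simps simp del: index_mult_mat_vec)
  then show ?thesis unfolding kres_def using kry_add[OF z(1,3)] by blast
qed

lemma kres_smult: "kres k s v \<Longrightarrow> kres k (a * s) (a \<cdot>\<^sub>v v)"
proof -
  assume "kres k s v"
  then obtain z where z: "kry k z" "v = s \<cdot>\<^sub>v r + (- 1) \<cdot>\<^sub>v (Z *\<^sub>v z)" by (auto simp: kres_def)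
  have "Z *\<^sub>v (a \<cdot>\<^sub>v z) = a \<cdot>\<^sub>v (Z *\<^sub>v z)"
    using mult_mat_vec[OF Z kry_carrier[OF z(1)]] .
  then have "a \<cdot>\<^sub>v v = (a * s) \<cdot>\<^sub>v r + (- 1) \<cdot>\<^sub>v (Z *\<^sub>v (a \<cdot>\<^sub>v z))"
    using z(2) r Z by (intro eq_vecI) (auto simp: algebra_simps simp del: index_mult_mat_vec)
  then show ?thesis unfolding kres_def using kry_smult[OF z(1)] by blast
qed

lemma kres_mult: "kres k s v \<Longrightarrow> kres (Suc k) 0 (a \<cdot>\<^sub>v (Z *\<^sub>v v))"
proof -
  assume v: "kres k s v"
  have "Z *\<^sub>v ((- a) \<cdot>\<^sub>v v) = (- a) \<cdot>\<^sub>v (Z *\<^sub>v v)"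
    using mult_mat_vec[OF Z kres_carrier[OF v]] .
  then have "a \<cdot>\<^sub>v (Z *\<^sub>v v) = 0 \<cdot>\<^sub>v r + (- 1) \<cdot>\<^sub>v (Z *\<^sub>v ((- a) \<cdot>\<^sub>v v))"
    using r Z by (intro eq_vecI) (auto simp del: index_mult_mat_vec)
  then show ?thesis unfolding kres_def using kry_smult[OF kres_kry[OF v]] by blast
qed

lemma kres_affine: "kres k s v \<Longrightarrow> kres (Suc k) (l * s) (a \<cdot>\<^sub>v (Z *\<^sub>v v) + l \<cdot>\<^sub>v v)"
  using kres_add[OF kres_mult[of k s v a] kres_smult[OF kres_Suc, of k s v l]] by simp

text \<open>The affine factor \<open>a z + l\<close> has the value \<open>l\<close> at 0, so the
  values at 0 follow the scalar recursion. The degrees are \<open>j + 1\<close> for \<open>t\<close>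
  and \<open>j\<close> for \<open>u\<close>, hence the different first arguments of
  \<open>kres\<close>.\<close>

lemma kres_chebyshev:
  assumes "chebyshev_vec (\<lambda>v. a \<cdot>\<^sub>v (Z *\<^sub>v v) + l \<cdot>\<^sub>v v) r j = (t, u)"
  shows "kres (Suc j) (fst (chebyshev_scalar l j)) t \<and> kres j (snd (chebyshev_scalar l j)) u"
  using assms
proof (induction j arbitrary: t u)
  case 0
  have "kres 0 1 r"
    unfolding kres_def using Z r by (intro exI[of _ "0\<^sub>v nn"] conjI kry_0) (auto intro!: eq_vecI)
  then show ?case using 0 kres_affine[of 0 1 r l a] by auto
next
  case (Suc j)
  let ?L = "\<lambda>v. a \<cdot>\<^sub>v (Z *\<^sub>v v) + l \<cdot>\<^sub>v v"
  obtain t0 u0 where tu: "chebyshev_vec ?L r j = (t0, u0)" by fastforce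
  obtain \<tau> \<upsilon> where sc: "chebyshev_scalar l j = (\<tau>, \<upsilon>)" by fastforce
  have t0: "kres (Suc j) \<tau> t0" and u0: "kres j \<upsilon> u0" using Suc.IH[OF tu] sc by auto
  have t: "t = ?L t0 + (- 1) \<cdot>\<^sub>v u0 + ?L (?L u0)" and u: "u = ?L u0 + t0" using Suc.prems tu by auto
  have "kres (Suc (Suc j)) (l * \<tau> + (- 1) * \<upsilon> + l * (l * \<upsilon>)) t"
    unfolding t by (intro kres_add kres_affine kres_smult t0 u0 kres_Suc)
  moreover have "kres (Suc j) (l * \<upsilon> + \<tau>) u"
    unfolding u by (intro kres_add kres_affine t0 u0)
  ultimately show ?case using sc by simp
qed

lemma gmres_le:
  assumes b: "b \<in> carrier_vec nn" and x0: "x0 \<in> carrier_vec nn" and rb: "r = b - Z *\<^sub>v x0"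
    and gm: "gmres_iterate Z b x0 k xk" and v: "kres k 1 v"
  shows "vnorm (b - Z *\<^sub>v xk) \<le> vnorm v"
proof -
  obtain z where z: "kry k z" "v = 1 \<cdot>\<^sub>v r + (- 1) \<cdot>\<^sub>v (Z *\<^sub>v z)" using v by (auto simp: kres_def)
  have zc: "z \<in> carrier_vec nn" using kry_carrier[OF z(1)] .
  have "vnorm (b - Z *\<^sub>v xk) \<le> vnorm (b - Z *\<^sub>v (x0 + z))"
    using gm kry_krylov_space[OF z(1)] by (auto simp: gmres_iterate_def Let_def rb)
  moreover have "b - Z *\<^sub>v (x0 + z) = v"
    using mult_add_distrib_mat_vec[OF Z x0 zc] z(2) rb b Z
    by (intro eq_vecI) (auto simp del: index_mult_mat_vec)
  ultimately show ?thesis by simp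
qed

lemma gmres_le_initial:
  assumes b: "b \<in> carrier_vec nn" and x0: "x0 \<in> carrier_vec nn" and rb: "r = b - Z *\<^sub>v x0"
    and gm: "gmres_iterate Z b x0 k xk"
  shows "vnorm (b - Z *\<^sub>v xk) \<le> vnorm r"
proof (rule gmres_le[OF b x0 rb gm])
  show "kres k 1 r"
    unfolding kres_def using Z r by (intro exI[of _ "0\<^sub>v nn"] conjI kry_0) (auto intro!: eq_vecI)
qed

end

subsection \<open>The preconditioned saddle point system\<close>

lemma outer_prod_mult_vec:
  assumes "y \<in> carrier_vec (dim_vec v)"
  shows "outer_prod u v *\<^sub>v y = scalar_prod v y \<cdot>\<^sub>v u"
  using assms by (intro eq_vecI) (auto simp: outer_prod_def scalar_prod_def row_def
      sum_distrib_left sum_distrib_right mult_ac)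

lemma vec_last_add: "x \<in> carrier_vec (n + N) \<Longrightarrow> y \<in> carrier_vec (n + N) \<Longrightarrow> vec_last (x + y) N =
    vec_last x N + vec_last y N"
  and vec_last_smult: "x \<in> carrier_vec (n + N) \<Longrightarrow> vec_last (c \<cdot>\<^sub>v x) N = c \<cdot>\<^sub>v vec_last x N"
  by (auto simp: vec_last_def intro!: eq_vecI)

lemma vec_last_append: "x \<in> carrier_vec n \<Longrightarrow> y \<in> carrier_vec N \<Longrightarrow> vec_last (x @\<^sub>v y) N = y"
  by (auto simp: vec_last_def intro!: eq_vecI)

text \<open>What the mesh contributes, in matrix form: \<open>B_le\<close> is the bound of the weak
  divergence by the weak gradient, tested with \<open>p\<close>; \<open>one_B\<close> says that the
  total divergence of a field with zero boundary values vanishes; \<open>m\<close> lists the element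
  volumes.\<close>

locale saddle_point =
  fixes n N :: nat and A B :: "real mat" and m :: "nat \<Rightarrow> real" and d \<beta> \<epsilon> \<rho> :: real
  assumes n: "0 < n" and N: "0 < N"
    and A: "A \<in> carrier_mat n n" "transpose_mat A = A"
    and A_pd: "\<And>x. x \<in> carrier_vec n \<Longrightarrow> x \<noteq> 0\<^sub>v n \<Longrightarrow> 0 < scalar_prod x (A *\<^sub>v x)"
    and B: "B \<in> carrier_mat N n"
    and m: "\<And>i. i < N \<Longrightarrow> 0 < m i"
    and d: "1 \<le> d" and \<beta>: "0 < \<beta>" "\<beta> < 1" and \<epsilon>: "0 < \<epsilon>" "\<epsilon> < 1" and \<rho>: "0 < \<rho>"
    and B_le: "\<And>p x. p \<in> carrier_vec N \<Longrightarrow> x \<in> carrier_vec n \<Longrightarrow> (scalar_prod p (B *\<^sub>v x))\<^sup>2 \<le>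
      d * scalar_prod p (mat_diag N m *\<^sub>v p) * scalar_prod x (A *\<^sub>v x)"
    and one_B: "\<And>x. x \<in> carrier_vec n \<Longrightarrow> scalar_prod (one_vec N) (B *\<^sub>v x) = 0"
    and inf_sup: "\<And>p. p \<in> carrier_vec N \<Longrightarrow> scalar_prod (one_vec N) (mat_diag N m *\<^sub>v p) = 0 \<Longrightarrow>
      \<beta> * sqrt (scalar_prod p (mat_diag N m *\<^sub>v p)) \<le>
        (SUP v\<in>carrier_vec n - {0\<^sub>v n}. scalar_prod p (B *\<^sub>v v) / sqrt (scalar_prod v (A *\<^sub>v v)))"
begin

abbreviation "M \<equiv> mat_diag N m"
abbreviation "e \<equiv> one_vec N"

definition nrm :: real where "nrm = vnorm (M *\<^sub>v e)"
definition w :: "real vec" where "w = (1 / nrm) \<cdot>\<^sub>v (M *\<^sub>v e)"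
definition gam :: real where "gam = scalar_prod e w"
definition ip :: "real vec \<Rightarrow> real vec \<Rightarrow> real" where "ip x y = (\<Sum>i<N. m i * x $ i * y $ i)"
definition Ai :: "real mat" where "Ai = the (mat_inverse A)"
definition E :: "real vec \<Rightarrow> real vec" where "E y = Ai *\<^sub>v (transpose_mat B *\<^sub>v y)"

text \<open>With \<open>S\<^sub>e = B A\<^sup>-\<^sup>1 B\<^sup>T + \<epsilon> M + \<rho> w w\<^sup>T\<close> and \<open>S' = M + \<rho> w w\<^sup>T\<close>, the operator \<open>G\<close> is the
  inverse of \<open>S'\<close> times \<open>S\<^sub>e\<close>. Since \<open>e\<^sup>T B = 0\<close>, solving \<open>S' (G y) = S\<^sub>e y\<close> only replaces \<open>\<rho>\<close> by
  \<open>sig\<close> in \<open>S\<^sub>e\<close> and \<open>S'\<close> by \<open>M\<close>, so that \<open>M G\<close> is symmetric.\<close>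
definition sig :: real where "sig = \<rho> * (1 - \<epsilon>) * nrm / (nrm + \<rho> * gam)"
definition G :: "real vec \<Rightarrow> real vec" where
  "G y = vec N (\<lambda>i. ((B *\<^sub>v E y) $ i + \<epsilon> * (m i * y $ i) + sig * scalar_prod w y * w $ i) / m i)"

lemma e [simp]: "e \<in> carrier_vec N" and M [simp]: "M \<in> carrier_mat N N"
  by (auto simp: one_vec_def)

lemma dim_row_M [simp]: "dim_row M = N" and dim_col_M [simp]: "dim_col M = N"
  by (simp_all add: mat_diag_def)

lemma M_mult [simp]: "y \<in> carrier_vec N \<Longrightarrow> M *\<^sub>v y \<in> carrier_vec N"
  by (rule mult_mat_vec_carrier[OF M])

lemma w [simp]: "w \<in> carrier_vec N"
  by (simp add: w_def)

lemma dim_vec_w [simp]: "dim_vec w = N" and dim_vec_e [simp]: "dim_vec e = N"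
  using carrier_vecD[OF w] carrier_vecD[OF e] by simp_all

lemma ip_form: "x \<in> carrier_vec N \<Longrightarrow> y \<in> carrier_vec N \<Longrightarrow> scalar_prod x (M *\<^sub>v y) = ip x y"
  by (simp add: mat_diag_form ip_def)

lemma ip_add: "\<lbrakk>x \<in> carrier_vec N; y \<in> carrier_vec N\<rbrakk> \<Longrightarrow> ip (x + y) z = ip x z + ip y z"
  by (simp add: ip_def distrib_left distrib_right sum.distrib)

lemma ip_smult: "x \<in> carrier_vec N \<Longrightarrow> ip (c \<cdot>\<^sub>v x) z = c * ip x z"
  by (simp add: ip_def sum_distrib_left algebra_simps)

lemma ip_sym: "ip x y = ip y x"
  by (simp add: ip_def mult_ac)

lemma ip_nonneg: "0 \<le> ip x x"
  unfolding ip_def using m by (intro sum_nonneg) (simp add: mult.assoc less_imp_le)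

lemma Me_nonzero: "M *\<^sub>v e \<noteq> 0\<^sub>v N"
proof
  assume "M *\<^sub>v e = 0\<^sub>v N"
  then have "m 0 * e $ 0 = 0" using mat_diag_mult_vec[OF e N, of m] N by simp
  then show False using m[OF N] N by (simp add: one_vec_def)
qed

lemma nrm: "0 < nrm"
  unfolding nrm_def by (rule vnorm_pos[OF _ Me_nonzero]) simp

text \<open>Euclidean orthogonality to \<open>w\<close> is thereby the same as
  \<open>M\<close>-orthogonality to the constants, the side condition of the inf-sup
  inequality.\<close>

lemma ip_e: "y \<in> carrier_vec N \<Longrightarrow> ip e y = nrm * scalar_prod w y"
  using nrm ip_form[of y e] comm_scalar_prod[of y N "M *\<^sub>v e"] by (simp add: w_def ip_sym[of e])

lemma w_unit: "scalar_prod w w = 1"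
proof -
  have "scalar_prod w w = scalar_prod (M *\<^sub>v e) (M *\<^sub>v e) / nrm\<^sup>2"
    by (simp add: w_def power2_eq_square)
  then show ?thesis using nrm by (simp add: nrm_def vnorm_power2[symmetric])
qed

lemma w_e: "scalar_prod w e = gam"
  unfolding gam_def by (rule comm_scalar_prod[OF w e])

lemma ip_ee: "ip e e = nrm * gam"
  by (simp add: ip_e w_e)

lemma gam: "0 < gam" "gam \<le> 1"
proof -
  have "ip e e > 0"
    unfolding ip_def using m N by (intro sum_pos) (auto simp: one_vec_def)
  then show "0 < gam" using nrm by (simp add: ip_ee zero_less_mult_iff)
  have "scalar_prod e e = 1" using N by (simp add: scalar_prod_def one_vec_def)
  then have "gam\<^sup>2 \<le> 1"
    using scalar_prod_Cauchy_Schwarz[OF e w] w_unit by (simp add: gam_def)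
  then show "gam \<le> 1" by (simp add: power2_le_imp_le)
qed

lemma Ai: "A * Ai = 1\<^sub>m n" "Ai * A = 1\<^sub>m n" "Ai \<in> carrier_mat n n"
proof -
  have "v = 0\<^sub>v n" if "v \<in> carrier_vec n" "A *\<^sub>v v = 0\<^sub>v n" for v
    using A_pd[OF that(1)] that by fastforce
  then show "A * Ai = 1\<^sub>m n" "Ai * A = 1\<^sub>m n" "Ai \<in> carrier_mat n n"
    unfolding Ai_def by (metis det_nonzero_inverse[OF A(1)] option.sel)+
qed

lemma E_closed [simp]: "y \<in> carrier_vec N \<Longrightarrow> E y \<in> carrier_vec n"
  using Ai B by (simp add: E_def)

lemma A_E: "y \<in> carrier_vec N \<Longrightarrow> A *\<^sub>v E y = transpose_mat B *\<^sub>v y"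
proof -
  assume "y \<in> carrier_vec N"
  then have c: "transpose_mat B *\<^sub>v y \<in> carrier_vec n" using B by simp
  show ?thesis unfolding E_def using assoc_mult_mat_vec[OF A(1) Ai(3) c] Ai(1) c by simp
qed

lemma E_add: "x \<in> carrier_vec N \<Longrightarrow> y \<in> carrier_vec N \<Longrightarrow> E (x + y) = E x + E y"
proof -
  assume x: "x \<in> carrier_vec N" and y: "y \<in> carrier_vec N"
  have Bt: "transpose_mat B \<in> carrier_mat n N" using B by simp
  show ?thesis unfolding E_def mult_add_distrib_mat_vec[OF Bt x y]
    by (rule mult_add_distrib_mat_vec[OF Ai(3)]) (use Bt x y in auto)
qed

lemma E_smult: "x \<in> carrier_vec N \<Longrightarrow> E (c \<cdot>\<^sub>v x) = c \<cdot>\<^sub>v E x"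
proof -
  assume x: "x \<in> carrier_vec N"
  have Bt: "transpose_mat B \<in> carrier_mat n N" using B by simp
  show ?thesis unfolding E_def mult_mat_vec[OF Bt x]
    by (rule mult_mat_vec[OF Ai(3)]) (use Bt x in auto)
qed

text \<open>The form of \<open>B A\<^sup>-\<^sup>1 B\<^sup>T\<close>, written as an
  \<open>A\<close>-energy of the lifts \<open>E x\<close> and \<open>E y\<close> so that symmetry
  and sign come from \<open>A\<close>.\<close>

definition q :: "real vec \<Rightarrow> real vec \<Rightarrow> real" where "q x y = scalar_prod (E x) (A *\<^sub>v E y)"

lemma q_sym: "x \<in> carrier_vec N \<Longrightarrow> y \<in> carrier_vec N \<Longrightarrow> q x y = q y x"
  unfolding q_def by (rule sym_scalar_prod[OF A]) auto

lemma q_add: "\<lbrakk>x \<in> carrier_vec N; y \<in> carrier_vec N; z \<in> carrier_vec N\<rbrakk> \<Longrightarrow> q (x + y) z = q x z + q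
    y z"
  unfolding q_def E_add by (rule add_scalar_prod_distrib[of _ n]) (use A in auto)

lemma q_smult: "\<lbrakk>x \<in> carrier_vec N; z \<in> carrier_vec N\<rbrakk> \<Longrightarrow> q (c \<cdot>\<^sub>v x) z = c * q x z"
  unfolding q_def E_smult using A by simp

lemma q_nonneg: "x \<in> carrier_vec N \<Longrightarrow> 0 \<le> q x x"
  using A_pd[of "E x"] A by (cases "E x = 0\<^sub>v n") (auto simp: q_def less_imp_le)

lemma form_B: "x \<in> carrier_vec n \<Longrightarrow> y \<in> carrier_vec N \<Longrightarrow> scalar_prod y (B *\<^sub>v x) = scalar_prod (A
    *\<^sub>v E y) x"
  using transpose_vec_mult_scalar[OF B] by (simp add: A_E)

lemma B_E: assumes "x \<in> carrier_vec N" "y \<in> carrier_vec N" shows "scalar_prod y (B *\<^sub>v E x) = q x y"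
  using form_B[of "E x" y] comm_scalar_prod[of "A *\<^sub>v E y" n "E x"] A assms by (simp add: q_def)

text \<open>\<open>B_le\<close> is applied to the lift \<open>E x\<close> itself, for which both
  sides contain \<open>q x x\<close>; one factor cancels.\<close>

lemma q_upper: assumes x: "x \<in> carrier_vec N" shows "q x x \<le> d * ip x x"
proof (cases "q x x = 0")
  case True
  then show ?thesis using d ip_nonneg[of x] by simp
next
  case False
  then have pos: "q x x > 0" using q_nonneg[OF x] by simp
  have "(q x x)\<^sup>2 \<le> d * ip x x * q x x"
    using B_le[OF x E_closed[OF x]] by (simp add: B_E[OF x x] ip_form[OF x x] q_def)
  then show ?thesis using pos by (simp add: power2_eq_square)
qed

lemma q_e: assumes x: "x \<in> carrier_vec N" shows "q x e = 0"
  using B_E[OF x e] one_B[OF E_closed[OF x]] by simp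

text \<open>The supremum is the norm of \<open>B\<^sup>T x\<close> dual to the
  \<open>A\<close>-norm: Cauchy--Schwarz in the form of \<open>A\<close> bounds each quotient by
  \<open>sqrt (q x x)\<close>.\<close>

lemma q_lower:
  assumes x: "x \<in> carrier_vec N" and wx: "scalar_prod w x = 0"
  shows "\<beta>\<^sup>2 * ip x x \<le> q x x"
proof -
  have "scalar_prod e (M *\<^sub>v x) = 0" using wx x by (simp add: ip_form ip_e)
  then have "\<beta> * sqrt (ip x x) \<le> (SUP v\<in>carrier_vec n - {0\<^sub>v n}. scalar_prod x (B *\<^sub>v v) / sqrt
      (scalar_prod v (A *\<^sub>v v)))"
    using inf_sup[OF x] by (simp add: ip_form[OF x x])
  also have "\<dots> \<le> sqrt (q x x)"
  proof (rule cSUP_least)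
    have "unit_vec n 0 \<noteq> (0\<^sub>v n :: real vec)"
      using n by (metis index_unit_vec(2) index_zero_vec(1) zero_neq_one)
    then show "carrier_vec n - {0\<^sub>v n :: real vec} \<noteq> {}" using unit_vec_carrier by blast
  next
    fix v assume "v \<in> carrier_vec n - {0\<^sub>v n :: real vec}"
    then have v: "v \<in> carrier_vec n" "v \<noteq> 0\<^sub>v n" by auto
    have psd: "0 \<le> scalar_prod z (A *\<^sub>v z)" if "z \<in> carrier_vec n" for z
      using A_pd[OF that] A that by (cases "z = 0\<^sub>v n") auto
    have "(scalar_prod x (B *\<^sub>v v))\<^sup>2 = (scalar_prod v (A *\<^sub>v E x))\<^sup>2"
      using form_B[OF v(1) x] comm_scalar_prod[of "A *\<^sub>v E x" n v] A v x by simp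
    also have "\<dots> \<le> scalar_prod v (A *\<^sub>v v) * q x x"
      unfolding q_def by (rule psd_Cauchy_Schwarz[OF A psd]) (use v x in auto)
    finally have "\<bar>scalar_prod x (B *\<^sub>v v)\<bar> \<le> sqrt (scalar_prod v (A *\<^sub>v v)) * sqrt (q x x)"
      by (metis real_sqrt_abs real_sqrt_le_mono real_sqrt_mult)
    then show "scalar_prod x (B *\<^sub>v v) / sqrt (scalar_prod v (A *\<^sub>v v)) \<le> sqrt (q x x)"
      using A_pd[OF v] by (simp add: divide_le_eq mult.commute)
  qed
  finally have "(\<beta> * sqrt (ip x x))\<^sup>2 \<le> (sqrt (q x x))\<^sup>2"
    using \<beta> ip_nonneg[of x] by (intro power_mono) auto
  then show ?thesis using ip_nonneg[of x] q_nonneg[OF x] by (simp add: power_mult_distrib)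
qed

lemma G_closed [simp]: "G y \<in> carrier_vec N" and dim_vec_G [simp]: "dim_vec (G y) = N"
  by (simp_all add: G_def)

lemma ip_G:
  assumes x: "x \<in> carrier_vec N" and y: "y \<in> carrier_vec N"
  shows "ip (G x) y = q x y + \<epsilon> * ip x y + sig * scalar_prod w x * scalar_prod w y"
proof -
  have "ip (G x) y = (\<Sum>i<N. ((B *\<^sub>v E x) $ i + \<epsilon> * (m i * x $ i) + sig * scalar_prod w x * w $ i)
      * y $ i)"
    unfolding ip_def using m by (intro sum.cong refl) (force simp: G_def)
  also have "\<dots> = (\<Sum>i<N. y $ i * (B *\<^sub>v E x) $ i) + \<epsilon> * ip x y + sig * scalar_prod w x * (\<Sum>i<N. w $
      i * y $ i)"
    by (simp add: ip_def sum.distrib sum_distrib_left algebra_simps del: index_mult_mat_vec)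
  also have "(\<Sum>i<N. y $ i * (B *\<^sub>v E x) $ i) = scalar_prod y (B *\<^sub>v E x)"
    using B by (simp add: scalar_prod_def[of y] lessThan_atLeast0 del: index_mult_mat_vec)
  also have "(\<Sum>i<N. w $ i * y $ i) = scalar_prod w y"
    using y by (simp add: scalar_prod_def lessThan_atLeast0)
  finally show ?thesis by (simp add: B_E[OF x y])
qed

lemma G_add: "x \<in> carrier_vec N \<Longrightarrow> y \<in> carrier_vec N \<Longrightarrow> G (x + y) = G x + G y"
proof -
  assume x: "x \<in> carrier_vec N" and y: "y \<in> carrier_vec N"
  have "B *\<^sub>v E (x + y) = B *\<^sub>v E x + B *\<^sub>v E y"
    unfolding E_add[OF x y] by (rule mult_add_distrib_mat_vec[OF B]) (use x y in auto)
  moreover have "scalar_prod w (x + y) = scalar_prod w x + scalar_prod w y"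
    by (rule scalar_prod_add_distrib) (use x y in auto)
  ultimately show ?thesis
    using x y B by (intro eq_vecI) (auto simp: G_def add_divide_distrib algebra_simps simp del:
        index_mult_mat_vec)
qed

lemma G_smult: "x \<in> carrier_vec N \<Longrightarrow> G (c \<cdot>\<^sub>v x) = c \<cdot>\<^sub>v G x"
proof -
  assume x: "x \<in> carrier_vec N"
  have "B *\<^sub>v E (c \<cdot>\<^sub>v x) = c \<cdot>\<^sub>v (B *\<^sub>v E x)"
    unfolding E_smult[OF x] by (rule mult_mat_vec[OF B]) (use x in auto)
  moreover have "scalar_prod w (c \<cdot>\<^sub>v x) = c * scalar_prod w x" using x by simp
  ultimately show ?thesis
    using x B by (intro eq_vecI) (auto simp: G_def algebra_simps simp del: index_mult_mat_vec)
qed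

lemma nrm_gam: "0 < nrm + \<rho> * gam"
  using nrm gam \<rho> by (simp add: add_pos_pos)

lemma sig: "sig * (nrm + \<rho> * gam) = \<rho> * (1 - \<epsilon>) * nrm"
  using nrm_gam by (simp add: sig_def)

text \<open>Both forms are diagonal in the \<open>M\<close>-orthogonal decomposition along \<open>e\<close>, which is an
  eigenvector of \<open>G\<close>, and the orthogonal complement of \<open>w\<close>.\<close>
lemma split_e:
  assumes x: "x \<in> carrier_vec N"
  obtains x0 a where "x0 \<in> carrier_vec N" "scalar_prod w x0 = 0" "scalar_prod w x = a * gam"
    "ip x x = ip x0 x0 + a\<^sup>2 * (nrm * gam)" "q x x = q x0 x0"
proof -
  define a where "a = scalar_prod w x / gam"
  define x0 where "x0 = x + (- a) \<cdot>\<^sub>v e"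
  have x0: "x0 \<in> carrier_vec N" using x by (simp add: x0_def)
  have wx: "scalar_prod w x = a * gam" using gam by (simp add: a_def)
  have "scalar_prod w x0 = scalar_prod w x + scalar_prod w ((- a) \<cdot>\<^sub>v e)"
    unfolding x0_def by (rule scalar_prod_add_distrib) (use x in auto)
  then have wx0: "scalar_prod w x0 = 0" by (simp add: w_e wx)
  have xx: "x = x0 + a \<cdot>\<^sub>v e" using x by (intro eq_vecI) (auto simp: x0_def)
  have ip0: "ip x0 e = 0" using ip_e[OF x0] wx0 by (simp add: ip_sym)
  have "ip x x = ip x0 x + a * ip e x"
    by (subst xx) (simp add: ip_add ip_smult x0)
  also have "ip x0 x = ip x0 x0 + a * ip x0 e"
    unfolding ip_sym[of x0 x] by (subst xx) (simp add: ip_add ip_smult x0 ip_sym[of x0 e])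
  also have "ip e x = a * (nrm * gam)"
    using ip_e[OF x] wx by simp
  finally have ipx: "ip x x = ip x0 x0 + a\<^sup>2 * (nrm * gam)" by (simp add: ip0 power2_eq_square)
  have "q x x = q x0 x + a * q e x"
    by (subst xx) (simp add: q_add q_smult x0 x)
  also have "q e x = 0" using q_sym[OF e x] q_e[OF x] by simp
  also have "q x0 x = q x0 x0 + a * q e x0"
    unfolding q_sym[OF x0 x] by (subst xx) (simp add: q_add q_smult x0)
  also have "q e x0 = 0" using q_sym[OF e x0] q_e[OF x0] by simp
  finally have "q x x = q x0 x0" by simp
  with that x0 wx0 wx ipx show thesis by blast
qed

lemma G_upper:
  assumes x: "x \<in> carrier_vec N"
  shows "ip (G x) x \<le> (d + \<epsilon>) * ip x x"
proof -
  obtain x0 a where s: "x0 \<in> carrier_vec N" "scalar_prod w x0 = 0" "scalar_prod w x = a * gam"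
    "ip x x = ip x0 x0 + a\<^sup>2 * (nrm * gam)" "q x x = q x0 x0" using split_e[OF x] by metis
  \<comment> \<open>On \<open>e\<close> the operator has the eigenvalue
    \<open>\<epsilon> + sig * gam / nrm\<close>; its second summand is at most 1, hence at most
    \<open>d\<close>.\<close>
  have "sig * gam \<le> nrm"
  proof -
    have "sig * gam * (nrm + \<rho> * gam) = gam * (sig * (nrm + \<rho> * gam))" by (simp only: mult_ac)
    also have "\<dots> = (1 - \<epsilon>) * nrm * (\<rho> * gam)" unfolding sig by (simp only: mult_ac)
    also have "\<dots> \<le> 1 * nrm * (nrm + \<rho> * gam)"
      using \<epsilon> \<rho> nrm gam by (intro mult_mono) auto
    finally show ?thesis using nrm_gam by simp
  qed
  also have "nrm \<le> d * nrm" using d nrm by simp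
  finally have "a\<^sup>2 * gam * (sig * gam) \<le> a\<^sup>2 * gam * (d * nrm)"
    using gam by (intro mult_left_mono) auto
  moreover have "q x0 x0 \<le> d * ip x0 x0" using q_upper[OF s(1)] .
  moreover have "ip (G x) x = q x0 x0 + \<epsilon> * ip x x + a\<^sup>2 * gam * (sig * gam)"
    unfolding ip_G[OF x x] s(3,5) by (simp add: power2_eq_square)
  ultimately have "ip (G x) x \<le> d * (ip x0 x0 + a\<^sup>2 * (nrm * gam)) + \<epsilon> * ip x x"
    by (simp add: algebra_simps)
  then show ?thesis unfolding s(4)[symmetric] by (simp add: algebra_simps)
qed

text \<open>On the complement of \<open>w\<close> the inf-sup bound applies. On \<open>e\<close> the
  eigenvalue \<open>\<epsilon> + sig * gam / nrm\<close> is at least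
  \<open>\<rho> * gam / (nrm + \<rho> * gam)\<close> for every \<epsilon> between 0 and 1, and
  \<open>small\<close> says that this quotient is at least \<open>\<beta>\<^sup>2\<close>.\<close>

lemma G_lower:
  assumes x: "x \<in> carrier_vec N" and small: "\<beta>\<^sup>2 * nrm \<le> \<rho> * gam * (1 - \<beta>\<^sup>2)"
  shows "\<beta>\<^sup>2 * ip x x \<le> ip (G x) x"
proof -
  obtain x0 a where s: "x0 \<in> carrier_vec N" "scalar_prod w x0 = 0" "scalar_prod w x = a * gam"
    "ip x x = ip x0 x0 + a\<^sup>2 * (nrm * gam)" "q x x = q x0 x0" using split_e[OF x] by metis
  have pos: "nrm + \<rho> * gam > 0" using nrm gam \<rho> by (simp add: add_pos_pos)
  have "\<beta>\<^sup>2 * nrm \<le> \<epsilon> * nrm + sig * gam"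
  proof -
    have "\<beta>\<^sup>2 * (nrm + \<rho> * gam) \<le> \<rho> * gam" using small by (simp add: algebra_simps)
    also have "\<dots> \<le> \<epsilon> * nrm + \<rho> * gam" using \<epsilon> nrm by simp
    finally have "nrm * (\<beta>\<^sup>2 * (nrm + \<rho> * gam)) \<le> nrm * (\<epsilon> * nrm + \<rho> * gam)"
      using nrm by (intro mult_left_mono) auto
    also have "\<dots> = \<epsilon> * nrm * (nrm + \<rho> * gam) + \<rho> * (1 - \<epsilon>) * nrm * gam" by (simp add: algebra_simps)
    also have "\<dots> = (\<epsilon> * nrm + sig * gam) * (nrm + \<rho> * gam)"
      unfolding sig[symmetric] by (simp add: algebra_simps)
    finally have "(\<beta>\<^sup>2 * nrm) * (nrm + \<rho> * gam) \<le> (\<epsilon> * nrm + sig * gam) * (nrm + \<rho> * gam)"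
      by (simp add: mult_ac)
    then show ?thesis using pos mult_le_cancel_right_pos by blast
  qed
  then have "a\<^sup>2 * gam * (\<beta>\<^sup>2 * nrm) \<le> a\<^sup>2 * gam * (\<epsilon> * nrm + sig * gam)"
    using gam by (intro mult_left_mono) auto
  moreover have "\<beta>\<^sup>2 * ip x0 x0 \<le> q x0 x0" using q_lower[OF s(1,2)] .
  moreover have "0 \<le> \<epsilon> * ip x0 x0" using \<epsilon> ip_nonneg by simp
  moreover have "ip (G x) x = q x0 x0 + \<epsilon> * ip x0 x0 + a\<^sup>2 * gam * (\<epsilon> * nrm + sig * gam)"
    unfolding ip_G[OF x x] s(3,4,5) by (simp add: power2_eq_square algebra_simps)
  ultimately show ?thesis unfolding s(4) by (simp add: algebra_simps)
qed

section \<open>Affine rescaling of \<open>G\<close> to a contraction\<close>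

definition b :: real where "b = d + \<epsilon>"

text \<open>\<open>x \<mapsto> c1 x + l\<close> maps the spectral interval \<open>[\<beta>\<^sup>2, b]\<close> of \<open>G\<close> onto \<open>[-1, 1]\<close>.\<close>
definition c1 :: real where "c1 = 2 / (b - \<beta>\<^sup>2)"
definition l :: real where "l = - (b + \<beta>\<^sup>2) / (b - \<beta>\<^sup>2)"
definition L :: "real vec \<Rightarrow> real vec" where "L y = c1 \<cdot>\<^sub>v G y + l \<cdot>\<^sub>v y"

lemma gap: "\<beta>\<^sup>2 < b"
proof -
  have "\<beta>\<^sup>2 < 1" using \<beta> by (simp add: abs_square_less_1)
  then show ?thesis using d \<epsilon> by (simp add: b_def)
qed

lemma self_adjoint_L:
  assumes small: "\<beta>\<^sup>2 * nrm \<le> \<rho> * gam * (1 - \<beta>\<^sup>2)"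
  shows "self_adjoint_op N ip L"
proof
  fix x y :: "real vec" and c :: real
  assume x: "x \<in> carrier_vec N" and y: "y \<in> carrier_vec N"
  show "L (x + y) = L x + L y"
    using x y by (intro eq_vecI) (auto simp: L_def G_add algebra_simps)
  have "ip (L x) y = c1 * ip (G x) y + l * ip x y" if "x \<in> carrier_vec N" for x y
    using that by (simp add: L_def ip_add ip_smult)
  note ipL = this
  have "ip (G x) y = ip (G y) x"
    using q_sym[OF x y] by (simp add: ip_G x y ip_sym[of x y])
  then show "ip (L x) y = ip x (L y)"
    unfolding ip_sym[of x "L y"] by (simp add: ipL x y ip_sym[of x y])
next
  fix x :: "real vec" and c :: real assume x: "x \<in> carrier_vec N"
  show "L x \<in> carrier_vec N" using x by (simp add: L_def)
  show "L (c \<cdot>\<^sub>v x) = c \<cdot>\<^sub>v L x"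
    using x by (intro eq_vecI) (auto simp: L_def G_smult algebra_simps)
  have ipL: "ip (L x) x = c1 * ip (G x) x + l * ip x x"
    using x by (simp add: L_def ip_add ip_smult)
  have "ip (L x) x = (2 * ip (G x) x - (b + \<beta>\<^sup>2) * ip x x) / (b - \<beta>\<^sup>2)"
  proof -
    have "2 / k * u + - c / k * v = (2 * u - c * v) / k" for k u c v :: real
      by (simp add: diff_divide_distrib)
    then show ?thesis unfolding ipL c1_def l_def .
  qed
  moreover have "ip (G x) x \<le> b * ip x x" "\<beta>\<^sup>2 * ip x x \<le> ip (G x) x"
    using G_upper[OF x] G_lower[OF x small] by (auto simp: b_def)
  then have "\<bar>2 * ip (G x) x - (b + \<beta>\<^sup>2) * ip x x\<bar> \<le> ip x x * (b - \<beta>\<^sup>2)"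
    by (simp add: abs_le_iff algebra_simps)
  ultimately show "\<bar>ip (L x) x\<bar> \<le> ip x x"
    using gap by (simp add: abs_divide divide_le_eq)
qed (simp_all add: ip_add ip_smult, rule ip_sym)

section \<open>Block form of the preconditioned matrix\<close>

definition P :: "real mat" where
  "P = four_block_mat A (0\<^sub>m n N) (- B) (- (\<rho> \<cdot>\<^sub>m outer_prod w w + M))"
definition S :: "real mat" where
  "S = four_block_mat A (- transpose_mat B) (- B) (- (\<epsilon> \<cdot>\<^sub>m M) - \<rho> \<cdot>\<^sub>m outer_prod w w)"
definition Z :: "real mat" where "Z = the (mat_inverse P) * S"

lemma outer_w [simp]: "outer_prod w w \<in> carrier_mat N N"
  and dim_outer_w [simp]: "dim_row (outer_prod w w) = N" "dim_col (outer_prod w w) = N"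
  by (simp_all add: outer_prod_def)

lemma P_carrier: "P \<in> carrier_mat (n + N) (n + N)" and S_carrier: "S \<in> carrier_mat (n + N) (n + N)"
  unfolding P_def S_def using A B by (auto intro!: four_block_carrier_mat minus_carrier_mat)

lemma P_mult:
  assumes x: "x \<in> carrier_vec n" and y: "y \<in> carrier_vec N"
  shows "P *\<^sub>v (x @\<^sub>v y) = (A *\<^sub>v x) @\<^sub>v
    (- (B *\<^sub>v x) + - ((\<rho> * scalar_prod w y) \<cdot>\<^sub>v w + M *\<^sub>v y))"
proof -
  have Sm: "(\<rho> \<cdot>\<^sub>m outer_prod w w + M) *\<^sub>v y = (\<rho> * scalar_prod w y) \<cdot>\<^sub>v w + M *\<^sub>v y"
  proof -
    have "(\<rho> \<cdot>\<^sub>m outer_prod w w) *\<^sub>v y = \<rho> \<cdot>\<^sub>v (outer_prod w w *\<^sub>v y)"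
      using y outer_w by (intro eq_vecI) auto
    moreover have "outer_prod w w *\<^sub>v y = scalar_prod w y \<cdot>\<^sub>v w"
      by (rule outer_prod_mult_vec) (use y in simp)
    ultimately show ?thesis
      using y add_mult_distrib_mat_vec[of "\<rho> \<cdot>\<^sub>m outer_prod w w" N N M y]
          by (simp add: smult_smult_assoc)
  qed
  have "P *\<^sub>v (x @\<^sub>v y) = (A *\<^sub>v x + 0\<^sub>m n N *\<^sub>v y) @\<^sub>v (- B *\<^sub>v x + - (\<rho> \<cdot>\<^sub>m outer_prod w w + M)
      *\<^sub>v y)"
    unfolding P_def by (rule four_block_mat_mult_vec) (use A B x y in auto)
  also have "0\<^sub>m n N *\<^sub>v y = 0\<^sub>v n" using y by (intro eq_vecI) auto
  also have "- B *\<^sub>v x = - (B *\<^sub>v x)" using x B by (intro uminus_mult_mat_vec) auto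
  also have "- (\<rho> \<cdot>\<^sub>m outer_prod w w + M) *\<^sub>v y = - ((\<rho> \<cdot>\<^sub>m outer_prod w w + M) *\<^sub>v y)"
    using y by (intro uminus_mult_mat_vec) auto
  finally show ?thesis using A x by (simp add: Sm)
qed

lemma S_mult:
  assumes x: "x \<in> carrier_vec n" and y: "y \<in> carrier_vec N"
  shows "S *\<^sub>v (x @\<^sub>v y) = (A *\<^sub>v x + - (A *\<^sub>v E y)) @\<^sub>v
    (- (B *\<^sub>v x) + (- (\<epsilon> \<cdot>\<^sub>v (M *\<^sub>v y)) - (\<rho> * scalar_prod w y) \<cdot>\<^sub>v w))"
proof -
  have "outer_prod w w *\<^sub>v y = scalar_prod w y \<cdot>\<^sub>v w"
    by (rule outer_prod_mult_vec) (use y in simp)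
  moreover have "(\<rho> \<cdot>\<^sub>m outer_prod w w) *\<^sub>v y = \<rho> \<cdot>\<^sub>v (outer_prod w w *\<^sub>v y)"
    using y outer_w by (intro eq_vecI) auto
  ultimately have o: "(\<rho> \<cdot>\<^sub>m outer_prod w w) *\<^sub>v y = (\<rho> * scalar_prod w y) \<cdot>\<^sub>v w"
    by (simp add: smult_smult_assoc)
  have "(\<epsilon> \<cdot>\<^sub>m M) *\<^sub>v y = \<epsilon> \<cdot>\<^sub>v (M *\<^sub>v y)" using y by (intro eq_vecI) auto
  then have eM: "(- (\<epsilon> \<cdot>\<^sub>m M)) *\<^sub>v y = - (\<epsilon> \<cdot>\<^sub>v (M *\<^sub>v y))" using y
      by (simp add: uminus_mult_mat_vec)
  have D: "(- (\<epsilon> \<cdot>\<^sub>m M) - \<rho> \<cdot>\<^sub>m outer_prod w w) *\<^sub>v y = - (\<epsilon> \<cdot>\<^sub>v (M *\<^sub>v y)) - (\<rho> * scalar_prod w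
      y) \<cdot>\<^sub>v w"
    unfolding o[symmetric] eM[symmetric] by (rule minus_mult_distrib_mat_vec) (use y in auto)
  have "S *\<^sub>v (x @\<^sub>v y) = (A *\<^sub>v x + - transpose_mat B *\<^sub>v y) @\<^sub>v
      (- B *\<^sub>v x + (- (\<epsilon> \<cdot>\<^sub>m M) - \<rho> \<cdot>\<^sub>m outer_prod w w) *\<^sub>v y)"
    unfolding S_def by (rule four_block_mat_mult_vec) (use A B x y in auto)
  also have "- transpose_mat B *\<^sub>v y = - (A *\<^sub>v E y)"
    using y B by (simp add: A_E)
  also have "- B *\<^sub>v x = - (B *\<^sub>v x)" using x B by (intro uminus_mult_mat_vec) auto
  finally show ?thesis by (simp add: D)
qed

text \<open>Forward substitution: definiteness of \<open>A\<close> gives \<open>x = 0\<close>, and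
  pairing the second block with \<open>y\<close> leaves
  \<open>\<rho> * (scalar_prod w y)\<^sup>2 + ip y y = 0\<close>, a sum of nonnegative
  terms.\<close>

lemma P_inverse:
  "the (mat_inverse P) * P = 1\<^sub>m (n + N)" "the (mat_inverse P) \<in> carrier_mat (n + N) (n + N)"
proof -
  have "v = 0\<^sub>v (n + N)" if v: "v \<in> carrier_vec (n + N)" and 0: "P *\<^sub>v v = 0\<^sub>v (n + N)" for v
  proof -
    define x where "x = vec_first v n"
    define y where "y = vec_last v N"
    have xy: "x \<in> carrier_vec n" "y \<in> carrier_vec N" "v = x @\<^sub>v y"
      using v by (auto simp: x_def y_def)
    have "(0\<^sub>v (n + N) :: real vec) = 0\<^sub>v n @\<^sub>v 0\<^sub>v N" by (intro eq_vecI) auto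
    then have eqs: "A *\<^sub>v x = 0\<^sub>v n" "- (B *\<^sub>v x) + - ((\<rho> * scalar_prod w y) \<cdot>\<^sub>v w + M *\<^sub>v y) =
        0\<^sub>v N"
      using 0 P_mult[OF xy(1,2)] xy(3) append_vec_eq[of "A *\<^sub>v x" n "0\<^sub>v n"] A xy(1) by auto
    have x0: "x = 0\<^sub>v n" using eqs(1) A_pd[OF xy(1)] xy(1) by fastforce
    then have "B *\<^sub>v x = 0\<^sub>v N" using B by (intro eq_vecI) auto
    then have "(\<rho> * scalar_prod w y) \<cdot>\<^sub>v w + M *\<^sub>v y = 0\<^sub>v N"
    proof -
      assume Bx: "B *\<^sub>v x = 0\<^sub>v N"
      show ?thesis
      proof (rule eq_vecI)
        fix i assume "i < dim_vec (0\<^sub>v N :: real vec)"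
        then have i: "i < N" by simp
        have "(- (B *\<^sub>v x) + - ((\<rho> * scalar_prod w y) \<cdot>\<^sub>v w + M *\<^sub>v y)) $ i = 0" using eqs(2) i
            by simp
        then show "((\<rho> * scalar_prod w y) \<cdot>\<^sub>v w + M *\<^sub>v y) $ i = 0\<^sub>v N $ i"
          using i B by (simp add: Bx del: index_mult_mat_vec)
      qed simp
    qed
    then have "0 = scalar_prod y ((\<rho> * scalar_prod w y) \<cdot>\<^sub>v w + M *\<^sub>v y)" using xy by simp
    also have "\<dots> = scalar_prod y ((\<rho> * scalar_prod w y) \<cdot>\<^sub>v w) + scalar_prod y (M *\<^sub>v y)"
      by (rule scalar_prod_add_distrib) (use xy in auto)
    also have "\<dots> = \<rho> * (scalar_prod w y)\<^sup>2 + ip y y"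
      using xy comm_scalar_prod[OF xy(2) w] by (simp add: ip_form power2_eq_square)
    finally have "ip y y = 0" using \<rho> ip_nonneg[of y]
        by (smt (verit) mult_nonneg_nonneg zero_le_power2)
    then have "y $ i = 0" if "i < N" for i
      using m that unfolding ip_def by (subst (asm) sum_nonneg_eq_0_iff) (force simp: mult.assoc
          less_imp_le)+
    then have "y = 0\<^sub>v N" using xy by (intro eq_vecI) auto
    then show ?thesis using xy(3) x0 by (auto intro!: eq_vecI)
  qed
  then show "the (mat_inverse P) * P = 1\<^sub>m (n + N)" "the (mat_inverse P) \<in> carrier_mat (n + N) (n
      + N)"
    by (metis det_nonzero_inverse[OF P_carrier] option.sel)+
qed

lemma Z_carrier: "Z \<in> carrier_mat (n + N) (n + N)"
  unfolding Z_def using P_inverse S_carrier by simp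

text \<open>As \<open>P\<close> is invertible, it suffices that \<open>P\<close> maps the claimed
  vector to the image of the given one under \<open>S\<close>. The first blocks agree by the choice
  of \<open>E\<close>; in the second, the term \<open>B *\<^sub>v E y\<close> left over by the first
  block is part of \<open>G y\<close>.\<close>

lemma Z_mult:
  assumes x: "x \<in> carrier_vec n" and y: "y \<in> carrier_vec N"
  shows "Z *\<^sub>v (x @\<^sub>v y) = (x + - E y) @\<^sub>v G y"
proof -
  let ?v = "(x + - E y) @\<^sub>v G y"
  have v: "x + - E y \<in> carrier_vec n" using x y by simp
  have Mi: "(M *\<^sub>v z) $ i = m i * z $ i" if "z \<in> carrier_vec N" "i < N" for z i
    using mat_diag_mult_vec[OF that] .
  have wG: "nrm * scalar_prod w (G y) = \<epsilon> * nrm * scalar_prod w y + sig * scalar_prod w y * gam"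
    using ip_G[OF y e] q_e[OF y] ip_e[OF G_closed, of y] ip_e[OF y] w_e
        by (simp add: ip_sym[of _ e])
  \<comment> \<open>\<open>sig\<close> is chosen for this equation, which balances the rank-one
    terms of \<open>P\<close> and \<open>S\<close>.\<close>
  have key: "\<rho> * scalar_prod w (G y) + sig * scalar_prod w y = \<rho> * scalar_prod w y"
  proof -
    have "nrm * (\<rho> * scalar_prod w (G y) + sig * scalar_prod w y) =
        \<rho> * (nrm * scalar_prod w (G y)) + nrm * sig * scalar_prod w y" by (simp add: algebra_simps)
    also have "\<dots> = \<rho> * \<epsilon> * nrm * scalar_prod w y + sig * (nrm + \<rho> * gam) * scalar_prod w y"
      unfolding wG by (simp add: algebra_simps)
    also have "\<dots> = nrm * (\<rho> * scalar_prod w y)" unfolding sig by (simp add: algebra_simps)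
    finally show ?thesis using nrm by simp
  qed
  have A1: "A *\<^sub>v (x + - E y) = A *\<^sub>v x + - (A *\<^sub>v E y)"
    and B1: "B *\<^sub>v (x + - E y) = B *\<^sub>v x + - (B *\<^sub>v E y)"
  proof -
    have "- E y = (- 1) \<cdot>\<^sub>v E y" by (intro eq_vecI) auto
    then show "A *\<^sub>v (x + - E y) = A *\<^sub>v x + - (A *\<^sub>v E y)" "B *\<^sub>v (x + - E y) = B *\<^sub>v x + - (B
        *\<^sub>v E y)"
      using mult_add_distrib_mat_vec[OF A(1) x, of "- E y"] mult_mat_vec[OF A(1) E_closed[OF y],
          of "- 1"]
        mult_add_distrib_mat_vec[OF B x, of "- E y"] mult_mat_vec[OF B E_closed[OF y], of "- 1"] y
      by (auto intro!: eq_vecI)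
  qed
  have "P *\<^sub>v ?v = S *\<^sub>v (x @\<^sub>v y)"
    unfolding P_mult[OF v G_closed] S_mult[OF x y] A1 B1
  proof (rule arg_cong[where f = "\<lambda>z. (A *\<^sub>v x + - (A *\<^sub>v E y)) @\<^sub>v z"], rule eq_vecI)
    fix i assume "i < dim_vec (- (B *\<^sub>v x) + (- (\<epsilon> \<cdot>\<^sub>v (M *\<^sub>v y)) - (\<rho> * scalar_prod w y) \<cdot>\<^sub>v w))"
    then have i: "i < N" by simp
    have "m i * G y $ i = (B *\<^sub>v E y) $ i + \<epsilon> * (m i * y $ i) + sig * scalar_prod w y * w $ i"
      using m[OF i] i by (simp add: G_def)
    moreover have "(\<rho> * scalar_prod w (G y) + sig * scalar_prod w y) * w $ i = \<rho> * scalar_prod w y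
        * w $ i"
      unfolding key ..
    ultimately show "(- (B *\<^sub>v x + - (B *\<^sub>v E y)) + - ((\<rho> * scalar_prod w (G y)) \<cdot>\<^sub>v w + M *\<^sub>v G
        y)) $ i =
      (- (B *\<^sub>v x) + (- (\<epsilon> \<cdot>\<^sub>v (M *\<^sub>v y)) - (\<rho> * scalar_prod w y) \<cdot>\<^sub>v w)) $ i"
      using i B by (simp add: Mi y algebra_simps del: index_mult_mat_vec)
  qed (use B in simp)
  then have "Z *\<^sub>v (x @\<^sub>v y) = the (mat_inverse P) *\<^sub>v (P *\<^sub>v ?v)"
    unfolding Z_def using assoc_mult_mat_vec[OF P_inverse(2) S_carrier, of "x @\<^sub>v y"] x y by simp
  also have "\<dots> = ?v"
    using assoc_mult_mat_vec[OF P_inverse(2) P_carrier, of ?v] v P_inverse(1) G_closed[of y] by simp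
  finally show ?thesis .
qed

end

text \<open>The triangle inequality for the seminorm of \<open>ip\<close>, obtained by expansion:
  \<open>L_bound\<close> controls the mixed term and \<open>contraction\<close> the last
  one.\<close>

lemma (in self_adjoint_op) affine_bound:
  assumes x: "x \<in> carrier_vec N"
  shows "ip (a \<cdot>\<^sub>v x + c \<cdot>\<^sub>v L x) (a \<cdot>\<^sub>v x + c \<cdot>\<^sub>v L x) \<le> (\<bar>a\<bar> + \<bar>c\<bar>)\<^sup>2 * ip x x"
proof -
  have "ip x (L x) = ip (L x) x" using x by (simp add: L_sa)
  then have "ip (a \<cdot>\<^sub>v x + c \<cdot>\<^sub>v L x) (a \<cdot>\<^sub>v x + c \<cdot>\<^sub>v L x) =
      a\<^sup>2 * ip x x + 2 * (a * c * ip (L x) x) + c\<^sup>2 * ip (L x) (L x)"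
    using x by (simp add: ip_add ip_add_right ip_smult ip_smult_right power2_eq_square
        algebra_simps)
  also have "\<dots> \<le> a\<^sup>2 * ip x x + 2 * (\<bar>a\<bar> * \<bar>c\<bar> * ip x x) + c\<^sup>2 * ip x x"
  proof -
    have "a * c * ip (L x) x \<le> \<bar>a * c * ip (L x) x\<bar>" by simp
    also have "\<dots> \<le> \<bar>a\<bar> * \<bar>c\<bar> * ip x x"
      unfolding abs_mult using L_bound[OF x] by (intro mult_left_mono) auto
    finally show ?thesis using contraction[OF x] by (intro add_mono mult_left_mono) auto
  qed
  also have "\<dots> = (\<bar>a\<bar> + \<bar>c\<bar>)\<^sup>2 * ip x x" by (simp add: power2_sum algebra_simps flip: abs_mult)
  finally show ?thesis .
qed

lemma vnorm_smult: "x \<in> carrier_vec n \<Longrightarrow> vnorm (c \<cdot>\<^sub>v x) = \<bar>c\<bar> * vnorm x"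
  by (simp add: vnorm_def real_sqrt_mult flip: mult.assoc power2_eq_square)

lemma vnorm_append_le:
  assumes "x \<in> carrier_vec n" "y \<in> carrier_vec N"
  shows "vnorm (x @\<^sub>v y) \<le> vnorm x + vnorm y"
  unfolding vnorm_def scalar_prod_append[OF assms assms]
  by (rule sqrt_add_le_add_sqrt) (rule scalar_prod_self_nonneg)+

lemma vnorm_vec_last_le:
  assumes "v \<in> carrier_vec (n + N)"
  shows "vnorm (vec_last v N) \<le> vnorm v"
proof -
  have "scalar_prod v v = scalar_prod (vec_first v n) (vec_first v n) + scalar_prod (vec_last v N)
      (vec_last v N)"
    using scalar_prod_append[of "vec_first v n" n "vec_last v N" N "vec_first v n" "vec_last v N"]
      vec_first_last_append[OF assms] by simp
  then show ?thesis by (simp add: vnorm_def scalar_prod_self_nonneg)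
qed

section \<open>Euclidean estimates for the Chebyshev residual\<close>

context saddle_point
begin

lemma lambda_M:
  "0 < lambda_min M" "i < N \<Longrightarrow> lambda_min M \<le> m i" "i < N \<Longrightarrow> m i \<le> lambda_max M"
  using m N by (auto simp: lambda_min_def lambda_max_def spectrum_mat_diag lessThan_empty_iff)

lemma lambda_M_le: "lambda_min M \<le> lambda_max M"
  using lambda_M(2,3)[of 0] N by simp

lemma ip_lambda:
  assumes "x \<in> carrier_vec N"
  shows "lambda_min M * scalar_prod x x \<le> ip x x" "ip x x \<le> lambda_max M * scalar_prod x x"
proof -
  have sp: "scalar_prod x x = (\<Sum>i<N. x $ i * x $ i)"
    using assms by (simp add: scalar_prod_def lessThan_atLeast0)
  show "lambda_min M * scalar_prod x x \<le> ip x x" "ip x x \<le> lambda_max M * scalar_prod x x"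
    unfolding sp ip_def sum_distrib_left mult.assoc
    by (intro sum_mono mult_right_mono lambda_M; simp)+
qed

lemma lambda_A: "0 < lambda_min A"
  by (rule lambda_min_Rayleigh(1)[OF A n A_pd])

text \<open>The \<open>A\<close>-energy of \<open>E y\<close> is \<open>q y y\<close>, at most
  \<open>d * ip y y\<close>; the extreme eigenvalues convert both sides. This is the square root in
  the prefactor.\<close>

lemma E_bound:
  assumes y: "y \<in> carrier_vec N"
  shows "vnorm (E y) \<le> sqrt (d * lambda_max M / lambda_min A) * vnorm y"
proof -
  have "lambda_min A * scalar_prod (E y) (E y) \<le> q y y"
    unfolding q_def by (rule lambda_min_Rayleigh(2)[OF A n A_pd]) (use y in auto)
  also have "\<dots> \<le> d * (lambda_max M * scalar_prod y y)"
    using q_upper[OF y] ip_lambda(2)[OF y] d by (smt (verit) mult_left_mono)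
  finally have "scalar_prod (E y) (E y) \<le> d * lambda_max M / lambda_min A * scalar_prod y y"
    using lambda_A by (simp add: field_simps)
  then show ?thesis unfolding vnorm_def real_sqrt_mult[symmetric] by (rule real_sqrt_le_mono)
qed

text \<open>The second block row of \<open>Z\<close> involves only \<open>G\<close>, so a polynomial
  in \<open>Z\<close> acts on the last \<open>N\<close> entries as the same polynomial in
  \<open>G\<close>.\<close>

lemma vec_last_chebyshev:
  assumes r: "r \<in> carrier_vec (n + N)"
  shows "(case chebyshev_vec (\<lambda>v. c1 \<cdot>\<^sub>v (Z *\<^sub>v v) + l \<cdot>\<^sub>v v) r j of (t, u) \<Rightarrow>
    t \<in> carrier_vec (n + N) \<and> u \<in> carrier_vec (n + N) \<and>
    chebyshev_vec L (vec_last r N) j = (vec_last t N, vec_last u N))"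
proof -
  let ?L = "\<lambda>v. c1 \<cdot>\<^sub>v (Z *\<^sub>v v) + l \<cdot>\<^sub>v v"
  have closed: "?L v \<in> carrier_vec (n + N)" if "v \<in> carrier_vec (n + N)" for v
    using that mult_mat_vec_carrier[OF Z_carrier] by simp
  have last: "vec_last (?L v) N = L (vec_last v N)" if v: "v \<in> carrier_vec (n + N)" for v
  proof -
    have Zv: "Z *\<^sub>v v \<in> carrier_vec (n + N)" using mult_mat_vec_carrier[OF Z_carrier v] .
    have "Z *\<^sub>v (vec_first v n @\<^sub>v vec_last v N) = (vec_first v n + - E (vec_last v N)) @\<^sub>v G
        (vec_last v N)"
      by (rule Z_mult) auto
    then have "vec_last (Z *\<^sub>v v) N = G (vec_last v N)"
      using vec_first_last_append[OF v] by (simp add: vec_last_append[of _ n])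
    then show ?thesis using v Zv by (simp add: L_def vec_last_add[of _ n] vec_last_smult[of _ n])
  qed
  show ?thesis
  proof (induction j)
    case 0
    then show ?case using r closed last by simp
  next
    case (Suc j)
    obtain t u where "chebyshev_vec ?L r j = (t, u)" by fastforce
    then show ?case using Suc closed last
      by (simp add: vec_last_add[of _ n] vec_last_smult[of _ n])
  qed
qed

text \<open>Solving \<open>L = c1 G + l\<close> for \<open>G\<close> writes \<open>1 - G\<close> as
  \<open>?a + ?c L\<close>, and the moduli of these coefficients add up to at most
  \<open>1 + b\<close>. This is the part \<open>1 + d + \<epsilon>\<close> of the prefactor;
  dividing by \<open>lambda_min M\<close> returns to the Euclidean norm.\<close>

lemma residual_last_bound:
  assumes small: "\<beta>\<^sup>2 * nrm \<le> \<rho> * gam * (1 - \<beta>\<^sup>2)" and y: "y \<in> carrier_vec N"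
  shows "vnorm (y + (- 1) \<cdot>\<^sub>v G y) \<le> (1 + b) * sqrt (ip y y / lambda_min M)"
proof -
  interpret sa: self_adjoint_op N ip L by (rule self_adjoint_L[OF small])
  let ?a = "1 - (b + \<beta>\<^sup>2) / 2" and ?c = "- (b - \<beta>\<^sup>2) / 2"
  let ?v = "y + (- 1) \<cdot>\<^sub>v G y"
  have cancel: "?c * (c1 * g + l * z) = - g + (b + \<beta>\<^sup>2) / 2 * z" for g z
  proof -
    have gen: "- k / 2 * (2 / k * g + - c / k * z) = - g + c / 2 * z" if "k \<noteq> 0" for k c :: real
      using that by (simp add: field_simps)
    show ?thesis unfolding c1_def l_def by (rule gen) (use gap in simp)
  qed
  have "?v = ?a \<cdot>\<^sub>v y + ?c \<cdot>\<^sub>v L y"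
  proof (rule eq_vecI)
    fix i assume "i < dim_vec (?a \<cdot>\<^sub>v y + ?c \<cdot>\<^sub>v L y)"
    then have i: "i < N" using sa.L_closed[OF y] by simp
    have "(?a \<cdot>\<^sub>v y + ?c \<cdot>\<^sub>v L y) $ i = ?a * y $ i + ?c * (c1 * G y $ i + l * y $ i)"
      using i y by (simp add: L_def)
    also have "\<dots> = ?v $ i" unfolding cancel using i y by (simp add: algebra_simps)
    finally show "?v $ i = (?a \<cdot>\<^sub>v y + ?c \<cdot>\<^sub>v L y) $ i" by simp
  qed (simp add: carrier_vecD[OF sa.L_closed[OF y]])
  then have "ip ?v ?v \<le> (\<bar>?a\<bar> + \<bar>?c\<bar>)\<^sup>2 * ip y y"
    by (simp only: sa.affine_bound[OF y])
  also have "\<dots> \<le> (1 + b)\<^sup>2 * ip y y"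
  proof -
    have "\<bar>?a\<bar> \<le> 1 + (b + \<beta>\<^sup>2) / 2"
    proof -
      have "\<bar>1 - x\<bar> \<le> 1 + x" if "0 \<le> x" for x :: real using that by simp
      moreover have "0 \<le> (b + \<beta>\<^sup>2) / 2" using order.trans[OF zero_le_power2 less_imp_le[OF gap]]
          by simp
      ultimately show ?thesis by blast
    qed
    moreover have "\<bar>?c\<bar> = (b - \<beta>\<^sup>2) / 2" using gap by simp
    ultimately have "\<bar>?a\<bar> + \<bar>?c\<bar> \<le> (1 + (b + \<beta>\<^sup>2) / 2) + (b - \<beta>\<^sup>2) / 2"
      by (metis add_mono order_refl)
    also have "\<dots> = 1 + b" by (simp add: field_simps)
    finally have "\<bar>?a\<bar> + \<bar>?c\<bar> \<le> 1 + b" .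
    then show ?thesis using ip_nonneg[of y] by (intro mult_right_mono power_mono) auto
  qed
  finally have "lambda_min M * scalar_prod ?v ?v \<le> (1 + b)\<^sup>2 * ip y y"
    using ip_lambda(1)[of ?v] y by simp
  then have "scalar_prod ?v ?v \<le> (1 + b)\<^sup>2 * (ip y y / lambda_min M)"
    using lambda_M(1) by (simp add: field_simps)
  then have "vnorm ?v \<le> sqrt ((1 + b)\<^sup>2 * (ip y y / lambda_min M))"
    unfolding vnorm_def by (rule real_sqrt_le_mono)
  also have "\<dots> = (1 + b) * sqrt (ip y y / lambda_min M)"
  proof -
    have "0 \<le> 1 + b" using d \<epsilon> by (simp add: b_def)
    then show ?thesis unfolding real_sqrt_mult by simp
  qed
  finally show ?thesis .
qed

definition fac :: real where "fac = 1 + sqrt (d * lambda_max M / lambda_min A) + d + \<epsilon>"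
definition C3 :: real where "C3 = \<beta>\<^sup>2 * (lambda_min M / lambda_max M) * gam\<^sup>2"

lemma fac_ge: "2 \<le> fac"
proof -
  have "0 \<le> sqrt (d * lambda_max M / lambda_min A)"
    using d lambda_A lambda_M(1) lambda_M_le by simp
  then show ?thesis unfolding fac_def using d \<epsilon> by linarith
qed

lemma gmres_ratio_le_1:
  assumes f: "f \<in> carrier_vec (n + N)" and x0: "x0 \<in> carrier_vec (n + N)"
    and gm: "gmres_iterate Z f x0 k xk" and r0: "f - Z *\<^sub>v x0 \<noteq> 0\<^sub>v (n + N)"
  shows "vnorm (f - Z *\<^sub>v xk) / vnorm (f - Z *\<^sub>v x0) \<le> 1"
proof -
  have r: "f - Z *\<^sub>v x0 \<in> carrier_vec (n + N)" using f x0 Z_carrier by simp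
  interpret krylov Z "f - Z *\<^sub>v x0" "n + N" by unfold_locales (use Z_carrier r in auto)
  show ?thesis
    using gmres_le_initial[OF f x0 refl gm] vnorm_pos[OF r r0] by simp
qed

text \<open>The competitor is \<open>(1 - Z) T_(j+1)(c1 Z + l) r\<close> divided by the value of its
  polynomial at 0; the degree \<open>j + 2\<close> is the number of steps. The factor
  \<open>1 - Z\<close> sends \<open>(x, y)\<close> to \<open>(E y, y - G y)\<close> and so forgets
  the uncontrolled first block. In the square root, \<open>lambda_max M\<close> comes from measuring
  the initial residual in \<open>ip\<close> and \<open>lambda_min M\<close> from the way
  back.\<close>

lemma gmres_ratio_chebyshev:
  assumes small: "\<beta>\<^sup>2 * nrm \<le> \<rho> * gam * (1 - \<beta>\<^sup>2)"
    and f: "f \<in> carrier_vec (n + N)" and x0: "x0 \<in> carrier_vec (n + N)"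
    and gm: "gmres_iterate Z f x0 (Suc (Suc j)) xk" and r0: "f - Z *\<^sub>v x0 \<noteq> 0\<^sub>v (n + N)"
    and \<tau>0: "fst (chebyshev_scalar l j) \<noteq> 0"
  shows "vnorm (f - Z *\<^sub>v xk) / vnorm (f - Z *\<^sub>v x0) \<le>
    fac * sqrt (lambda_max M / lambda_min M) * (1 / \<bar>fst (chebyshev_scalar l j)\<bar>)"
proof -
  define r where "r = f - Z *\<^sub>v x0"
  have r: "r \<in> carrier_vec (n + N)" unfolding r_def using f x0 Z_carrier by simp
  interpret kr: krylov Z r "n + N" by unfold_locales (use Z_carrier r in auto)
  interpret sa: self_adjoint_op N ip L by (rule self_adjoint_L[OF small])
  define \<tau> where "\<tau> = fst (chebyshev_scalar l j)"
  define \<kappa> where "\<kappa> = lambda_max M / lambda_min M"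
  have \<kappa>: "\<kappa> > 0" using lambda_M(1) lambda_M_le by (simp add: \<kappa>_def)
  have rpos: "vnorm r > 0" using vnorm_pos[OF r] r0 by (simp add: r_def)
  have fac: "fac \<ge> 0" using fac_ge by simp
  have \<tau>: "\<tau> \<noteq> 0" using \<tau>0 by (simp add: \<tau>_def)
  show ?thesis
  proof -
    obtain t u where tu: "chebyshev_vec (\<lambda>v. c1 \<cdot>\<^sub>v (Z *\<^sub>v v) + l \<cdot>\<^sub>v v) r j = (t, u)" by fastforce
    define y where "y = vec_last t N"
    have t: "t \<in> carrier_vec (n + N)" and chy: "fst (chebyshev_vec L (vec_last r N) j) = y"
      using vec_last_chebyshev[OF r, of j] tu by (auto simp: y_def)
    have y: "y \<in> carrier_vec N" by (simp add: y_def)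
    define v where "v = t + (- 1) \<cdot>\<^sub>v (Z *\<^sub>v t)"
    have tres: "kr.kres (Suc j) \<tau> t" using kr.kres_chebyshev[OF tu] by (simp add: \<tau>_def)
    \<comment> \<open>The term with the factor \<open>Z\<close> has the value 0 at the origin, so
      the polynomial of \<open>v\<close> keeps the value \<open>\<tau>\<close> there and can be
      normalised.\<close>
    have "kr.kres (Suc (Suc j)) (\<tau> + 0) v"
      unfolding v_def by (rule kr.kres_add[OF kr.kres_Suc[OF tres] kr.kres_mult[OF tres]])
    then have "kr.kres (Suc (Suc j)) (1 / \<tau> * (\<tau> + 0)) ((1 / \<tau>) \<cdot>\<^sub>v v)"
      by (rule kr.kres_smult)
    then have "vnorm (f - Z *\<^sub>v xk) \<le> vnorm ((1 / \<tau>) \<cdot>\<^sub>v v)"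
      using kr.gmres_le[OF f x0 r_def gm] \<tau> by simp
    also have "\<dots> = 1 / \<bar>\<tau>\<bar> * vnorm v"
      using vnorm_smult[of v "n + N" "1 / \<tau>"] t Z_carrier by (simp add: v_def)
    also have "vnorm v \<le> fac * sqrt \<kappa> * vnorm r"
    proof -
      have Zt: "Z *\<^sub>v t = (vec_first t n + - E y) @\<^sub>v G y"
        using Z_mult[of "vec_first t n" y] vec_first_last_append[OF t] y by (simp add: y_def)
      have "v = (vec_first t n @\<^sub>v y) + (- 1) \<cdot>\<^sub>v ((vec_first t n + - E y) @\<^sub>v G y)"
        unfolding v_def Zt using vec_first_last_append[OF t] by (simp add: y_def)
      also have "\<dots> = E y @\<^sub>v (y + (- 1) \<cdot>\<^sub>v G y)"
        using carrier_vecD[OF E_closed[OF y]] carrier_vecD[OF y] by (intro eq_vecI) auto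
      finally have "vnorm v \<le> vnorm (E y) + vnorm (y + (- 1) \<cdot>\<^sub>v G y)"
        using vnorm_append_le[of "E y" n "y + (- 1) \<cdot>\<^sub>v G y" N] y by simp
      also have "\<dots> \<le> sqrt (d * lambda_max M / lambda_min A) * sqrt (ip y y / lambda_min M)
          + (1 + b) * sqrt (ip y y / lambda_min M)"
      proof (rule add_mono[OF _ residual_last_bound[OF small y]])
        have "vnorm y \<le> sqrt (ip y y / lambda_min M)"
          unfolding vnorm_def using ip_lambda(1)[OF y] lambda_M(1)
          by (intro real_sqrt_le_mono) (simp add: field_simps)
        then have "sqrt (d * lambda_max M / lambda_min A) * vnorm y \<le>
            sqrt (d * lambda_max M / lambda_min A) * sqrt (ip y y / lambda_min M)"
          using d lambda_A lambda_M(1) lambda_M_le by (intro mult_left_mono) auto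
        then show "vnorm (E y) \<le> sqrt (d * lambda_max M / lambda_min A) * sqrt (ip y y /
            lambda_min M)"
          using E_bound[OF y] by linarith
      qed
      also have "\<dots> = fac * sqrt (ip y y / lambda_min M)" by (simp add: fac_def b_def algebra_simps)
      also have "\<dots> \<le> fac * (sqrt \<kappa> * vnorm r)"
      proof (rule mult_left_mono[OF _ fac])
        have "ip y y \<le> ip (vec_last r N) (vec_last r N)"
          using sa.chebyshev_vec_bound[of "vec_last r N" j] chy by simp
        also have "\<dots> \<le> lambda_max M * scalar_prod (vec_last r N) (vec_last r N)"
          by (rule ip_lambda) simp
        finally have "ip y y / lambda_min M \<le> \<kappa> * scalar_prod (vec_last r N) (vec_last r N)"
          using lambda_M(1) by (simp add: \<kappa>_def field_simps)
        then have "sqrt (ip y y / lambda_min M) \<le> sqrt \<kappa> * vnorm (vec_last r N)"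
          unfolding vnorm_def real_sqrt_mult[symmetric] by (rule real_sqrt_le_mono)
        also have "\<dots> \<le> sqrt \<kappa> * vnorm r"
          using vnorm_vec_last_le[OF r] \<kappa> by (intro mult_left_mono) auto
        finally show "sqrt (ip y y / lambda_min M) \<le> sqrt \<kappa> * vnorm r" .
      qed
      finally show ?thesis by (simp add: mult.assoc)
    qed
    then have "1 / \<bar>\<tau>\<bar> * vnorm v \<le> 1 / \<bar>\<tau>\<bar> * (fac * sqrt \<kappa> * vnorm r)"
      by (intro mult_left_mono) auto
    finally show ?thesis
      using rpos unfolding r_def[symmetric] \<tau>_def[symmetric] \<kappa>_def[symmetric]
      by (simp add: divide_le_eq mult_ac)
  qed
qed

text \<open>From \<open>gam \<le> 1\<close> follows
  \<open>sqrt C3 = \<beta> * t * gam \<le> \<beta> * t\<close>, and the rate decreases in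
  \<open>sqrt C3\<close>. The lower bound is \<open>(1 - s * t) / (1 + s * t)\<close> with
  \<open>s = \<beta> / sqrt b\<close>, the shape required by \<open>residual_rate_absorb\<close>;
  nonnegativity serves the coarse meshes.\<close>

lemma rate_nonneg: "0 \<le> (sqrt b - sqrt C3) / (sqrt b + sqrt C3)"
  and rate_lower: "(1 - \<beta> / sqrt b * sqrt (lambda_min M / lambda_max M)) / (1 + \<beta> / sqrt b * sqrt
      (lambda_min M / lambda_max M))
    \<le> (sqrt b - sqrt C3) / (sqrt b + sqrt C3)"
proof -
  define t where "t = sqrt (lambda_min M / lambda_max M)"
  have t: "0 < t" "t \<le> 1" using lambda_M(1) lambda_M_le by (auto simp: t_def)
  have b1: "1 < b" using d \<epsilon> by (simp add: b_def)
  then have sb: "1 < sqrt b" by simp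
  have C3: "sqrt C3 = \<beta> * t * gam"
    unfolding C3_def t_def real_sqrt_mult using \<beta> gam by simp
  have C30: "0 \<le> sqrt C3" using C3 \<beta> gam t by simp
  have C3t: "sqrt C3 \<le> \<beta> * t" unfolding C3 using \<beta> gam t by (simp add: mult_left_le)
  have "\<beta> * t \<le> 1" using \<beta> t by (simp add: mult_le_one)
  then have C31: "sqrt C3 \<le> sqrt b" using C3t sb by linarith
  then show "0 \<le> (sqrt b - sqrt C3) / (sqrt b + sqrt C3)" using C30 sb by simp
  have "(1 - \<beta> / sqrt b * t) / (1 + \<beta> / sqrt b * t) = (sqrt b - \<beta> * t) / (sqrt b + \<beta> * t)"
  proof -
    have "1 - \<beta> / sqrt b * t = (sqrt b - \<beta> * t) / sqrt b" "1 + \<beta> / sqrt b * t = (sqrt b + \<beta> * t) /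
        sqrt b"
      using sb by (simp_all add: field_simps)
    then show ?thesis using sb by simp
  qed
  also have "\<dots> \<le> (sqrt b - sqrt C3) / (sqrt b + sqrt C3)"
    by (rule frac_le) (use C30 C3t C31 sb in linarith)+
  finally show "(1 - \<beta> / sqrt b * sqrt (lambda_min M / lambda_max M)) / (1 + \<beta> / sqrt b * sqrt
      (lambda_min M / lambda_max M))
    \<le> (sqrt b - sqrt C3) / (sqrt b + sqrt C3)" unfolding t_def .
qed

theorem gmres_bound:
  assumes small: "\<beta>\<^sup>2 * nrm \<le> \<rho> * gam * (1 - \<beta>\<^sup>2)"
    and f: "f \<in> carrier_vec (n + N)" and x0: "x0 \<in> carrier_vec (n + N)" and k: "1 \<le> k"
    and gm: "gmres_iterate Z f x0 k xk" and r0: "f - Z *\<^sub>v x0 \<noteq> 0\<^sub>v (n + N)"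
  shows "vnorm (f - Z *\<^sub>v xk) / vnorm (f - Z *\<^sub>v x0) \<le>
    2 * fac * ((sqrt b - sqrt C3) / (sqrt b + sqrt C3)) ^ (k - 1)"
proof -
  have R1: "vnorm (f - Z *\<^sub>v xk) / vnorm (f - Z *\<^sub>v x0) \<le> 1"
    by (rule gmres_ratio_le_1[OF f x0 gm r0])
  show ?thesis
  \<comment> \<open>A single step is used up by the factor \<open>1 - Z\<close>; there the power is
    1 and the prefactor alone exceeds the ratio.\<close>
  proof (cases "k = 1")
    case True
    then show ?thesis using R1 fac_ge by simp
  next
    case False
    \<comment> \<open>One step is spent on \<open>1 - Z\<close>, and index \<open>j\<close> of the
      Chebyshev pair means degree \<open>j + 1\<close>.\<close>
    then obtain j where j: "k = Suc (Suc j)" using k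
        by (metis One_nat_def Suc_le_D le_neq_implies_less less_Suc_eq_0_disj not0_implies_Suc
        not_less_eq_eq)
    define s where "s = \<beta> / sqrt b"
    define t where "t = sqrt (lambda_min M / lambda_max M)"
    define qq where "qq = (1 - s) / (1 + s)"
    have b1: "1 < b" using d \<epsilon> by (simp add: b_def)
    then have sb: "1 < sqrt b" by simp
    have "\<beta> < sqrt b" using \<beta>(2) sb by (rule less_trans)
    moreover have "0 < sqrt b" using b1 by simp
    ultimately have s: "0 < s" "s < 1" unfolding s_def using \<beta>(1)
      by (simp_all only: divide_pos_pos divide_less_eq_1_pos)
    have t: "0 < t" "t \<le> 1" using lambda_M(1) lambda_M_le by (auto simp: t_def)
    have tinv: "sqrt (lambda_max M / lambda_min M) = 1 / t"
      by (simp add: t_def real_sqrt_divide)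
    have q0: "0 < qq" using s by (simp add: qq_def)
    have bs: "\<beta>\<^sup>2 = b * s\<^sup>2" using b1 by (simp add: s_def power_divide)
    \<comment> \<open>\<open>qq\<close> is the Chebyshev rate of the interval from
      \<open>\<beta>\<^sup>2 = b * s\<^sup>2\<close> to \<open>b\<close>; the image \<open>l\<close>
      of 0 is the Joukowski point belonging to it.\<close>
    have l: "l = - (1 / qq + qq) / 2"
    proof -
      have "s\<^sup>2 < 1" using s by (simp add: abs_square_less_1)
      then have ne: "1 - s\<^sup>2 \<noteq> 0" "1 - s \<noteq> 0" "1 + s \<noteq> 0" using s by auto
      have "l = - (b * (1 + s\<^sup>2)) / (b * (1 - s\<^sup>2))" unfolding l_def bs by (simp add: algebra_simps)
      also have "\<dots> = - (1 + s\<^sup>2) / (1 - s\<^sup>2)"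
      proof -
        have "- (b * u) / (b * v) = - u / v" for u v using b1 by simp
        then show ?thesis .
      qed
      also have "\<dots> = - (((1 + s)\<^sup>2 + (1 - s)\<^sup>2) / ((1 - s) * (1 + s))) / 2"
        using ne by (simp add: field_simps power2_eq_square)
      also have "((1 + s)\<^sup>2 + (1 - s)\<^sup>2) / ((1 - s) * (1 + s)) = 1 / qq + qq"
        using ne by (simp add: qq_def add_divide_distrib power2_eq_square)
      finally show ?thesis .
    qed
    have "vnorm (f - Z *\<^sub>v xk) / vnorm (f - Z *\<^sub>v x0) \<le> fac * (1 / t) * (1 / \<bar>fst
        (chebyshev_scalar l j)\<bar>)"
      using gmres_ratio_chebyshev[OF small f x0 gm[unfolded j] r0]
          chebyshev_scalar_lower_bound(2)[OF q0, of j]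
      unfolding tinv l by blast
    also have "\<dots> \<le> fac * (1 / t) * (2 * qq ^ Suc j)"
      unfolding l using chebyshev_scalar_lower_bound(1)[OF q0, of j] fac_ge t
          by (intro mult_left_mono) auto
    finally have "vnorm (f - Z *\<^sub>v xk) / vnorm (f - Z *\<^sub>v x0) \<le> fac * (1 / t) * (2 * qq ^ Suc j)" .
    then have "vnorm (f - Z *\<^sub>v xk) / vnorm (f - Z *\<^sub>v x0) \<le> 2 * fac * ((sqrt b - sqrt C3) / (sqrt
        b + sqrt C3)) ^ Suc j"
      using residual_rate_absorb[OF s t fac_ge R1 qq_def rate_lower[folded s_def t_def]] by blast
    then show ?thesis using j by simp
  qed
qed

end

subsection \<open>Facets of simplicial meshes\<close>

text \<open>A set of codimension one spans the whole hyperplane \<open>n \<bullet> x = c\<close>, so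
  \<open>n'\<close> annihilates every vector orthogonal to \<open>n\<close>, in particular its own
  component orthogonal to \<open>n\<close>.\<close>

lemma unit_normal_unique:
  fixes n n' :: "'a::euclidean_space"
  assumes F: "aff_dim F = int DIM('a) - 1" and n: "norm n = 1" "norm n' = 1"
    and c: "\<And>x. x \<in> F \<Longrightarrow> n \<bullet> x = c" "\<And>x. x \<in> F \<Longrightarrow> n' \<bullet> x = c'"
  shows "n' = n \<or> n' = - n"
proof -
  have n0: "n \<noteq> 0" using n by auto
  have "affine hull F \<subseteq> {x. n \<bullet> x = c}"
    by (rule hull_minimal) (auto simp: c affine_hyperplane)
  moreover have "aff_dim (affine hull F) = aff_dim {x. n \<bullet> x = c}"
    using F n0 by simp
  moreover have ne: "affine hull F \<noteq> {}"
    using F by auto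
  ultimately have eq: "affine hull F = {x. n \<bullet> x = c}"
    by (intro affine_dim_equal) (auto simp: affine_hyperplane)
  have "affine hull F \<subseteq> {x. n' \<bullet> x = c'}"
    by (rule hull_minimal) (auto simp: c affine_hyperplane)
  with eq have sub: "n' \<bullet> x = c'" if "n \<bullet> x = c" for x
    using that by auto
  obtain x0 where x0: "n \<bullet> x0 = c" using ne eq by auto
  have perp: "n' \<bullet> z = 0" if "n \<bullet> z = 0" for z
    using sub[of "x0 + z"] sub[of x0] x0 that by (simp add: inner_add_right)
  define k where "k = n' \<bullet> n"
  define z where "z = n' - k *\<^sub>R n"
  have "n \<bullet> z = 0" using n by (simp add: z_def k_def inner_diff_right inner_commute flip: norm_eq_1)
  then have "n' \<bullet> z = 0" "n \<bullet> z = 0" using perp by auto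
  then have "z \<bullet> z = 0" by (simp add: z_def inner_diff_left)
  then have nk: "n' = k *\<^sub>R n" by (simp add: z_def)
  then have "\<bar>k\<bar> = 1" using n by (metis norm_scaleR mult.right_neutral)
  then show ?thesis using nk by (auto simp: abs_if split: if_splits)
qed

lemma facet_unit_normal:
  fixes K :: "'a::euclidean_space set"
  assumes K: "polyhedron K" and F: "F facet_of K"
  obtains n c where "norm n = 1" "\<And>x. x \<in> K \<Longrightarrow> n \<bullet> x \<le> c" "F = K \<inter> {x. n \<bullet> x = c}"
proof -
  obtain a b where a: "a \<noteq> 0" "K \<subseteq> {x. a \<bullet> x \<le> b}" "F = K \<inter> {x. a \<bullet> x = b}"
    using facet_of_polyhedron[OF K F] by metis
  show thesis
  proof (rule that[of "a /\<^sub>R norm a" "b / norm a"])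
    show "norm (a /\<^sub>R norm a) = 1" using a by simp
    show "(a /\<^sub>R norm a) \<bullet> x \<le> b / norm a" if "x \<in> K" for x
      using a that by (auto simp: divide_simps)
    show "F = K \<inter> {x. (a /\<^sub>R norm a) \<bullet> x = b / norm a}"
      using a by (auto simp: divide_simps)
  qed
qed

lemma aff_dim_facet:
  fixes K :: "'a::euclidean_space set"
  assumes "interior K \<noteq> {}" "F facet_of K"
  shows "aff_dim F = int DIM('a) - 1"
  using assms aff_dim_nonempty_interior[of K] by (simp add: facet_of_def)

text \<open>The opposite normal is excluded because \<open>K\<close> would then lie in a hyperplane.
  This justifies the definite description in \<open>outward_normal\<close>.\<close>

lemma outward_normal_unique:
  fixes K :: "'a::euclidean_space set"
  assumes K: "interior K \<noteq> {}" and F: "F facet_of K"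
    and n: "norm n = 1" "\<And>x. x \<in> F \<Longrightarrow> n \<bullet> x = c" "\<And>x. x \<in> K \<Longrightarrow> n \<bullet> x \<le> c"
  shows "outward_normal K F = n"
  unfolding outward_normal_def
proof (rule the_equality)
  show "norm n = 1 \<and> (\<exists>c. (\<forall>x\<in>F. n \<bullet> x = c) \<and> (\<forall>x\<in>K. n \<bullet> x \<le> c))"
    using n by auto
next
  fix m assume "norm m = 1 \<and> (\<exists>c. (\<forall>x\<in>F. m \<bullet> x = c) \<and> (\<forall>x\<in>K. m \<bullet> x \<le> c))"
  then obtain c' where m: "norm m = 1" "\<And>x. x \<in> F \<Longrightarrow> m \<bullet> x = c'" "\<And>x. x \<in> K \<Longrightarrow> m \<bullet> x \<le> c'"
    by blast
  have "m = n \<or> m = - n"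
    using unit_normal_unique[OF aff_dim_facet[OF K F] n(1) m(1) n(2) m(2)] .
  moreover have "m \<noteq> - n"
  proof
    assume mn: "m = - n"
    obtain x where "x \<in> F" using F by (auto simp: facet_of_def)
    then have "c' = - c" using m(2)[of x] n(2)[of x] mn by simp
    then have "K \<subseteq> {x. n \<bullet> x = c}"
      using m(3) n(3) mn by force
    then have "interior K \<subseteq> interior {x. n \<bullet> x = c}" by (rule interior_mono)
    moreover have "n \<noteq> 0" using n by auto
    ultimately show False using K by simp
  qed
  ultimately show "m = n" by blast
qed

lemma outward_normal:
  fixes K :: "'a::euclidean_space set"
  assumes K: "polyhedron K" "interior K \<noteq> {}" and F: "F facet_of K"
  obtains c where "norm (outward_normal K F) = 1" "\<And>x. x \<in> K \<Longrightarrow> outward_normal K F \<bullet> x \<le> c"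
    "F = K \<inter> {x. outward_normal K F \<bullet> x = c}"
proof -
  obtain n c where n: "norm n = 1" "\<And>x. x \<in> K \<Longrightarrow> n \<bullet> x \<le> c" "F = K \<inter> {x. n \<bullet> x = c}"
    by (rule facet_unit_normal[OF K(1) F]) blast
  have "outward_normal K F = n"
    using outward_normal_unique[OF K(2) F n(1), of c] n by auto
  then show thesis using that n by metis
qed

text \<open>Seen from an interior point, the part of a neighbourhood of \<open>x\<close> on the inner side of the facet
  projects centrally into the facet.\<close>
lemma facet_half_ball:
  fixes K :: "'a::euclidean_space set"
  assumes K: "convex K" "interior K \<noteq> {}" and F: "F facet_of K" and n: "norm n = 1"
    and le: "\<And>x. x \<in> K \<Longrightarrow> n \<bullet> x \<le> c" and Feq: "F = K \<inter> {x. n \<bullet> x = c}"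
    and x: "x \<in> rel_interior F"
  obtains e where "e > 0" "ball x e \<inter> {y. n \<bullet> y \<le> c} \<subseteq> K"
proof -
  have n0: "n \<noteq> 0" using n by auto
  have "affine hull F \<subseteq> {x. n \<bullet> x = c}"
    by (rule hull_minimal) (auto simp: Feq affine_hyperplane)
  moreover have "aff_dim (affine hull F) = aff_dim {x. n \<bullet> x = c}"
    using aff_dim_facet[OF K(2) F] n0 by simp
  moreover have "affine hull F \<noteq> {}" using F by (auto simp: facet_of_def)
  ultimately have hull: "affine hull F = {x. n \<bullet> x = c}"
    by (intro affine_dim_equal) (auto simp: affine_hyperplane)
  have xF: "x \<in> F" using x rel_interior_subset by blast
  then have nx: "n \<bullet> x = c" using Feq by auto
  obtain d where d: "d > 0" "ball x d \<inter> affine hull F \<subseteq> F"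
    using x by (auto simp: mem_rel_interior_ball)
  obtain z where z: "z \<in> interior K" using K by auto
  have "interior K \<subseteq> interior {x. n \<bullet> x \<le> c}" by (rule interior_mono) (use le in auto)
  then have nz: "n \<bullet> z < c" using z n0 by auto
  have zK: "z \<in> K" using z interior_subset by blast
  \<comment> \<open>The point where the line from \<open>z\<close> through \<open>y\<close> meets
    the hyperplane of the facet. The number \<open>s\<close> below is the reciprocal of the
    stretching factor; it is at most 1 on the inner side, so \<open>y\<close> lies between
    \<open>z\<close> and \<open>p y\<close>.\<close>
  define p where "p y = z + ((c - n \<bullet> z) / (n \<bullet> y - n \<bullet> z)) *\<^sub>R (y - z)" for y
  have px: "p x = x" using nx nz by (simp add: p_def)
  have "isCont p x" unfolding p_def using nx nz by (intro continuous_intros) auto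
  then obtain e1 where e1: "e1 > 0" "\<And>y. dist y x < e1 \<Longrightarrow> dist (p y) (p x) < d"
    using d(1) unfolding continuous_at_eps_delta by metis
  have "isCont (\<lambda>y. n \<bullet> y - n \<bullet> z) x" by (intro continuous_intros)
  then obtain e2 where e2: "e2 > 0" "\<And>y. dist y x < e2 \<Longrightarrow> dist (n \<bullet> y - n \<bullet> z) (n \<bullet> x - n \<bullet> z) < c
      - n \<bullet> z"
    using nz unfolding continuous_at_eps_delta by (metis diff_gt_0_iff_gt)
  show thesis
  proof (rule that[of "min e1 e2"])
    show "min e1 e2 > 0" using e1 e2 by auto
    show "ball x (min e1 e2) \<inter> {y. n \<bullet> y \<le> c} \<subseteq> K"
    proof safe
      fix y assume y: "y \<in> ball x (min e1 e2)" "n \<bullet> y \<le> c"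
      have pos: "n \<bullet> y - n \<bullet> z > 0"
        using e2(2)[of y] y nx by (auto simp: dist_real_def dist_commute)
      define s where "s = (n \<bullet> y - n \<bullet> z) / (c - n \<bullet> z)"
      have s: "0 < s" "s \<le> 1" using pos nz y by (auto simp: s_def divide_simps)
      have "p y \<in> ball x d" using e1(2)[of y] y px by (auto simp: dist_commute)
      moreover have "n \<bullet> p y = c" using pos by (simp add: p_def inner_simps)
      ultimately have "p y \<in> F" using d hull by auto
      then have "p y \<in> K" using Feq by auto
      then have "(1 - s) *\<^sub>R z + s *\<^sub>R p y \<in> K"
        using K(1) zK s by (auto simp: convex_alt)
      moreover define q where "q = (c - n \<bullet> z) / (n \<bullet> y - n \<bullet> z)"
      have q: "p y = z + q *\<^sub>R (y - z)" "s * q = 1"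
        using pos nz by (simp_all add: p_def s_def q_def)
      have "(1 - s) *\<^sub>R z + s *\<^sub>R p y = z + (s * q) *\<^sub>R (y - z)"
        unfolding q(1) by (simp add: algebra_simps)
      then have "(1 - s) *\<^sub>R z + s *\<^sub>R p y = y"
        by (simp add: q(2))
      ultimately show "y \<in> K" by simp
    qed
  qed
qed

locale simplicial_complex_full =
  fixes T :: "'a::euclidean_space set set"
  assumes tri: "triangulation T" and simplex: "\<And>K. K \<in> T \<Longrightarrow> int DIM('a) simplex K"
begin

lemma finite_T: "finite T"
  using tri by (simp add: triangulation_def)

lemma polyhedron_T: "K \<in> T \<Longrightarrow> polyhedron K"
  using simplex simplex_imp_polyhedron by blast

lemma convex_T: "K \<in> T \<Longrightarrow> convex K"
  using simplex convex_simplex by blast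

lemma compact_T: "K \<in> T \<Longrightarrow> compact K"
  using simplex compact_simplex by blast

lemma aff_dim_T: "K \<in> T \<Longrightarrow> aff_dim K = int DIM('a)"
  using simplex aff_dim_simplex by blast

lemma interior_T: assumes "K \<in> T" shows "interior K \<noteq> {}"
proof -
  have "rel_interior K = interior K"
    using aff_dim_T[OF assms] by (metis aff_dim_eq_full rel_interior_interior)
  moreover have "K \<noteq> {}" using aff_dim_T[OF assms] by auto
  ultimately show ?thesis using rel_interior_eq_empty convex_T[OF assms] by metis
qed

lemma full_face_T:
  assumes "K \<in> T" "I face_of K" "aff_dim I = int DIM('a)"
  shows "I = K"
  using face_of_aff_dim_lt[OF convex_T[OF assms(1)] assms(2)] aff_dim_T[OF assms(1)] assms(3)
      by auto

lemma Int_face_T: "K \<in> T \<Longrightarrow> K' \<in> T \<Longrightarrow> (K \<inter> K') face_of K"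
  using tri by (simp add: triangulation_def)

lemma Int_eq_T:
  assumes "K \<in> T" "K' \<in> T" "aff_dim (K \<inter> K') = int DIM('a)"
  shows "K = K'"
  using full_face_T[OF assms(1) Int_face_T[OF assms(1,2)] assms(3)]
    full_face_T[OF assms(2) Int_face_T[OF assms(2,1)]] assms(3) by (simp add: Int_commute)

lemma negligible_Int_T:
  assumes "K \<in> T" "K' \<in> T" "K \<noteq> K'"
  shows "negligible (K \<inter> K')"
proof -
  have "interior (K \<inter> K') = {}"
    using Int_eq_T[OF assms(1,2)] assms(3) aff_dim_nonempty_interior by blast
  moreover have "convex (K \<inter> K')" using convex_T assms by (intro convex_Int)
  ultimately show ?thesis by (simp add: negligible_convex_interior)
qed

lemma facet_T_nonempty_rel_interior:
  assumes "K \<in> T" "F facet_of K"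
  obtains x where "x \<in> rel_interior F" "x \<in> F" "x \<in> K"
proof -
  have "convex F" "F \<noteq> {}" "F \<subseteq> K"
    using facet_of_imp_subset[OF assms(2)] face_of_imp_convex[OF facet_of_imp_face_of[OF assms(2)]]
      assms(2) by (auto simp: facet_of_def)
  then show ?thesis using that rel_interior_eq_empty rel_interior_subset by blast
qed

text \<open>The face \<open>K \<inter> K'\<close> meets the relative interior of \<open>F\<close>
  and therefore contains \<open>F\<close>; for distinct elements its dimension is below that of
  \<open>K\<close>, so it cannot be larger than \<open>F\<close>.\<close>

lemma facet_shared:
  assumes K: "K \<in> T" "K' \<in> T" and F: "F facet_of K" and x: "x \<in> rel_interior F" "x \<in> K'"
  shows "F facet_of K'"
proof (cases "K' = K")
  case False
  let ?I = "K \<inter> K'"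
  have xF: "x \<in> F" using x rel_interior_subset by blast
  have FK: "F \<subseteq> K" using F facet_of_imp_subset by blast
  have sub: "F \<subseteq> ?I"
    by (rule subset_of_face_of[OF Int_face_T[OF K] FK]) (use x xF FK in auto)
  have face: "F face_of ?I"
    using face_of_subset[OF facet_of_imp_face_of[OF F] sub] by simp
  have "aff_dim ?I < int DIM('a)"
    using Int_eq_T[OF K] False aff_dim_le_DIM[of ?I] by force
  moreover have dF: "aff_dim F = int DIM('a) - 1" using aff_dim_facet[OF interior_T[OF K(1)] F] .
  ultimately have "\<not> aff_dim F < aff_dim ?I" by simp
  then have "F = ?I"
    using face_of_aff_dim_lt[OF convex_Int[OF convex_T[OF K(1)] convex_T[OF K(2)]] face] by blast
  then have "F face_of K'" using Int_face_T[OF K(2,1)] by (simp add: Int_commute)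
  then show ?thesis using dF aff_dim_T[OF K(2)] xF by (auto simp: facet_of_def)
qed (use F in simp)

lemma facet_hyperplane:
  assumes "K \<in> T" "F facet_of K"
  obtains c where "norm (outward_normal K F) = 1" "\<And>x. x \<in> K \<Longrightarrow> outward_normal K F \<bullet> x \<le> c"
    "F = K \<inter> {x. outward_normal K F \<bullet> x = c}"
  using outward_normal[OF polyhedron_T interior_T] assms by metis

lemma norm_outward_normal:
  assumes "K \<in> T" "F facet_of K"
  shows "norm (outward_normal K F) = 1"
  using facet_hyperplane[OF assms] by blast

text \<open>With equal normals both elements would contain the same half of a small ball around a
  point of the facet, and their intersection would have interior points.\<close>

lemma outward_normal_opposite:
  assumes K: "K \<in> T" "K' \<in> T" "K \<noteq> K'" and F: "F facet_of K" "F facet_of K'"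
  shows "outward_normal K' F = - outward_normal K F"
proof -
  obtain c where c: "norm (outward_normal K F) = 1" "\<And>x. x \<in> K \<Longrightarrow> outward_normal K F \<bullet> x \<le> c"
    "F = K \<inter> {x. outward_normal K F \<bullet> x = c}"
    by (rule facet_hyperplane[OF K(1) F(1)]) blast
  obtain c' where c': "norm (outward_normal K' F) = 1" "\<And>x. x \<in> K' \<Longrightarrow> outward_normal K' F \<bullet> x \<le> c'"
    "F = K' \<inter> {x. outward_normal K' F \<bullet> x = c'}"
    by (rule facet_hyperplane[OF K(2) F(2)]) blast
  have "outward_normal K' F = outward_normal K F \<or> outward_normal K' F = - outward_normal K F"
    by (rule unit_normal_unique[OF aff_dim_facet[OF interior_T[OF K(1)] F(1)] c(1) c'(1)])
      (use c(3) c'(3) in blast)+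
  moreover have False if same: "outward_normal K' F = outward_normal K F"
  proof -
    define n where "n = outward_normal K F"
    obtain x where x: "x \<in> rel_interior F" "x \<in> F" "x \<in> K"
      using facet_T_nonempty_rel_interior[OF K(1) F(1)] .
    have nx: "n \<bullet> x = c" "c' = c" using c(3) c'(3) x(2) same by (auto simp: n_def)
    obtain e where e: "e > 0" "ball x e \<inter> {y. n \<bullet> y \<le> c} \<subseteq> K"
      using facet_half_ball[OF convex_T interior_T F(1) c(1,2,3) x(1)] K(1) unfolding n_def by blast
    obtain e' where e': "e' > 0" "ball x e' \<inter> {y. n \<bullet> y \<le> c} \<subseteq> K'"
      using facet_half_ball[OF convex_T interior_T F(2) c'(1,2,3) x(1)] K(2) same nx(2)
      unfolding n_def by auto
    let ?B = "ball x (min e e') \<inter> {y. n \<bullet> y < c}"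
    have "?B \<subseteq> K \<inter> K'" using e e' by auto
    moreover have "open ?B" by (intro open_Int open_ball open_halfspace_lt)
    moreover have "x - (min e e' / 2) *\<^sub>R n \<in> ?B"
      using e(1) e'(1) nx(1) c(1) by (auto simp: n_def dist_norm inner_diff_right simp flip:
          power2_norm_eq_inner)
    ultimately have "interior (K \<inter> K') \<noteq> {}"
      using interior_maximal by blast
    then show False using Int_eq_T[OF K(1,2)] K(3) aff_dim_nonempty_interior by blast
  qed
  ultimately show ?thesis by blast
qed

text \<open>Three elements would have pairwise opposite normals on \<open>F\<close>, forcing a
  normal to equal its negative.\<close>

lemma facet_elements_le_2:
  assumes K: "K \<in> T" "K' \<in> T" "K'' \<in> T" "K \<noteq> K'" "K \<noteq> K''"
    and F: "F facet_of K" "F facet_of K'" "F facet_of K''"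
  shows "K' = K''"
proof (rule ccontr)
  assume "K' \<noteq> K''"
  then have "outward_normal K F = - outward_normal K F"
    using outward_normal_opposite[of K K' F] outward_normal_opposite[of K K'' F]
      outward_normal_opposite[of K' K'' F] assms by simp
  then have "outward_normal K F = 0"
    by (simp add: eq_neg_iff_add_eq_0 flip: scaleR_2)
  then show False using norm_outward_normal[OF K(1) F(1)] by simp
qed

lemma rel_interior_facet_interior_Un:
  assumes K: "K \<in> T" "K' \<in> T" "K \<noteq> K'" and F: "F facet_of K" "F facet_of K'" and x: "x \<in>
      rel_interior F"
  shows "x \<in> interior (K \<union> K')"
proof -
  define n where "n = outward_normal K F"
  obtain c where c: "norm (outward_normal K F) = 1" "\<And>x. x \<in> K \<Longrightarrow> outward_normal K F \<bullet> x \<le> c"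
    "F = K \<inter> {x. outward_normal K F \<bullet> x = c}"
    by (rule facet_hyperplane[OF K(1) F(1)]) blast
  obtain c' where c': "norm (outward_normal K' F) = 1" "\<And>x. x \<in> K' \<Longrightarrow> outward_normal K' F \<bullet> x \<le> c'"
    "F = K' \<inter> {x. outward_normal K' F \<bullet> x = c'}"
    by (rule facet_hyperplane[OF K(2) F(2)]) blast
  have opp: "outward_normal K' F = - n"
    using outward_normal_opposite[OF K F] by (simp add: n_def)
  have "x \<in> F" using x rel_interior_subset by blast
  then have cc: "c' = - c" using c(3) c'(3) opp by (auto simp: n_def)
  obtain e where e: "e > 0" "ball x e \<inter> {y. n \<bullet> y \<le> c} \<subseteq> K"
    using facet_half_ball[OF convex_T interior_T F(1) c(1,2,3) x(1)] K(1) unfolding n_def by blast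
  obtain e' where e': "e' > 0" "ball x e' \<inter> {y. - n \<bullet> y \<le> - c} \<subseteq> K'"
    using facet_half_ball[OF convex_T interior_T F(2) c'(1,2,3) x(1)] K(2) opp cc by auto
  have "ball x (min e e') \<subseteq> K \<union> K'"
    using e e' by (auto simp: subset_iff) (meson linear)
  then show ?thesis using e(1) e'(1) by (meson centre_in_ball interior_maximal min_less_iff_conj
      open_ball subsetD)
qed

text \<open>If a relative interior point of \<open>F\<close> lay in \<Omega>, then near it only
  \<open>K\<close> would cover the open set \<Omega>, which would thus lie in a half-space having
  that point on its boundary. The rest of \<open>F\<close> follows because the frontier is
  closed.\<close>

lemma one_sided_facet_frontier:
  assumes K: "K \<in> T" and F: "F facet_of K" and one: "\<And>K'. K' \<in> T \<Longrightarrow> F facet_of K' \<Longrightarrow> K' = K"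
    and \<Omega>: "open \<Omega>" "\<Union>T = closure \<Omega>"
  shows "F \<subseteq> frontier \<Omega>"
proof -
  obtain c where c: "norm (outward_normal K F) = 1" "\<And>x. x \<in> K \<Longrightarrow> outward_normal K F \<bullet> x \<le> c"
    "F = K \<inter> {x. outward_normal K F \<bullet> x = c}"
    by (rule facet_hyperplane[OF K F]) blast
  have "x \<in> frontier \<Omega>" if x: "x \<in> rel_interior F" for x
  proof -
    have xF: "x \<in> F" using x rel_interior_subset by blast
    then have "x \<in> closure \<Omega>" using facet_of_imp_subset[OF F] K \<Omega> by blast
    moreover have "x \<notin> \<Omega>"
    proof
      assume "x \<in> \<Omega>"
      let ?O = "\<Omega> \<inter> - \<Union>(T - {K})"
      have "closed (\<Union>(T - {K}))"
        by (rule closed_Union) (use finite_T compact_T compact_imp_closed in auto)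
      then have "open ?O" using \<Omega> by (simp add: open_Int open_Compl)
      moreover have "x \<notin> K'" if "K' \<in> T - {K}" for K'
        using facet_shared[OF K _ F x] one that by blast
      then have "x \<in> ?O" using \<open>x \<in> \<Omega>\<close> by auto
      moreover have "?O \<subseteq> {y. outward_normal K F \<bullet> y \<le> c}"
        using c(2) \<Omega>(2) closure_subset[of \<Omega>] by blast
      ultimately have "x \<in> interior {y. outward_normal K F \<bullet> y \<le> c}"
        using interior_maximal by blast
      moreover have "outward_normal K F \<noteq> 0" using c(1) by auto
      moreover have "outward_normal K F \<bullet> x = c" using c(3) xF by blast
      ultimately show False by simp
    qed
    ultimately show ?thesis using \<Omega>(1) by (simp add: frontier_def interior_open)
  qed
  then have "closure (rel_interior F) \<subseteq> frontier \<Omega>"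
    by (intro closure_minimal) auto
  moreover have "closed F" "convex F"
    using F K convex_T compact_T compact_imp_closed
    by (meson face_of_imp_closed facet_of_imp_face_of, meson F face_of_imp_convex
        facet_of_imp_face_of)
  ultimately show ?thesis by (simp add: convex_closure_rel_interior)
qed

lemma facet_neighbour:
  assumes K: "K \<in> T" and F: "F facet_of K" "\<not> F \<subseteq> frontier \<Omega>" and \<Omega>: "open \<Omega>" "\<Union>T = closure \<Omega>"
  obtains K' where "K' \<in> T" "K' \<noteq> K" "F facet_of K'"
  using one_sided_facet_frontier[OF K F(1) _ \<Omega>] F(2) by blast

text \<open>A segment from an interior point to a generic outer point leaves the union of the family
  through the relative interior of a facet.\<close>
lemma facet_closed_subfamily_empty:
  assumes S: "S \<subseteq> T" and nb: "\<And>K F. K \<in> S \<Longrightarrow> F facet_of K \<Longrightarrow> \<exists>K'\<in>S. K' \<noteq> K \<and> F facet_of K'"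
  shows "S = {}"
proof (rule ccontr)
  assume "S \<noteq> {}"
  then obtain K0 where K0: "K0 \<in> S" by blast
  obtain p where p: "p \<in> interior K0" using interior_T K0 S by blast
  have finS: "finite S" using S finite_T finite_subset by blast
  define U where "U = \<Union>S"
  have cU: "compact U" unfolding U_def using finS S compact_T by (intro compact_Union) auto
  \<comment> \<open>Faces of codimension two. The affine hull of \<open>p\<close> and such a face is
    a null set, so an end point \<open>q\<close> outside \<open>U\<close> can avoid all of them at
    once; this is the genericity of the segment.\<close>
  define \<G> where "\<G> = (\<Union>K\<in>S. \<Union>F\<in>{F. F facet_of K}. {G. G facet_of F})"
  have polyF: "polyhedron F" if "K \<in> S" "F facet_of K" for K F
    using that S polyhedron_T face_of_polyhedron_polyhedron facet_of_imp_face_of by blast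
  have finG: "finite \<G>" unfolding \<G>_def
    using finS S polyhedron_T polyF by (intro finite_UN_I) (auto intro: finite_polyhedron_facets)
  have "negligible (affine hull (insert p G))" if G: "G \<in> \<G>" for G
  proof -
    obtain K F where KF: "K \<in> S" "F facet_of K" "G facet_of F" using G unfolding \<G>_def by blast
    have "aff_dim G = int DIM('a) - 2"
      using aff_dim_facet[of K F] interior_T KF S by (auto simp: facet_of_def)
    then have "aff_dim (affine hull (insert p G)) < int DIM('a)"
      by (simp add: aff_dim_insert)
    then have "interior (affine hull (insert p G)) = {}"
      using aff_dim_nonempty_interior by force
    then show ?thesis by (simp add: negligible_convex_interior affine_imp_convex)
  qed
  then have "negligible (\<Union>G\<in>\<G>. affine hull (insert p G))"
    using finG by (intro negligible_Union) auto
  moreover have "open (- U)" using cU compact_imp_closed by blast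
  moreover have "- U \<noteq> {}"
    using cU compact_imp_bounded not_bounded_UNIV by (metis Compl_empty_eq double_compl)
  ultimately obtain q where q: "q \<notin> U" "q \<notin> (\<Union>G\<in>\<G>. affine hull (insert p G))"
    using open_not_negligible negligible_subset by (metis (no_types, lifting) Compl_iff subsetI)
  define f where "f s = p + s *\<^sub>R (q - p)" for s :: real
  have cf: "continuous_on UNIV f" unfolding f_def by (intro continuous_intros)
  \<comment> \<open>Parameters at which the segment is in \<open>U\<close>; the largest marks the
    last covered point, which cannot be interior to \<open>U\<close>.\<close>
  define I where "I = {0..1} \<inter> f -` U"
  have "compact I" unfolding I_def
    using continuous_closed_vimage[of U f] cU compact_imp_closed cf
    by (intro compact_Int_closed) (auto simp: continuous_on_eq_continuous_at)
  have p0: "p \<in> K0" using p interior_subset by blast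
  have "0 \<in> I" using K0 p0 by (auto simp: I_def f_def U_def)
  then obtain s where s: "s \<in> I" "\<And>t. t \<in> I \<Longrightarrow> t \<le> s"
    using compact_attains_sup[OF \<open>compact I\<close>] by blast
  have s01: "0 \<le> s" "s \<le> 1" "f s \<in> U" using s by (auto simp: I_def)
  have "s \<noteq> 1" using s01 q by (auto simp: f_def)
  have leave: "f s \<notin> interior U"
  proof
    assume "f s \<in> interior U"
    then have "s \<in> f -` interior U" by simp
    moreover have "open (f -` interior U)"
      using cf by (intro open_vimage) auto
    ultimately obtain e where e: "e > 0" "ball s e \<subseteq> f -` interior U"
      by (meson openE)
    define t where "t = s + min (e/2) (1 - s)"
    have "s < t" "t \<le> 1" "t \<in> ball s e" using e(1) \<open>s \<noteq> 1\<close> s01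
        by (auto simp: t_def dist_real_def min_def)
    then have "t \<in> I" using e(2) interior_subset s01 by (fastforce simp: I_def)
    then show False using s(2) \<open>s < t\<close> by fastforce
  qed
  have sub_int: "interior X \<subseteq> interior U" if "X \<subseteq> U" for X using that by (rule interior_mono)
  have sub_U: "interior X \<subseteq> interior U" if "X \<in> S" for X
    using that by (intro sub_int) (auto simp: U_def)
  have "s \<noteq> 0"
    using leave p sub_U[OF K0] by (auto simp: f_def)
  obtain K where K: "K \<in> S" "f s \<in> K" using s01 U_def by blast
  have KT: "K \<in> T" using K S by blast
  have "rel_interior K = interior K"
    using aff_dim_T[OF KT] by (metis aff_dim_eq_full rel_interior_interior)
  then have "f s \<in> K - rel_interior K"
    using leave K(2) sub_U[OF K(1)] by auto
  then obtain F where F: "F facet_of K" "f s \<in> F"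
    using rel_boundary_of_polyhedron[OF polyhedron_T[OF KT]] by blast
  have "f s \<in> rel_interior F"
  proof (rule ccontr)
    assume "f s \<notin> rel_interior F"
    then obtain G where G: "G facet_of F" "f s \<in> G"
      using rel_boundary_of_polyhedron[OF polyF[OF K(1) F(1)]] F by blast
    let ?H = "affine hull (insert p G)"
    have "p \<in> ?H" "f s \<in> ?H" using G by (auto simp: hull_inc)
    then have "(1 - 1/s) *\<^sub>R p + (1/s) *\<^sub>R f s \<in> ?H"
      by (intro mem_affine) (auto simp: affine_affine_hull)
    moreover have "(1 - 1/s) *\<^sub>R p + (1/s) *\<^sub>R f s = q"
      using \<open>s \<noteq> 0\<close> by (simp add: f_def algebra_simps)
    ultimately have "q \<in> ?H" by simp
    moreover have "G \<in> \<G>" using K F G by (auto simp: \<G>_def)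
    ultimately show False using q by blast
  qed
  moreover obtain K' where K': "K' \<in> S" "K' \<noteq> K" "F facet_of K'" using nb[OF K(1) F(1)] by blast
  ultimately have "f s \<in> interior (K \<union> K')"
    using rel_interior_facet_interior_Un[OF KT _ _ F(1)] S by blast
  moreover have "K \<union> K' \<subseteq> U" using K K' by (auto simp: U_def)
  ultimately show False using leave sub_int by blast
qed

end

subsection \<open>Weak gradients\<close>

lemma integrable_on_compact:
  fixes f :: "'a::euclidean_space \<Rightarrow> real"
  assumes "compact S" "continuous_on S f"
  shows "f integrable_on S"
proof -
  have "set_integrable lborel S f"
    unfolding set_integrable_def by (rule borel_integrable_compact[OF assms])
  then show ?thesis by (rule set_borel_integral_eq_integral(1))
qed

text \<open>A convex body is the closure of its interior and differs from it by a null set, which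
  lets the conclusion reach the points of the frontier.\<close>

lemma integral_continuous_nonneg_0:
  fixes f :: "'a::euclidean_space \<Rightarrow> real"
  assumes K: "compact K" "convex K" "interior K \<noteq> {}" and f: "continuous_on K f"
    and nonneg: "\<And>x. x \<in> K \<Longrightarrow> 0 \<le> f x" and 0: "integral K f = 0" and x: "x \<in> K"
  shows "f x = 0"
proof -
  have cl: "closure (interior K) = K"
    using convex_closure_interior[OF K(2,3)] closure_closed[OF compact_imp_closed[OF K(1)]] by simp
  have int: "(f has_integral 0) K"
    using integrable_integral[OF integrable_on_compact[OF K(1) f]] 0 by simp
  have fin: "emeasure lborel K < \<infinity>"
    using K(1) by (rule emeasure_compact_finite)
  have "frontier K = K - interior K"
    using K(1) by (simp add: frontier_def closure_closed compact_imp_closed)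
  moreover have "negligible (frontier K)" using K(2) by (rule negligible_convex_frontier)
  ultimately have "emeasure lebesgue (K - interior K) = 0"
    using negligible_iff_emeasure0 negligible_imp_sets by metis
  moreover have "K - interior K \<in> sets lborel"
    using compact_imp_closed[OF K(1)] by auto
  ultimately have "emeasure lborel (K - interior K) = 0" by simp
  then have eq: "emeasure lborel K = emeasure lborel (interior K)"
    using plus_emeasure[of "interior K" lborel "K - interior K"] interior_subset[of K]
      compact_imp_closed[OF K(1)] by (auto simp: Un_absorb1 sup.absorb2)
  have pos: "0 < emeasure lborel (interior K)"
  proof -
    have "\<not> negligible (interior K)" using open_not_negligible[OF open_interior K(3)] .
    then have "emeasure lebesgue (interior K) \<noteq> 0" by (simp add: negligible_iff_emeasure0)
    then show ?thesis by (simp add: zero_less_iff_neq_zero)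
  qed
  show ?thesis
    by (rule has_integral_0_closure_imp_0[of "interior K" f x, unfolded cl])
      (use f nonneg interior_subset pos fin eq int x in \<open>auto\<close>)
qed

lemma linear_functional_inner:
  fixes f :: "'a::euclidean_space \<Rightarrow> real"
  assumes "linear f"
  shows "f x = (\<Sum>b\<in>Basis. f b *\<^sub>R b) \<bullet> x"
proof -
  have "f x = f (\<Sum>b\<in>Basis. (x \<bullet> b) *\<^sub>R b)" by (simp add: euclidean_representation)
  also have "\<dots> = (\<Sum>b\<in>Basis. (x \<bullet> b) * f b)"
    using assms by (simp add: linear_sum linear_scale)
  also have "\<dots> = (\<Sum>b\<in>Basis. f b *\<^sub>R b) \<bullet> x"
    by (simp add: inner_sum_left inner_commute[of x] mult.commute)
  finally show ?thesis .
qed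

text \<open>Coordinates \<open>(a, c)\<close> of the field \<open>a + c x\<close>. They replace a
  space of functions by a Euclidean space, on which injective linear endomorphisms are
  surjective.\<close>

definition rt :: "'a::euclidean_space \<times> real \<Rightarrow> 'a \<Rightarrow> 'a" where
  "rt p x = fst p + snd p *\<^sub>R x"

lemma RT0_eq_range: "RT0 = range rt"
  by (auto simp: RT0_def rt_def[abs_def] image_iff) metis

lemma rt_add: "rt (p + q) x = rt p x + rt q x"
  and rt_scaleR: "rt (r *\<^sub>R p) x = r *\<^sub>R rt p x"
  by (auto simp: rt_def algebra_simps)

lemma continuous_on_rt [continuous_intros]: "continuous_on S (rt p)"
  unfolding rt_def[abs_def] by (intro continuous_intros)

lemma rt_0_interior:
  fixes K :: "'a::euclidean_space set"
  assumes "interior K \<noteq> {}" "\<And>x. x \<in> K \<Longrightarrow> rt p x = 0"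
  shows "p = 0"
proof -
  obtain x0 e where e: "e > 0" "ball x0 e \<subseteq> K"
    using assms(1) by (auto simp: mem_interior)
  obtain b :: 'a where b: "b \<in> Basis" using nonempty_Basis by blast
  have "x0 + (e/2) *\<^sub>R b \<in> ball x0 e" using e b by (simp add: dist_norm)
  then have "rt p (x0 + (e/2) *\<^sub>R b) = 0" "rt p x0 = 0" using assms(2) e by (auto simp: subset_iff)
  moreover have "rt p (x0 + (e/2) *\<^sub>R b) = rt p x0 + snd p *\<^sub>R ((e/2) *\<^sub>R b)"
    by (simp add: rt_def algebra_simps)
  ultimately have "snd p *\<^sub>R ((e/2) *\<^sub>R b) = 0" "fst p + snd p *\<^sub>R x0 = 0"
    by (simp_all add: rt_def)
  then show ?thesis using e b by (auto simp: prod_eq_iff)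
qed

text \<open>The Gram operator \<open>R\<close> of the integral product in these coordinates is
  injective, because a field vanishing on \<open>K\<close> is zero; by dimension it is bijective and
  represents every functional exactly once.\<close>

lemma RT0_riesz:
  fixes K :: "'a::euclidean_space set" and \<phi> :: "'a \<times> real \<Rightarrow> real"
  assumes K: "compact K" "convex K" "interior K \<noteq> {}" and \<phi>: "linear \<phi>"
  shows "\<exists>!p. \<forall>q. integral K (\<lambda>x. rt p x \<bullet> rt q x) = \<phi> q"
proof -
  define I where "I p q = integral K (\<lambda>x. rt p x \<bullet> rt q x)" for p q
  have int: "(\<lambda>x. rt p x \<bullet> rt q x) integrable_on K" for p q
    by (intro integrable_on_compact K continuous_intros)
  have add1: "I (p + p') q = I p q + I p' q" for p p' q
    by (simp add: I_def rt_add inner_add_left integral_add int)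
  have scale1: "I (r *\<^sub>R p) q = r * I p q" for r p q
    by (simp add: I_def rt_scaleR)
  have sym: "I p q = I q p" for p q by (simp add: I_def inner_commute)
  have lin: "linear (I p)" for p
    by (rule linearI) (simp_all add: sym[of p] add1 scale1)
  have pd: "p = 0" if "I p p = 0" for p
  proof (rule rt_0_interior[OF K(3)])
    fix x assume "x \<in> K"
    then have "rt p x \<bullet> rt p x = 0"
      using that unfolding I_def
      by (intro integral_continuous_nonneg_0[OF K, of "\<lambda>x. rt p x \<bullet> rt p x"] continuous_intros) auto
    then show "rt p x = 0" by simp
  qed
  define R where "R p = (\<Sum>b\<in>Basis. I p b *\<^sub>R b)" for p
  have R: "I p q = R p \<bullet> q" for p q
    unfolding R_def by (rule linear_functional_inner[OF lin])
  have "linear R"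
    by (rule linearI) (simp_all add: R_def add1 scale1 scaleR_add_left sum.distrib scaleR_sum_right)
  moreover have "inj R"
  proof -
    have "p = 0" if "R p = 0" for p using that R[of p p] pd by simp
    then show ?thesis using \<open>linear R\<close> linear_injective_0 by blast
  qed
  ultimately have "surj R" by (simp add: linear_injective_imp_surjective)
  define w where "w = (\<Sum>b\<in>Basis. \<phi> b *\<^sub>R b)"
  have \<phi>w: "\<phi> q = w \<bullet> q" for q unfolding w_def by (rule linear_functional_inner[OF \<phi>])
  have iff: "(\<forall>q. I p q = \<phi> q) \<longleftrightarrow> R p = w" for p
    unfolding R \<phi>w by (rule vector_eq_rdot)
  have "\<exists>!p. R p = w" using \<open>surj R\<close> \<open>inj R\<close> by (metis surjD injD)
  then show ?thesis unfolding iff[symmetric] I_def .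
qed

section \<open>Facet areas\<close>

definition facet_cylinder :: "'a::euclidean_space set \<Rightarrow> 'a \<Rightarrow> 'a set" where
  "facet_cylinder F n = {x + t *\<^sub>R n |x t. x \<in> F \<and> t \<in> {0..1}}"

lemma compact_facet_cylinder: assumes "compact F" shows "compact (facet_cylinder F n)"
proof -
  have "facet_cylinder F n = (\<lambda>(x, t). x + t *\<^sub>R n) ` (F \<times> {0..1})"
    by (fastforce simp: facet_cylinder_def image_iff)
  moreover have "compact \<dots>"
    unfolding case_prod_unfold
    by (intro compact_continuous_image compact_Times assms compact_Icc continuous_intros)
  ultimately show ?thesis by simp
qed

text \<open>The fluxes of \<open>RT0\<close> fields and of facet values through a flat facet have
  constant density, so of each facet integral only the volume of the cylinder of height one, that is
  the facet area, survives.\<close>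

lemma facet_integral_const:
  assumes F: "compact F" "F \<noteq> {}" and g: "\<And>x. x \<in> F \<Longrightarrow> g x = k"
  shows "facet_integral F n g = k * lvol (facet_cylinder F n)"
proof -
  have "g (closest_point F y) = k" for y
    using g closest_point_in_set[OF compact_imp_closed[OF F(1)] F(2)] by blast
  then have "facet_integral F n g = integral (facet_cylinder F n) (\<lambda>y. k * 1)"
    by (simp add: facet_integral_def facet_cylinder_def)
  also have "\<dots> = k * integral (facet_cylinder F n) (\<lambda>y. 1)"
    by (simp only: integral_mult_right)
  also have "integral (facet_cylinder F n) (\<lambda>y. 1) = lvol (facet_cylinder F n)"
    using compact_facet_cylinder[OF F(1)] by (simp add: lmeasurable_compact lmeasure_integral)
  finally show ?thesis .
qed

text \<open>The cylinders are translates of each other. Neighbouring elements see opposite normals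
  on their common facet, and their fluxes cancel only if they agree on its area.\<close>

lemma lvol_facet_cylinder_minus: "lvol (facet_cylinder F (- n)) = lvol (facet_cylinder F n)"
proof -
  have "facet_cylinder F (- n) = (+) (- n) ` facet_cylinder F n"
  proof safe
    fix z assume "z \<in> facet_cylinder F (- n)"
    then obtain x t where xt: "z = x + t *\<^sub>R (- n)" "x \<in> F" "t \<in> {0..1}"
      by (auto simp: facet_cylinder_def)
    then have "z = - n + (x + (1 - t) *\<^sub>R n)" by (simp add: algebra_simps)
    then show "z \<in> (+) (- n) ` facet_cylinder F n"
      using xt by (auto simp: facet_cylinder_def intro!: imageI exI[of _ x] exI[of _ "1 - t"])
  next
    fix z assume "z \<in> facet_cylinder F n"
    then obtain x t where xt: "z = x + t *\<^sub>R n" "x \<in> F" "t \<in> {0..1}"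
      by (auto simp: facet_cylinder_def)
    then have "- n + z = x + (1 - t) *\<^sub>R (- n)" by (simp add: algebra_simps)
    then show "- n + z \<in> facet_cylinder F (- n)"
      using xt by (auto simp: facet_cylinder_def intro!: exI[of _ x] exI[of _ "1 - t"])
  qed
  then show ?thesis by (simp only: measure_translation)
qed

text \<open>A null cylinder would lie in a hyperplane. As it contains \<open>F\<close>, the normal
  would be parallel to \<open>n\<close>; as it contains \<open>F\<close> shifted by
  \<open>n\<close>, the normal would be orthogonal to \<open>n\<close>.\<close>

lemma lvol_facet_cylinder_pos:
  fixes F :: "'a::euclidean_space set"
  assumes F: "compact F" "convex F" "aff_dim F = int DIM('a) - 1" "F \<noteq> {}"
    and n: "norm n = 1" "\<And>x. x \<in> F \<Longrightarrow> n \<bullet> x = c"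
  shows "lvol (facet_cylinder F n) > 0"
proof -
  have conv: "convex (facet_cylinder F n)"
  proof -
    have "facet_cylinder F n = (\<Union>x\<in>F. \<Union>y\<in>(\<lambda>t. t *\<^sub>R n) ` {0..1}. {x + y})"
      by (fastforce simp: facet_cylinder_def)
    then show ?thesis
      using convex_sums[OF F(2) convex_linear_image[of "\<lambda>t::real. t *\<^sub>R n" "{0..1}"]]
      by (simp add: linear_scaleR_left)
  qed
  have "interior (facet_cylinder F n) \<noteq> {}"
  proof
    assume "interior (facet_cylinder F n) = {}"
    then obtain a b where a: "a \<noteq> 0" "facet_cylinder F n \<subseteq> {x. a \<bullet> x = b}"
      using empty_interior_subset_hyperplane[OF conv] by metis
    have onF: "a \<bullet> x = b" if "x \<in> F" for x
      using a(2) that by (force simp: facet_cylinder_def intro: exI[of _ x] exI[of _ 0])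
    have "a /\<^sub>R norm a = n \<or> a /\<^sub>R norm a = - n"
      by (rule unit_normal_unique[OF F(3) n(1), where c = c and c' = "b / norm a"])
        (use a n onF in \<open>auto simp: divide_simps\<close>)
    moreover obtain x where x: "x \<in> F" using F(4) by blast
    have "x + 1 *\<^sub>R n \<in> facet_cylinder F n"
      unfolding facet_cylinder_def using x by (intro CollectI exI[of _ x] exI[of _ 1]) auto
    then have "a \<bullet> (x + n) = b" using a(2) by auto
    then have "a \<bullet> n = 0" using onF[OF x] by (simp add: inner_add_right)
    ultimately have "a \<bullet> (a /\<^sub>R norm a) = 0" by (metis inner_minus_right neg_equal_0_iff_equal)
    then show False using a(1) by simp
  qed
  then have "\<not> negligible (facet_cylinder F n)"
    by (simp add: negligible_convex_interior[OF conv])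
  then show ?thesis
    using lmeasurable_compact[OF compact_facet_cylinder[OF F(1)]]
    by (simp add: negligible_iff_measure zero_less_measure_iff)
qed

definition facet_area :: "'a::euclidean_space set \<Rightarrow> 'a set \<Rightarrow> real" where
  "facet_area K F = lvol (facet_cylinder F (outward_normal K F))"

definition facet_offset :: "'a::euclidean_space set \<Rightarrow> 'a set \<Rightarrow> real" where
  "facet_offset K F = outward_normal K F \<bullet> (SOME x. x \<in> F)"

section \<open>Existence, uniqueness and linearity of the weak gradient\<close>

context simplicial_complex_full
begin

lemma finite_facets: "K \<in> T \<Longrightarrow> finite {F. F facet_of K}"
  using polyhedron_T finite_polyhedron_facets by blast

lemma facet_props:
  assumes "K \<in> T" "F facet_of K"
  shows "compact F" "convex F" "F \<noteq> {}" "F \<subseteq> K" "aff_dim F = int DIM('a) - 1"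
proof -
  show "compact F" using assms compact_T convex_T face_of_imp_compact facet_of_imp_face_of by blast
  show "convex F" using assms face_of_imp_convex facet_of_imp_face_of by blast
  show "F \<noteq> {}" "F \<subseteq> K" using assms facet_of_imp_subset by (auto simp: facet_of_def)
  show "aff_dim F = int DIM('a) - 1" using assms interior_T aff_dim_facet by blast
qed

lemma facet_offset:
  assumes K: "K \<in> T" "F facet_of K"
  shows "F = K \<inter> {x. outward_normal K F \<bullet> x = facet_offset K F}"
    "x \<in> K \<Longrightarrow> outward_normal K F \<bullet> x \<le> facet_offset K F"
proof -
  obtain c where c: "\<And>x. x \<in> K \<Longrightarrow> outward_normal K F \<bullet> x \<le> c"
    "F = K \<inter> {x. outward_normal K F \<bullet> x = c}"
    using facet_hyperplane[OF K] by metis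
  have "(SOME x. x \<in> F) \<in> F" using facet_props(3)[OF K] by (simp add: some_in_eq)
  then have "facet_offset K F = c" using c(2) by (auto simp: facet_offset_def)
  then show "F = K \<inter> {x. outward_normal K F \<bullet> x = facet_offset K F}"
    "x \<in> K \<Longrightarrow> outward_normal K F \<bullet> x \<le> facet_offset K F" using c by auto
qed

lemma facet_area_pos:
  assumes K: "K \<in> T" "F facet_of K"
  shows "facet_area K F > 0"
  unfolding facet_area_def
  by (rule lvol_facet_cylinder_pos[OF facet_props(1,2,5,3)[OF K] norm_outward_normal[OF K]])
    (use facet_offset(1)[OF K] in blast)

lemma boundary_integral_T:
  assumes K: "K \<in> T"
    and g: "\<And>F x. F facet_of K \<Longrightarrow> x \<in> F \<Longrightarrow> g F (outward_normal K F) x = k F"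
  shows "boundary_integral K g = (\<Sum>F | F facet_of K. k F * facet_area K F)"
  unfolding boundary_integral_def facet_area_def
  by (intro sum.cong refl facet_integral_const) (use g facet_props[OF K] in auto)

lemma boundary_integral_rt:
  assumes K: "K \<in> T"
  shows "boundary_integral K (\<lambda>F n x. ub F * (rt q x \<bullet> n)) =
    (\<Sum>F | F facet_of K. ub F * (fst q \<bullet> outward_normal K F + snd q * facet_offset K F) *
        facet_area K F)"
proof (rule boundary_integral_T[OF K])
  fix F x assume F: "F facet_of K" "x \<in> F"
  have "x \<bullet> outward_normal K F = facet_offset K F"
    using facet_offset(1)[OF K F(1)] F(2) by (auto simp: inner_commute)
  then show "ub F * (rt q x \<bullet> outward_normal K F) =
      ub F * (fst q \<bullet> outward_normal K F + snd q * facet_offset K F)"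
    by (simp add: rt_def inner_add_left)
qed

lemma boundary_integral_normal:
  assumes K: "K \<in> T"
  shows "boundary_integral K (\<lambda>F n x. u F \<bullet> n) =
    (\<Sum>F | F facet_of K. (u F \<bullet> outward_normal K F) * facet_area K F)"
  by (rule boundary_integral_T[OF K]) simp

lemma divergence_rt: "divergence (rt q) x = snd q * DIM('a)" for q :: "'a \<times> real"
proof -
  have "(rt q has_derivative (\<lambda>h. snd q *\<^sub>R h)) (at x)"
    unfolding rt_def[abs_def] by (auto intro!: derivative_eq_intros)
  then have "frechet_derivative (rt q) (at x) = (\<lambda>h. snd q *\<^sub>R h)"
    using frechet_derivative_at by metis
  then show ?thesis by (simp add: divergence_def inner_Basis)
qed

lemma lvol_T_pos: assumes "K \<in> T" shows "0 < lvol K"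
proof -
  have "\<not> negligible K"
    using interior_T[OF assms] by (simp add: negligible_convex_interior[OF convex_T[OF assms]])
  then show ?thesis
    using lmeasurable_compact[OF compact_T[OF assms]]
    by (simp add: negligible_iff_measure zero_less_measure_iff)
qed

lemma integral_const_T:
  assumes "K \<in> T" shows "integral K (\<lambda>x. k) = k * lvol K"
proof -
  have "integral K (\<lambda>x. k) = integral K (\<lambda>x. k * 1)" by simp
  also have "\<dots> = k * integral K (\<lambda>x. 1)" by (simp only: integral_mult_right)
  finally show ?thesis
    using lmeasurable_compact[OF compact_T[OF assms]] by (simp add: lmeasure_integral)
qed

text \<open>The right-hand side of the defining identity as a functional of the coordinates of the
  test field, in the form required by \<open>RT0_riesz\<close>.\<close>

definition weak_gradient_functional :: "'a set \<Rightarrow> real \<Rightarrow> ('a set \<Rightarrow> real) \<Rightarrow> 'a \<times> real \<Rightarrow> real" where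
  "weak_gradient_functional K u0 ub q =
    (\<Sum>F | F facet_of K. ub F * (fst q \<bullet> outward_normal K F + snd q * facet_offset K F) *
        facet_area K F)
      - u0 * (snd q * DIM('a)) * lvol K"

lemma linear_weak_gradient_functional: "linear (weak_gradient_functional K u0 ub)"
proof (rule linearI)
  fix p q :: "'a \<times> real" and r :: real
  show "weak_gradient_functional K u0 ub (p + q) =
      weak_gradient_functional K u0 ub p + weak_gradient_functional K u0 ub q"
    by (simp add: weak_gradient_functional_def inner_add_left algebra_simps sum.distrib)
  show "weak_gradient_functional K u0 ub (r *\<^sub>R p) = r *\<^sub>R weak_gradient_functional K u0 ub p"
    by (simp add: weak_gradient_functional_def algebra_simps sum_distrib_left)
qed

lemma weak_gradient_ex1:
  assumes K: "K \<in> T"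
  shows "\<exists>!p. \<forall>q. integral K (\<lambda>x. rt p x \<bullet> rt q x) = weak_gradient_functional K u0 ub q"
  by (rule RT0_riesz[OF compact_T convex_T interior_T linear_weak_gradient_functional])
      (use K in auto)

lemma weak_gradient_eqI:
  assumes K: "K \<in> T"
    and p: "\<And>q. integral K (\<lambda>x. rt p x \<bullet> rt q x) = weak_gradient_functional K u0 ub q"
  shows "weak_gradient K u0 ub = rt p"
proof -
  have eq: "boundary_integral K (\<lambda>F n x. ub F * (rt q x \<bullet> n)) - integral K (\<lambda>x. u0 * divergence
      (rt q) x)
      = weak_gradient_functional K u0 ub q" for q
    using integral_const_T[OF K, of "u0 * (snd q * DIM('a))"]
    by (simp add: boundary_integral_rt[OF K] divergence_rt weak_gradient_functional_def)
  show ?thesis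
    unfolding weak_gradient_def
  proof (rule the_equality)
    show "rt p \<in> RT0 \<and> (\<forall>v\<in>RT0. integral K (\<lambda>x. rt p x \<bullet> v x) =
        boundary_integral K (\<lambda>F n x. ub F * (v x \<bullet> n)) - integral K (\<lambda>x. u0 * divergence v x))"
      using p eq by (auto simp: RT0_eq_range)
  next
    fix g assume g: "g \<in> RT0 \<and> (\<forall>v\<in>RT0. integral K (\<lambda>x. g x \<bullet> v x) =
        boundary_integral K (\<lambda>F n x. ub F * (v x \<bullet> n)) - integral K (\<lambda>x. u0 * divergence v x))"
    then obtain p' where p': "g = rt p'" by (auto simp: RT0_eq_range)
    have "integral K (\<lambda>x. rt p' x \<bullet> rt q x) = weak_gradient_functional K u0 ub q" for q
    proof -
      have "rt q \<in> RT0" by (simp add: RT0_eq_range)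
      then show ?thesis using g unfolding p' eq[symmetric] by blast
    qed
    then show "g = rt p" using weak_gradient_ex1[OF K, of u0 ub] p p' by blast
  qed
qed

lemma weak_gradient_rt:
  assumes K: "K \<in> T"
  obtains p where "weak_gradient K u0 ub = rt p"
    "\<And>q. integral K (\<lambda>x. rt p x \<bullet> rt q x) = weak_gradient_functional K u0 ub q"
  using weak_gradient_ex1[OF K, of u0 ub] weak_gradient_eqI[OF K] by metis

lemma continuous_on_weak_gradient [continuous_intros]:
  "K \<in> T \<Longrightarrow> continuous_on S (weak_gradient K u0 ub)"
  by (metis weak_gradient_rt continuous_on_rt)

lemma integral_weak_gradient_rt:
  assumes K: "K \<in> T"
  shows "integral K (\<lambda>x. weak_gradient K u0 ub x \<bullet> rt q x) = weak_gradient_functional K u0 ub q"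
  by (metis weak_gradient_rt[OF K])

lemma weak_gradient_sum:
  assumes K: "K \<in> T" and J: "finite J"
  shows "weak_gradient K (\<Sum>j\<in>J. r j * u0 j) (\<lambda>F. \<Sum>j\<in>J. r j * ub j F) x =
    (\<Sum>j\<in>J. r j *\<^sub>R weak_gradient K (u0 j) (ub j) x)"
proof -
  have "\<exists>p. weak_gradient K (u0 j) (ub j) = rt p \<and>
    (\<forall>q. integral K (\<lambda>x. rt p x \<bullet> rt q x) = weak_gradient_functional K (u0 j) (ub j) q)" for j
    using weak_gradient_rt[OF K, of "u0 j" "ub j"] by metis
  then obtain p where p: "\<And>j. weak_gradient K (u0 j) (ub j) = rt (p j)"
    "\<And>j q. integral K (\<lambda>x. rt (p j) x \<bullet> rt q x) = weak_gradient_functional K (u0 j) (ub j) q"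
    by metis
  have rt_sum: "rt (\<Sum>j\<in>J. r j *\<^sub>R p j) x = (\<Sum>j\<in>J. r j *\<^sub>R rt (p j) x)" for x
    using J by induction (auto simp: rt_add rt_scaleR, simp add: rt_def)
  have int: "(\<lambda>x. rt p x \<bullet> rt q x) integrable_on K" for p q
    by (intro integrable_on_compact compact_T K continuous_intros)
  have "weak_gradient K (\<Sum>j\<in>J. r j * u0 j) (\<lambda>F. \<Sum>j\<in>J. r j * ub j F) = rt (\<Sum>j\<in>J. r j *\<^sub>R p j)"
  proof (rule weak_gradient_eqI[OF K])
    fix q
    have "integral K (\<lambda>x. rt (\<Sum>j\<in>J. r j *\<^sub>R p j) x \<bullet> rt q x) =
        (\<Sum>j\<in>J. r j * integral K (\<lambda>x. rt (p j) x \<bullet> rt q x))"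
      unfolding rt_sum inner_sum_left inner_scaleR_left
      by (subst integral_sum[OF J]) (use integrable_cmul[OF int] in auto)
    also have "\<dots> = (\<Sum>j\<in>J. r j * weak_gradient_functional K (u0 j) (ub j) q)"
      by (simp add: p)
    also have "\<dots> = weak_gradient_functional K (\<Sum>j\<in>J. r j * u0 j) (\<lambda>F. \<Sum>j\<in>J. r j * ub j F) q"
      unfolding weak_gradient_functional_def right_diff_distrib sum_subtractf
      by (subst sum_distrib_left, subst sum.swap)
        (simp add: sum_distrib_left sum_distrib_right mult.assoc)
    finally show "integral K (\<lambda>x. rt (\<Sum>j\<in>J. r j *\<^sub>R p j) x \<bullet> rt q x) =
        weak_gradient_functional K (\<Sum>j\<in>J. r j * u0 j) (\<lambda>F. \<Sum>j\<in>J. r j * ub j F) q" .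
  qed
  then show ?thesis by (simp add: rt_sum p)
qed

text \<open>Testing with the field centred at the vertex opposite to \<open>F\<close>, whose flux through the other
  facets vanishes.\<close>
lemma weak_gradient_0_facet:
  assumes K: "K \<in> T" and F: "F facet_of K" and 0: "\<And>x. x \<in> K \<Longrightarrow> weak_gradient K u0 ub x = 0"
  shows "ub F = 0 \<longleftrightarrow> u0 = 0"
proof -
  obtain C where C: "\<not> affine_dependent C" "K = convex hull C"
    using simplex[OF K] by (auto simp: simplex_def)
  obtain u where u: "u \<in> C" "F = convex hull (C - {u})"
    using F facet_of_convex_hull_affine_independent_alt[OF C(1)] C(2) by auto
  have uK: "u \<in> K" using u C by (simp add: hull_inc)
  have other: "u \<in> F'" if F': "F' facet_of K" "F' \<noteq> F" for F'
  proof -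
    obtain u' where u': "u' \<in> C" "F' = convex hull (C - {u'})"
      using F' facet_of_convex_hull_affine_independent_alt[OF C(1)] C(2) by auto
    then have "u \<in> C - {u'}" using u F'(2) by auto
    then show ?thesis using u' hull_inc by metis
  qed
  have uF: "u \<notin> F"
    using C(1) u convex_hull_subset_affine_hull[of "C - {u}"] by (auto simp: affine_dependent_def)
  define h where "h = facet_offset K F - outward_normal K F \<bullet> u"
  have h: "h > 0"
    using facet_offset[OF K F] uF uK by (force simp: h_def)
  \<comment> \<open>The coordinates \<open>(- u, 1)\<close> are those of the test field
    \<open>x - u\<close>. Its normal flux is 0 on the facets through \<open>u\<close> and equals the
    height \<open>h\<close> on \<open>F\<close>.\<close>
  have "(\<Sum>F' | F' facet_of K. ub F' * ((- u) \<bullet> outward_normal K F' + 1 * facet_offset K F') *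
      facet_area K F')
      = (\<Sum>F' | F' facet_of K. if F' = F then ub F * h * facet_area K F else 0)"
  proof (rule sum.cong)
    fix F' assume F': "F' \<in> {F'. F' facet_of K}"
    have "outward_normal K F' \<bullet> u = facet_offset K F'" if "F' \<noteq> F"
      using facet_offset(1)[of K F'] other[of F'] F' that K by auto
    then show "ub F' * ((- u) \<bullet> outward_normal K F' + 1 * facet_offset K F') * facet_area K F' =
        (if F' = F then ub F * h * facet_area K F else 0)"
      by (auto simp: h_def inner_commute)
  qed simp
  also have "\<dots> = ub F * h * facet_area K F"
    using F finite_facets[OF K] by simp
  finally have "weak_gradient_functional K u0 ub (- u, 1) = ub F * h * facet_area K F - u0 *
      DIM('a) * lvol K"
    by (simp add: weak_gradient_functional_def)
  moreover have "weak_gradient_functional K u0 ub (- u, 1) = integral K (\<lambda>x. 0)"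
    unfolding integral_weak_gradient_rt[OF K, symmetric] by (rule integral_cong) (simp add: 0)
  ultimately have "ub F * (h * facet_area K F) = u0 * (DIM('a) * lvol K)"
    by simp
  moreover have "h * facet_area K F \<noteq> 0" "DIM('a) * lvol K \<noteq> 0"
    using h facet_area_pos[OF K F] lvol_T_pos[OF K] by auto
  ultimately show ?thesis by auto
qed

end

subsection \<open>The stiffness and divergence matrices\<close>

locale mesh_numbering = simplicial_complex_full T for T :: "'a::euclidean_space set set" +
  fixes \<Omega> :: "'a set" and Ks :: "'a set list" and ds :: "'a dof list"
  assumes open_\<Omega>: "open \<Omega>" and Union_T: "\<Union>T = closure \<Omega>" and numbering: "numbering \<Omega> T Ks ds"
begin

lemma Ks: "distinct Ks" "set Ks = T" and ds: "distinct ds" "set ds = dofs \<Omega> T"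
  using numbering by (auto simp: numbering_def)

lemma Ks_nth: "i < length Ks \<Longrightarrow> Ks ! i \<in> T"
  using Ks by auto

lemma sum_Ks: "(\<Sum>i<length Ks. f (Ks ! i)) = (\<Sum>K\<in>T. f K)"
  using sum.reindex_bij_betw[OF bij_betw_nth[OF Ks(1) refl refl], of f] Ks
      by (simp add: lessThan_atLeast0)

lemma dof_value_unit:
  assumes "j < length ds"
  shows "dof_value ds (unit_vec (length ds) j) p = (if ds ! j = p then 1 else 0)"
proof -
  have "dof_value ds (unit_vec (length ds) j) p =
      (\<Sum>l<length ds. if l = j then (if ds ! j = p then 1 else 0) else 0)"
    unfolding dof_value_def by (rule sum.cong) (use assms in \<open>auto simp: unit_vec_def\<close>)
  then show ?thesis using assms by simp
qed

lemma dof_value_sum: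
  "dof_value ds x p = (\<Sum>j<length ds. x $ j * dof_value ds (unit_vec (length ds) j) p)"
  unfolding dof_value_def[of ds x] by (rule sum.cong) (auto simp: dof_value_unit)

lemma dof_value_nth: "j < length ds \<Longrightarrow> dof_value ds x (ds ! j) = x $ j"
proof -
  assume j: "j < length ds"
  have "dof_value ds x (ds ! j) = (\<Sum>l<length ds. if l = j then x $ j else 0)"
    unfolding dof_value_def by (rule sum.cong) (use j ds(1) nth_eq_iff_index_eq in \<open>auto\<close>)
  then show ?thesis using j by simp
qed

lemma dof_value_notin: "p \<notin> dofs \<Omega> T \<Longrightarrow> dof_value ds x p = 0"
  unfolding dof_value_def by (rule sum.neutral) (use ds nth_mem in \<open>fastforce\<close>)

lemma weak_fun_of_inner:
  assumes "i \<in> Basis"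
  shows "fst (weak_fun_of ds x) K \<bullet> i = dof_value ds x (Elem_Dof K i)"
    "snd (weak_fun_of ds x) F \<bullet> i = dof_value ds x (Facet_Dof F i)"
  using assms by (simp_all add: weak_fun_of_def inner_sum_left_Basis)

lemma weak_fun_of_frontier:
  assumes "F \<subseteq> frontier \<Omega>"
  shows "snd (weak_fun_of ds x) F = 0"
  using assms by (auto simp: weak_fun_of_def dofs_def intro!: sum.neutral dof_value_notin)

lemma weak_gradient_row_sum:
  assumes K: "K \<in> T" and i: "i \<in> Basis"
  shows "weak_gradient_row K (weak_fun_of ds x) i z =
    (\<Sum>j<length ds. x $ j *\<^sub>R weak_gradient_row K (basis_fun ds j) i z)"
  unfolding weak_gradient_row_def basis_fun_def weak_fun_of_inner[OF i]
  by (subst (1 2) dof_value_sum) (rule weak_gradient_sum[OF K finite_lessThan])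

lemma integrable_gradient_rows:
  assumes "K \<in> T"
  shows "(\<lambda>z. weak_gradient_row K u i z \<bullet> weak_gradient_row K v l z) integrable_on K"
  unfolding weak_gradient_row_def
  by (intro integrable_on_compact compact_T continuous_intros assms)

lemma gradient_form_rows:
  "gradient_form T u v = (\<Sum>K\<in>T. \<Sum>i\<in>Basis. integral K (\<lambda>z. weak_gradient_row K u i z \<bullet>
      weak_gradient_row K v i z))"
  unfolding gradient_form_def
  by (intro sum.cong refl integral_sum integrable_gradient_rows) auto

lemma gradient_form_sym: "gradient_form T u v = gradient_form T v u"
  by (simp add: gradient_form_def inner_commute)

lemma gradient_form_sum_left:
  "gradient_form T (weak_fun_of ds x) v = (\<Sum>j<length ds. x $ j * gradient_form T (basis_fun ds j)
      v)"
proof -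
  have "integral K (\<lambda>z. weak_gradient_row K (weak_fun_of ds x) i z \<bullet> weak_gradient_row K v i z) =
     (\<Sum>j<length ds. x $ j * integral K (\<lambda>z. weak_gradient_row K (basis_fun ds j) i z \<bullet>
         weak_gradient_row K v i z))"
    if "K \<in> T" "i \<in> Basis" for K i
    unfolding weak_gradient_row_sum[OF that] inner_sum_left inner_scaleR_left
    by (subst integral_sum) (use integrable_cmul[OF integrable_gradient_rows[OF that(1)]] in auto)
  then have "gradient_form T (weak_fun_of ds x) v =
     (\<Sum>K\<in>T. \<Sum>i\<in>Basis. \<Sum>j<length ds. x $ j * integral K (\<lambda>z. weak_gradient_row K (basis_fun ds j) i
         z \<bullet> weak_gradient_row K v i z))"
    by (simp add: gradient_form_rows)
  also have "\<dots> = (\<Sum>K\<in>T. \<Sum>j<length ds. \<Sum>i\<in>Basis. x $ j * integral K (\<lambda>z. weak_gradient_row K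
      (basis_fun ds j) i z \<bullet> weak_gradient_row K v i z))"
    by (intro sum.cong refl sum.swap)
  also have "\<dots> = (\<Sum>j<length ds. \<Sum>K\<in>T. \<Sum>i\<in>Basis. x $ j * integral K (\<lambda>z. weak_gradient_row K
      (basis_fun ds j) i z \<bullet> weak_gradient_row K v i z))"
    by (rule sum.swap)
  finally show ?thesis by (simp add: gradient_form_rows sum_distrib_left)
qed

lemma A1_dim: "A1_mat Ks ds \<in> carrier_mat (length ds) (length ds)"
  and B_dim: "B_mat Ks ds \<in> carrier_mat (length Ks) (length ds)"
  by (simp_all add: A1_mat_def B_mat_def)

lemma A1_sym: "transpose_mat (A1_mat Ks ds) = A1_mat Ks ds"
  by (rule eq_matI) (auto simp: A1_mat_def Ks intro: gradient_form_sym)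

lemma A1_form:
  assumes x: "x \<in> carrier_vec (length ds)" and y: "y \<in> carrier_vec (length ds)"
  shows "scalar_prod y (A1_mat Ks ds *\<^sub>v x) = gradient_form T (weak_fun_of ds x) (weak_fun_of ds y)"
proof -
  have "gradient_form T (weak_fun_of ds x) (weak_fun_of ds y) =
     (\<Sum>i<length ds. y $ i * gradient_form T (weak_fun_of ds x) (basis_fun ds i))"
    using gradient_form_sum_left[of y "weak_fun_of ds x"] by (simp add: gradient_form_sym)
  also have "\<dots> = (\<Sum>i<length ds. y $ i * (\<Sum>j<length ds. x $ j * gradient_form T (basis_fun ds j)
      (basis_fun ds i)))"
    by (simp add: gradient_form_sum_left)
  finally show ?thesis
    using x y by (simp add: scalar_prod_def A1_mat_def Ks lessThan_atLeast0 mult.commute)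
qed

lemma gradient_form_eq_0:
  assumes 0: "gradient_form T u u = 0" and K: "K \<in> T" "i \<in> Basis" "z \<in> K"
  shows "weak_gradient_row K u i z = 0"
proof -
  let ?I = "\<lambda>K i. integral K (\<lambda>z. weak_gradient_row K u i z \<bullet> weak_gradient_row K u i z)"
  have nn: "?I K i \<ge> 0" if "K \<in> T" for K i
    by (rule integral_nonneg) (use integrable_gradient_rows[OF that] in auto)
  have "(\<Sum>i\<in>Basis. ?I K i) = 0"
    using 0 K(1) nn finite_T
    by (subst (asm) gradient_form_rows, subst (asm) sum_nonneg_eq_0_iff) (auto intro!: sum_nonneg)
  then have I0: "?I K i = 0"
    using K nn by (subst (asm) sum_nonneg_eq_0_iff) auto
  have "weak_gradient_row K u i z \<bullet> weak_gradient_row K u i z = 0"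
    by (rule integral_continuous_nonneg_0[OF compact_T convex_T interior_T _ _ I0])
      (use K in \<open>auto simp: weak_gradient_row_def intro!: continuous_intros\<close>)
  then show ?thesis by simp
qed

lemma A1_nonneg:
  assumes "x \<in> carrier_vec (length ds)"
  shows "scalar_prod x (A1_mat Ks ds *\<^sub>v x) \<ge> 0"
  unfolding A1_form[OF assms assms] gradient_form_rows
  by (intro sum_nonneg integral_nonneg integrable_gradient_rows) auto

text \<open>Zero energy makes all weak gradients vanish, so a component is nonzero on an element
  exactly when it is nonzero on each of its facets. Nonzero values thus spread across facets; as
  boundary facets carry the value 0, the elements concerned form a family closed under passing to
  neighbours, which must be empty.\<close>

lemma A1_definite:
  assumes x: "x \<in> carrier_vec (length ds)" and 0: "scalar_prod x (A1_mat Ks ds *\<^sub>v x) = 0"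
  shows "x = 0\<^sub>v (length ds)"
proof -
  let ?u = "weak_fun_of ds x"
  have g0: "weak_gradient K (fst ?u K \<bullet> i) (\<lambda>F. snd ?u F \<bullet> i) z = 0"
      if "K \<in> T" "i \<in> Basis" "z \<in> K" for K i z
    using gradient_form_eq_0[OF _ that] 0 by (simp add: A1_form[OF x x] weak_gradient_row_def)
  have iff: "snd ?u F \<bullet> i = 0 \<longleftrightarrow> fst ?u K \<bullet> i = 0" if "K \<in> T" "F facet_of K" "i \<in> Basis" for K F i
    using weak_gradient_0_facet[OF that(1,2) g0] that by blast
  have elem: "fst ?u K \<bullet> i = 0" if K: "K \<in> T" and i: "i \<in> Basis" for K i
  proof -
    let ?S = "{K \<in> T. fst ?u K \<bullet> i \<noteq> 0}"
    have "?S = {}"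
    proof (rule facet_closed_subfamily_empty)
      fix K F assume K: "K \<in> ?S" and F: "F facet_of K"
      have "snd ?u F \<bullet> i \<noteq> 0" using iff[OF _ F i] K by auto
      then have "\<not> F \<subseteq> frontier \<Omega>" using weak_fun_of_frontier by auto
      then obtain K' where K': "K' \<in> T" "K' \<noteq> K" "F facet_of K'"
        using facet_neighbour[OF _ F _ open_\<Omega> Union_T] K by auto
      then show "\<exists>K'\<in>?S. K' \<noteq> K \<and> F facet_of K'"
        using iff[OF K'(1,3) i] \<open>snd ?u F \<bullet> i \<noteq> 0\<close> by auto
    qed auto
    then show ?thesis using K by auto
  qed
  show ?thesis
  proof (rule eq_vecI)
    fix j assume "j < dim_vec (0\<^sub>v (length ds))"
    then have j: "j < length ds" by simp
    then have "ds ! j \<in> dofs \<Omega> T" using ds nth_mem by blast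
    then consider (elem) K i where "ds ! j = Elem_Dof K i" "K \<in> T" "i \<in> Basis"
      | (facet) F i K where "ds ! j = Facet_Dof F i" "K \<in> T" "F facet_of K" "i \<in> Basis"
      unfolding dofs_def by blast
    then have "dof_value ds x (ds ! j) = 0"
    proof cases
      case elem
      then show ?thesis using elem(1) weak_fun_of_inner(1)[of i x K] \<open>K \<in> T\<close>
          by (metis \<open>\<And>K i. K \<in> T \<Longrightarrow> i \<in> Basis \<Longrightarrow> fst (weak_fun_of ds x) K \<bullet> i = 0\<close>)
    next
      case facet
      then show ?thesis using iff[OF facet(2-4)] elem[OF facet(2,4)] weak_fun_of_inner(2)[OF
          facet(4), of x F] by simp
    qed
    then show "x $ j = 0\<^sub>v (length ds) $ j" using j by (simp add: dof_value_nth)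
  qed (use x in auto)
qed

section \<open>The weak divergence and its matrix\<close>

lemma weak_divergence_T:
  assumes K: "K \<in> T"
  shows "lvol K * weak_divergence K u = (\<Sum>F | F facet_of K. (snd u F \<bullet> outward_normal K F) *
      facet_area K F)"
  using lvol_T_pos[OF K] by (simp add: weak_divergence_def boundary_integral_normal[OF K])

lemma weak_divergence_sum:
  assumes K: "K \<in> T"
  shows "lvol K * weak_divergence K (weak_fun_of ds x) =
    (\<Sum>j<length ds. lvol K * weak_divergence K (basis_fun ds j) * x $ j)"
proof -
  have snd_sum: "snd (weak_fun_of ds x) F = (\<Sum>j<length ds. x $ j *\<^sub>R snd (basis_fun ds j) F)" for F
  proof (rule euclidean_eqI)
    fix i :: 'a assume i: "i \<in> Basis"
    show "snd (weak_fun_of ds x) F \<bullet> i = (\<Sum>j<length ds. x $ j *\<^sub>R snd (basis_fun ds j) F) \<bullet> i"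
      unfolding inner_sum_left inner_scaleR_left basis_fun_def weak_fun_of_inner[OF i]
      by (rule dof_value_sum)
  qed
  have "lvol K * weak_divergence K (weak_fun_of ds x) =
    (\<Sum>F | F facet_of K. \<Sum>j<length ds. x $ j * ((snd (basis_fun ds j) F \<bullet> outward_normal K F) *
        facet_area K F))"
    unfolding weak_divergence_T[OF K] snd_sum
        by (simp add: inner_sum_left sum_distrib_right mult.assoc)
  also have "\<dots> = (\<Sum>j<length ds. x $ j * (lvol K * weak_divergence K (basis_fun ds j)))"
    unfolding weak_divergence_T[OF K] sum_distrib_left by (rule sum.swap)
  finally show ?thesis by (simp add: mult.commute)
qed

lemma B_entry:
  assumes "i < length Ks" "j < length ds"
  shows "B_mat Ks ds $$ (i, j) = lvol (Ks ! i) * weak_divergence (Ks ! i) (basis_fun ds j)"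
proof -
  have "B_mat Ks ds $$ (i, j) = (\<Sum>K\<in>T. integral K (\<lambda>x. weak_divergence K (basis_fun ds j) * (if K
      = Ks ! i then 1 else 0)))"
    using assms by (simp add: B_mat_def divergence_form_def Ks)
  also have "\<dots> = (\<Sum>K\<in>T. if K = Ks ! i then lvol (Ks ! i) * weak_divergence (Ks ! i) (basis_fun ds
      j) else 0)"
    by (rule sum.cong) (auto simp: integral_const_T)
  also have "\<dots> = lvol (Ks ! i) * weak_divergence (Ks ! i) (basis_fun ds j)"
    using Ks_nth[OF assms(1)] finite_T by simp
  finally show ?thesis .
qed

lemma B_mult_vec:
  assumes x: "x \<in> carrier_vec (length ds)" and i: "i < length Ks"
  shows "(B_mat Ks ds *\<^sub>v x) $ i = lvol (Ks ! i) * weak_divergence (Ks ! i) (weak_fun_of ds x)"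
  using x i B_dim unfolding weak_divergence_sum[OF Ks_nth[OF i]]
  by (auto simp: scalar_prod_def lessThan_atLeast0 B_entry row_def intro!: sum.cong)

text \<open>The contributions of the two elements sharing an interior facet cancel.\<close>
lemma sum_weak_divergence_0: "(\<Sum>K\<in>T. lvol K * weak_divergence K (weak_fun_of ds x)) = 0"
proof -
  let ?u = "snd (weak_fun_of ds x)"
  let ?\<F> = "\<Union>K\<in>T. {F. F facet_of K}"
  let ?g = "\<lambda>K F. (?u F \<bullet> outward_normal K F) * facet_area K F"
  have fin: "finite ?\<F>" using finite_T finite_facets by blast
  have "(\<Sum>K\<in>T. lvol K * weak_divergence K (weak_fun_of ds x)) = (\<Sum>K\<in>T. \<Sum>F | F facet_of K. ?g K F)"
    by (simp add: weak_divergence_T)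
  also have "\<dots> = (\<Sum>K\<in>T. \<Sum>F | F \<in> ?\<F> \<and> F facet_of K. ?g K F)"
    by (intro sum.cong) auto
  also have "\<dots> = (\<Sum>F\<in>?\<F>. \<Sum>K | K \<in> T \<and> F facet_of K. ?g K F)"
    by (rule sum.swap_restrict[OF finite_T fin])
  also have "\<dots> = 0"
  proof (rule sum.neutral, rule ballI)
    fix F assume "F \<in> ?\<F>"
    then obtain K where K: "K \<in> T" "F facet_of K" by blast
    show "(\<Sum>K | K \<in> T \<and> F facet_of K. ?g K F) = 0"
    proof (cases "F \<subseteq> frontier \<Omega>")
      case True
      then show ?thesis by (simp add: weak_fun_of_frontier)
    next
      case False
      obtain K' where K': "K' \<in> T" "K' \<noteq> K" "F facet_of K'"
        using facet_neighbour[OF K False open_\<Omega> Union_T] .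
      have "{K \<in> T. F facet_of K} = {K, K'}"
        using K K' facet_elements_le_2[OF K(1) K'(1) _ _ _ K(2) K'(3)] by blast
      moreover have "outward_normal K' F = - outward_normal K F"
        using outward_normal_opposite[OF K(1) K'(1)] K K' by metis
      ultimately show ?thesis
        using K'(2) by (simp add: facet_area_def lvol_facet_cylinder_minus)
    qed
  qed
  finally show ?thesis .
qed

text \<open>Testing with the constant fields \<open>(i, 0)\<close> shows that the weak divergence is
  the mean over \<open>K\<close> of the trace \<open>f\<close> of the weak gradient, which itself
  need not be constant. Nonnegative variance bounds the square of the mean by the mean of the
  square, and Cauchy--Schwarz over the \<open>DIM('a)\<close> diagonal entries gives the
  factor.\<close>

lemma weak_divergence_square_le:
  assumes K: "K \<in> T"
  shows "lvol K * (weak_divergence K u)\<^sup>2 \<le>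
    DIM('a) * (\<Sum>i\<in>Basis. integral K (\<lambda>z. weak_gradient_row K u i z \<bullet> weak_gradient_row K u i z))"
proof -
  define f where "f z = (\<Sum>i\<in>Basis. weak_gradient_row K u i z \<bullet> i)" for z
  define m where "m = weak_divergence K u"
  have cont: "continuous_on K f" "continuous_on K (weak_gradient_row K u i)" for i
    unfolding f_def weak_gradient_row_def using K by (auto intro!: continuous_intros)
  have int: "g integrable_on K" if "continuous_on K g" for g :: "'a \<Rightarrow> real"
    using integrable_on_compact[OF compact_T[OF K] that] .
  have "integral K f = (\<Sum>i\<in>Basis. integral K (\<lambda>z. weak_gradient_row K u i z \<bullet> rt (i, 0) z))"
    unfolding f_def rt_def by (simp, rule integral_sum) (auto intro!: int continuous_intros cont)
  also have "\<dots> = (\<Sum>i\<in>Basis. \<Sum>F | F facet_of K. (snd u F \<bullet> i) * (i \<bullet> outward_normal K F) *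
      facet_area K F)"
    unfolding weak_gradient_row_def integral_weak_gradient_rt[OF K] weak_gradient_functional_def
        by simp
  also have "\<dots> = (\<Sum>F | F facet_of K. \<Sum>i\<in>Basis. (snd u F \<bullet> i) * (i \<bullet> outward_normal K F) *
      facet_area K F)"
    by (rule sum.swap)
  also have "\<dots> = (\<Sum>F | F facet_of K. (snd u F \<bullet> outward_normal K F) * facet_area K F)"
    by (intro sum.cong refl)
      (subst euclidean_inner, simp add: sum_distrib_right inner_commute)
  also have "\<dots> = lvol K * m" by (simp add: weak_divergence_T[OF K] m_def)
  finally have intf: "integral K f = lvol K * m" .
  have "0 \<le> integral K (\<lambda>z. (f z - m)\<^sup>2)"
    by (rule integral_nonneg) (auto intro!: int continuous_intros cont)
  also have "(\<lambda>z. (f z - m)\<^sup>2) = (\<lambda>z. (f z)\<^sup>2 - 2 * m * f z + m\<^sup>2)"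
    by (auto simp: power2_eq_square algebra_simps)
  also have "integral K \<dots> = integral K (\<lambda>z. (f z)\<^sup>2) - 2 * m * integral K f + m\<^sup>2 * lvol K"
    by (subst integral_add, (intro int continuous_intros cont)+,
        subst integral_diff, (intro int continuous_intros cont)+) (simp add: integral_const_T[OF K])
  finally have "lvol K * m\<^sup>2 \<le> integral K (\<lambda>z. (f z)\<^sup>2)"
    unfolding intf by (simp add: power2_eq_square algebra_simps)
  also have "\<dots> \<le> integral K (\<lambda>z. DIM('a) * (\<Sum>i\<in>Basis. weak_gradient_row K u i z \<bullet>
      weak_gradient_row K u i z))"
  proof (rule integral_le)
    fix z assume "z \<in> K"
    have "(f z)\<^sup>2 \<le> (\<Sum>i\<in>(Basis::'a set). 1\<^sup>2) * (\<Sum>i\<in>Basis. (weak_gradient_row K u i z \<bullet> i)\<^sup>2)"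
      unfolding f_def using Cauchy_Schwarz_ineq_sum[of "\<lambda>_. 1" "\<lambda>i. weak_gradient_row K u i z \<bullet> i"
          "Basis::'a set"] by simp
    also have "\<dots> \<le> DIM('a) * (\<Sum>i\<in>Basis. weak_gradient_row K u i z \<bullet> weak_gradient_row K u i z)"
    proof -
      have "(weak_gradient_row K u i z \<bullet> i)\<^sup>2 \<le> weak_gradient_row K u i z \<bullet> weak_gradient_row K u
          i z" if "i \<in> Basis" for i
        using Cauchy_Schwarz_ineq[of "weak_gradient_row K u i z" i] that by simp
      then show ?thesis by (auto intro!: sum_mono mult_left_mono)
    qed
    finally show "(f z)\<^sup>2 \<le> DIM('a) * (\<Sum>i\<in>Basis. weak_gradient_row K u i z \<bullet> weak_gradient_row K u
        i z)" .
  qed (auto intro!: int continuous_intros cont)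
  also have "\<dots> = DIM('a) * (\<Sum>i\<in>Basis. integral K (\<lambda>z. weak_gradient_row K u i z \<bullet>
      weak_gradient_row K u i z))"
    by (simp only: integral_mult_right, subst integral_sum) (auto intro!: int continuous_intros
        cont)
  finally show ?thesis by (simp add: m_def)
qed

lemma Mp_dim: "Mp_mat Ks \<in> carrier_mat (length Ks) (length Ks)"
  by (simp add: Mp_mat_def)

lemma Mp_mult_vec:
  "p \<in> carrier_vec (length Ks) \<Longrightarrow> i < length Ks \<Longrightarrow> (Mp_mat Ks *\<^sub>v p) $ i = lvol (Ks ! i) * p $ i"
  unfolding Mp_mat_def by (rule mat_diag_mult_vec)

lemma Mp_form:
  "p \<in> carrier_vec (length Ks) \<Longrightarrow> q \<in> carrier_vec (length Ks) \<Longrightarrow>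
    scalar_prod q (Mp_mat Ks *\<^sub>v p) = (\<Sum>i<length Ks. lvol (Ks ! i) * q $ i * p $ i)"
  unfolding Mp_mat_def by (rule mat_diag_form)

lemma B_bound:
  assumes p: "p \<in> carrier_vec (length Ks)" and x: "x \<in> carrier_vec (length ds)"
  shows "(scalar_prod p (B_mat Ks ds *\<^sub>v x))\<^sup>2 \<le>
    DIM('a) * scalar_prod p (Mp_mat Ks *\<^sub>v p) * scalar_prod x (A1_mat Ks ds *\<^sub>v x)"
proof -
  let ?l = "\<lambda>i. lvol (Ks ! i)" and ?d = "\<lambda>i. weak_divergence (Ks ! i) (weak_fun_of ds x)"
  have "scalar_prod p (B_mat Ks ds *\<^sub>v x) = (\<Sum>i<length Ks. (sqrt (?l i) * p $ i) * (sqrt (?l i) *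
      ?d i))"
    using B_dim by (auto simp: scalar_prod_def[of p] lessThan_atLeast0 B_mult_vec[OF x] simp del:
        index_mult_mat_vec intro!: sum.cong)
  then have "(scalar_prod p (B_mat Ks ds *\<^sub>v x))\<^sup>2 \<le>
      (\<Sum>i<length Ks. (sqrt (?l i) * p $ i)\<^sup>2) * (\<Sum>i<length Ks. (sqrt (?l i) * ?d i)\<^sup>2)"
    by (simp only: Cauchy_Schwarz_ineq_sum)
  also have "(\<Sum>i<length Ks. (sqrt (?l i) * p $ i)\<^sup>2) = scalar_prod p (Mp_mat Ks *\<^sub>v p)"
    unfolding Mp_form[OF p p] by (intro sum.cong refl) (simp add: power_mult_distrib
        power2_eq_square)
  also have "(\<Sum>i<length Ks. (sqrt (?l i) * ?d i)\<^sup>2) = (\<Sum>K\<in>T. lvol K * (weak_divergence K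
      (weak_fun_of ds x))\<^sup>2)"
    unfolding sum_Ks[symmetric] by (simp add: power_mult_distrib)
  finally have le: "(scalar_prod p (B_mat Ks ds *\<^sub>v x))\<^sup>2 \<le> scalar_prod p (Mp_mat Ks *\<^sub>v p) *
      (\<Sum>K\<in>T. lvol K * (weak_divergence K (weak_fun_of ds x))\<^sup>2)" .
  have "(\<Sum>K\<in>T. lvol K * (weak_divergence K (weak_fun_of ds x))\<^sup>2) \<le>
      (\<Sum>K\<in>T. DIM('a) * (\<Sum>i\<in>Basis. integral K (\<lambda>z. weak_gradient_row K (weak_fun_of ds x) i z \<bullet>
          weak_gradient_row K (weak_fun_of ds x) i z)))"
    by (intro sum_mono weak_divergence_square_le)
  also have "\<dots> = DIM('a) * scalar_prod x (A1_mat Ks ds *\<^sub>v x)"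
    by (simp add: A1_form[OF x x] gradient_form_rows sum_distrib_left)
  finally have "scalar_prod p (Mp_mat Ks *\<^sub>v p) * (\<Sum>K\<in>T. lvol K * (weak_divergence K (weak_fun_of
      ds x))\<^sup>2)
      \<le> scalar_prod p (Mp_mat Ks *\<^sub>v p) * (DIM('a) * scalar_prod x (A1_mat Ks ds *\<^sub>v x))"
    by (rule mult_left_mono) (simp add: Mp_form[OF p p] sum_nonneg mult.assoc)
  with le show ?thesis by (simp add: mult_ac)
qed

lemma one_B:
  assumes x: "x \<in> carrier_vec (length ds)"
  shows "scalar_prod (one_vec (length Ks)) (B_mat Ks ds *\<^sub>v x) = 0"
proof -
  have "scalar_prod (one_vec (length Ks)) (B_mat Ks ds *\<^sub>v x) =
      (\<Sum>i<length Ks. 1 / sqrt (length Ks) * (lvol (Ks ! i) * weak_divergence (Ks ! i) (weak_fun_of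
          ds x)))"
    using B_dim by (auto simp: scalar_prod_def lessThan_atLeast0 B_mult_vec[OF x] one_vec_def simp
        del: index_mult_mat_vec intro!: sum.cong)
  also have "\<dots> = 0"
    unfolding sum_distrib_left[symmetric] sum_Ks[of "\<lambda>K. lvol K * weak_divergence K (weak_fun_of
        ds x)"]
      sum_weak_divergence_0 by simp
  finally show ?thesis .
qed

end

subsection \<open>Volumes\<close>

text \<open>Near each of its points the frontier lies on the graph of \<open>g\<close>, a Lipschitz
  image of a hyperplane. This matters because the elements fill the closure of \<Omega>, while
  \<gamma> is stated with the volume of \<Omega>.\<close>

lemma negligible_frontier_lipschitz:
  fixes \<Omega> :: "'a::euclidean_space set"
  assumes op: "open \<Omega>" and lip: "lipschitz_boundary \<Omega>"
  shows "negligible (frontier \<Omega>)"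
proof (subst locally_negligible_alt, rule ballI)
  fix x assume x: "x \<in> frontier \<Omega>"
  obtain e r L g where e: "norm e = 1" and r: "0 < r" and g: "L-lipschitz_on {z. z \<bullet> e = 0} g"
    and \<Omega>: "\<Omega> \<inter> ball x r = {y \<in> ball x r. g (y - (y \<bullet> e) *\<^sub>R e) < y \<bullet> e}"
    using lip x unfolding lipschitz_boundary_def by blast
  let ?H = "{z. z \<bullet> e = 0}" and ?f = "\<lambda>z. z + g z *\<^sub>R e"
  let ?p = "\<lambda>y. y - (y \<bullet> e) *\<^sub>R e"
  have ee: "e \<bullet> e = 1" using e by (simp add: norm_eq_1)
  have pH: "?p y \<in> ?H" for y by (simp add: inner_diff_left ee)
  have "negligible ?H"
    using negligible_hyperplane[of e 0] e by (force simp: inner_commute)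
  then have neg: "negligible (?f ` ?H)"
  proof (rule negligible_locally_Lipschitz_image[rotated])
    fix z assume z: "z \<in> ?H"
    have "norm (?f y - ?f z) \<le> (1 + L) * norm (y - z)" if y: "y \<in> ?H" for y
    proof -
      have "norm (?f y - ?f z) = norm ((y - z) + (g y - g z) *\<^sub>R e)" by (simp add: algebra_simps)
      also have "\<dots> \<le> norm (y - z) + \<bar>g y - g z\<bar> * norm e" by (metis norm_scaleR norm_triangle_ineq)
      also have "\<bar>g y - g z\<bar> \<le> L * norm (y - z)"
        using lipschitz_onD[OF g y z] by (simp add: dist_norm)
      finally show ?thesis using e by (simp add: algebra_simps)
    qed
    then show "\<exists>T B. open T \<and> z \<in> T \<and> (\<forall>y\<in>?H \<inter> T. norm (?f y - ?f z) \<le> B * norm (y - z))"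
      by (intro exI[of _ UNIV] exI[of _ "1 + L"]) auto
  qed simp
  have "frontier \<Omega> \<inter> ball x r \<subseteq> ?f ` ?H"
  proof
    fix y assume y: "y \<in> frontier \<Omega> \<inter> ball x r"
    have "y \<notin> \<Omega>" using y op by (simp add: frontier_def interior_open)
    then have ge: "\<not> g (?p y) < y \<bullet> e" using y \<Omega> by blast
    \<comment> \<open>A point strictly below the graph has a neighbourhood below it; this misses
      \<Omega>, so the point is not in the closure.\<close>
    have "\<not> y \<bullet> e < g (?p y)"
    proof
      assume less: "y \<bullet> e < g (?p y)"
      have "continuous_on UNIV (\<lambda>y. g (?p y))"
        by (rule continuous_on_compose2[OF lipschitz_on_continuous_on[OF g]])
          (use pH in \<open>auto intro!: continuous_intros\<close>)
      then have "open {y. y \<bullet> e < g (?p y)}"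
        by (intro open_Collect_less continuous_intros)
      then have "open (ball x r \<inter> {y. y \<bullet> e < g (?p y)})" by (intro open_Int open_ball)
      moreover have "y \<in> ball x r \<inter> {y. y \<bullet> e < g (?p y)}" using y less by auto
      moreover have "y \<in> closure \<Omega>" using y by (simp add: frontier_def)
      ultimately have "(ball x r \<inter> {y. y \<bullet> e < g (?p y)}) \<inter> \<Omega> \<noteq> {}"
        using open_Int_closure_eq_empty by blast
      then obtain z where z: "z \<in> \<Omega> \<inter> ball x r" "z \<bullet> e < g (?p z)" by blast
      then have "g (?p z) < z \<bullet> e" using \<Omega> by blast
      with z(2) show False by simp
    qed
    with ge have "y = ?f (?p y)" by simp
    then show "y \<in> ?f ` ?H" using pH by (rule image_eqI)
  qed
  then have "negligible (frontier \<Omega> \<inter> ball x r)" using neg negligible_subset by blast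
  moreover have "openin (top_of_set (frontier \<Omega>)) (frontier \<Omega> \<inter> ball x r)"
      by (rule openin_open_Int) simp
  ultimately show "\<exists>U. openin (top_of_set (frontier \<Omega>)) U \<and> x \<in> U \<and> negligible U"
    using x r by (intro exI[of _ "frontier \<Omega> \<inter> ball x r"]) auto
qed

context simplicial_complex_full
begin

lemma mesh_size_ge: assumes "K \<in> T" "x \<in> K" shows "K \<subseteq> cball x (mesh_size T)"
proof
  fix y assume "y \<in> K"
  then have "dist x y \<le> diameter K"
    using assms compact_imp_bounded[OF compact_T] by (intro diameter_bounded_bound) auto
  also have "\<dots> \<le> mesh_size T" unfolding mesh_size_def using finite_T assms by (intro Max_ge) auto
  finally show "y \<in> cball x (mesh_size T)" by simp
qed

lemma mesh_size_nonneg: assumes "K \<in> T" shows "0 \<le> mesh_size T"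
proof -
  have "K \<noteq> {}" using interior_T[OF assms] by auto
  then obtain x where "x \<in> K" by blast
  then have "x \<in> cball x (mesh_size T)" using mesh_size_ge[OF assms] by blast
  then show ?thesis by simp
qed

lemma lvol_le: assumes K: "K \<in> T" shows "lvol K \<le> unit_ball_vol DIM('a) * mesh_size T ^ DIM('a)"
proof -
  have "K \<noteq> {}" using interior_T[OF K] by auto
  then obtain x where x: "x \<in> K" by blast
  have "lvol K \<le> lvol (cball x (mesh_size T))"
    by (rule measure_mono_fmeasurable[OF mesh_size_ge[OF K x]])
      (use lmeasurable_compact[OF compact_T[OF K]] in \<open>auto simp: fmeasurableD\<close>)
  then show ?thesis using mesh_size_nonneg[OF K] by (simp add: content_cball)
qed

lemma lvol_ge:
  assumes K: "K \<in> T" and \<sigma>: "0 < \<sigma>" "cball x (\<sigma> * mesh_size T) \<subseteq> K"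
  shows "unit_ball_vol DIM('a) * \<sigma> ^ DIM('a) * mesh_size T ^ DIM('a) \<le> lvol K"
proof -
  have "lvol (cball x (\<sigma> * mesh_size T)) \<le> lvol K"
    by (rule measure_mono_fmeasurable[OF \<sigma>(2)])
        (use lmeasurable_compact[OF compact_T[OF K]] in auto)
  then show ?thesis using mesh_size_nonneg[OF K] \<sigma>(1)
      by (simp add: content_cball power_mult_distrib mult.assoc)
qed

end

context mesh_numbering
begin

lemma lvol_\<Omega>:
  assumes "negligible (frontier \<Omega>)"
  shows "lvol \<Omega> = (\<Sum>K\<in>T. lvol K)"
proof -
  have "(\<Sum>K\<in>T. lvol K) = lvol (\<Union>T)"
    by (rule measure_negligible_finite_Union[symmetric, OF finite_T])
      (use lmeasurable_compact compact_T negligible_Int_T in \<open>auto simp: pairwise_def\<close>)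
  also have "\<dots> = lvol \<Omega>"
  proof (rule measure_negligible_symdiff[symmetric])
    have "compact (\<Union>T)" using finite_T compact_T by (intro compact_Union) auto
    then show "\<Union>T \<in> lmeasurable" by (rule lmeasurable_compact)
    have "\<Union>T - \<Omega> \<union> (\<Omega> - \<Union>T) = frontier \<Omega>"
      using Union_T open_\<Omega> closure_subset by (auto simp: frontier_def interior_open)
    then show "negligible (\<Union>T - \<Omega> \<union> (\<Omega> - \<Union>T))" using assms by simp
  qed
  finally show ?thesis by simp
qed

lemma vnorm_Mp_one: "vnorm (Mp_mat Ks *\<^sub>v one_vec (length Ks)) = sqrt (\<Sum>K\<in>T. (lvol K)\<^sup>2) / sqrt
    (length Ks)"
proof -
  have o: "one_vec (length Ks) \<in> carrier_vec (length Ks)" by (simp add: one_vec_def)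
  have "scalar_prod (Mp_mat Ks *\<^sub>v one_vec (length Ks)) (Mp_mat Ks *\<^sub>v one_vec (length Ks)) =
      (\<Sum>i<length Ks. (lvol (Ks ! i))\<^sup>2 / length Ks)"
    using Mp_dim Mp_mult_vec[OF o]
    by (auto simp: scalar_prod_def lessThan_atLeast0 one_vec_def power2_eq_square simp del:
        index_mult_mat_vec intro!: sum.cong)
  also have "\<dots> = (\<Sum>K\<in>T. (lvol K)\<^sup>2) / length Ks"
    by (simp add: sum_Ks[of "\<lambda>K. (lvol K)\<^sup>2"] flip: sum_divide_distrib)
  finally show ?thesis by (simp add: vnorm_def real_sqrt_divide)
qed

lemma gamma_const_sum:
  "gamma_const Ks = (\<Sum>K\<in>T. lvol K) / (sqrt (length Ks) * sqrt (\<Sum>K\<in>T. (lvol K)\<^sup>2))"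
proof -
  have o: "one_vec (length Ks) \<in> carrier_vec (length Ks)" by (simp add: one_vec_def)
  have "scalar_prod (one_vec (length Ks)) (Mp_mat Ks *\<^sub>v one_vec (length Ks)) = (\<Sum>i<length Ks.
      lvol (Ks ! i) / length Ks)"
    unfolding Mp_form[OF o o] by (simp add: one_vec_def)
  also have "\<dots> = (\<Sum>K\<in>T. lvol K) / length Ks"
    by (simp add: sum_Ks flip: sum_divide_distrib)
  finally have eq: "scalar_prod (one_vec (length Ks)) (Mp_mat Ks *\<^sub>v one_vec (length Ks)) =
      (\<Sum>K\<in>T. lvol K) / (sqrt (length Ks) * sqrt (length Ks))" by simp
  have cancel: "1 / (c / a) * (s / (a * a)) = s / (a * c)" for a c s :: real
    by (cases "a = 0") simp_all
  show ?thesis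
    unfolding gamma_const_def w_vec_def vnorm_Mp_one
      scalar_prod_smult_distrib[OF o mult_mat_vec_carrier[OF Mp_dim o]] eq by (rule cancel)
qed

text \<open>The left side is the root mean square of the element volumes, hence at most their
  maximum. It is the source of the order \<open>h^d\<close>.\<close>

lemma vnorm_Mp_one_le:
  assumes "T \<noteq> {}"
  shows "vnorm (Mp_mat Ks *\<^sub>v one_vec (length Ks)) \<le> unit_ball_vol DIM('a) * mesh_size T ^ DIM('a)"
proof -
  let ?v = "unit_ball_vol DIM('a) * mesh_size T ^ DIM('a)"
  have N: "length Ks = card T" using Ks distinct_card by fastforce
  have N0: "0 < card T" using assms finite_T by (simp add: card_gt_0_iff)
  obtain K where "K \<in> T" using assms by blast
  then have v: "0 \<le> ?v" using mesh_size_nonneg by simp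
  have "(\<Sum>K\<in>T. (lvol K)\<^sup>2) \<le> (\<Sum>K\<in>T. ?v\<^sup>2)"
    by (intro sum_mono power_mono lvol_le) auto
  then have "sqrt (\<Sum>K\<in>T. (lvol K)\<^sup>2) \<le> sqrt (card T * ?v\<^sup>2)" by simp
  also have "\<dots> = sqrt (card T) * ?v" using v by (simp add: real_sqrt_mult del: mult_eq_0_iff)
  finally show ?thesis unfolding vnorm_Mp_one unfolding N using N0
      by (simp add: divide_le_eq mult.commute)
qed

text \<open>\<open>gamma_const\<close> is the quotient of the mean and the root mean square of the
  volumes; by quasi-uniformity the smallest volume is at least \<open>\<sigma> ^ DIM('a)\<close>
  times the upper bound for the largest.\<close>

lemma gamma_const_ge:
  assumes "T \<noteq> {}" and \<sigma>: "0 < \<sigma>" "\<And>K. K \<in> T \<Longrightarrow> \<exists>x. cball x (\<sigma> * mesh_size T) \<subseteq> K"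
  shows "\<sigma> ^ DIM('a) \<le> gamma_const Ks"
proof -
  let ?v = "unit_ball_vol DIM('a) * mesh_size T ^ DIM('a)"
  have N: "length Ks = card T" using Ks distinct_card by fastforce
  have N0: "0 < card T" using assms finite_T by (simp add: card_gt_0_iff)
  obtain K where K: "K \<in> T" using assms by blast
  have v: "0 < ?v" using lvol_T_pos[OF K] lvol_le[OF K] by linarith
  have "0 < (\<Sum>K\<in>T. (lvol K)\<^sup>2)"
    by (rule sum_pos[OF finite_T assms(1)]) (use lvol_T_pos in force)
  then have sq: "0 < sqrt (\<Sum>K\<in>T. (lvol K)\<^sup>2)" by simp
  have "sqrt (card T) * sqrt (\<Sum>K\<in>T. (lvol K)\<^sup>2) \<le> card T * ?v"
  proof -
    have "sqrt (\<Sum>K\<in>T. (lvol K)\<^sup>2) / sqrt (card T) \<le> ?v"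
      using vnorm_Mp_one_le[OF assms(1)] unfolding vnorm_Mp_one unfolding N .
    then have "sqrt (\<Sum>K\<in>T. (lvol K)\<^sup>2) \<le> ?v * sqrt (card T)" using N0 by (simp add: divide_le_eq)
    then have "sqrt (card T) * sqrt (\<Sum>K\<in>T. (lvol K)\<^sup>2) \<le> sqrt (card T) * (?v * sqrt (card T))"
      by (intro mult_left_mono) auto
    also have "\<dots> = (sqrt (card T) * sqrt (card T)) * ?v" by (simp only: mult_ac)
    also have "\<dots> = card T * ?v" by simp
    finally show ?thesis .
  qed
  then have "\<sigma> ^ DIM('a) * (sqrt (card T) * sqrt (\<Sum>K\<in>T. (lvol K)\<^sup>2)) \<le> \<sigma> ^ DIM('a) * (card T * ?v)"
    using \<sigma>(1) by (intro mult_left_mono) auto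
  also have "\<dots> = (\<Sum>K\<in>T. unit_ball_vol DIM('a) * \<sigma> ^ DIM('a) * mesh_size T ^ DIM('a))"
      by (simp add: mult_ac)
  also have "\<dots> \<le> (\<Sum>K\<in>T. lvol K)"
  proof (rule sum_mono)
    fix K assume K: "K \<in> T"
    then obtain x where "cball x (\<sigma> * mesh_size T) \<subseteq> K" using \<sigma>(2) by blast
    then show "unit_ball_vol DIM('a) * \<sigma> ^ DIM('a) * mesh_size T ^ DIM('a) \<le> lvol K"
      by (rule lvol_ge[OF K \<sigma>(1)])
  qed
  finally show ?thesis
    unfolding gamma_const_sum N using N0 sq by (simp add: le_divide_eq)
qed

end

section \<open>The bound, uniformly over the mesh family\<close>

theorem proposition3p2:
  fixes \<Omega> :: "'a::euclidean_space set" and \<T> :: "'a set set set" and \<beta> \<rho> \<mu> :: real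
  assumes "bounded_lipschitz_domain \<Omega>"
    and "quasi_uniform_family \<Omega> \<T>"
    and "0 < \<beta>" and "\<beta> < 1"
    and "\<And>T Ks ds. T \<in> \<T> \<Longrightarrow> numbering \<Omega> T Ks ds \<Longrightarrow> inf_sup_condition \<beta> Ks ds"
    and "0 < \<rho>" and "0 < \<mu>"
  shows "\<exists>C. \<forall>lam>0. \<forall>T\<in>\<T>. \<forall>Ks ds. numbering \<Omega> T Ks ds \<longrightarrow>
    (let \<epsilon> = \<mu> / (lam + \<mu>);
         d = DIM('a);
         N = length Ks;
         Z = preconditioned_mat \<epsilon> \<rho> Ks ds;
         C3 = C3_const \<beta> Ks
     in gamma_const Ks = lvol \<Omega> / (sqrt N * sqrt (\<Sum>K\<in>T. (lvol K)\<^sup>2)) \<and>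
        (\<exists>\<delta>. \<bar>\<delta>\<bar> \<le> C * mesh_size T ^ d \<and>
          (\<forall>b x0 xk k.
             b \<in> carrier_vec (length ds + N) \<longrightarrow> x0 \<in> carrier_vec (length ds + N) \<longrightarrow>
             1 \<le> k \<longrightarrow> gmres_iterate Z b x0 k xk \<longrightarrow>
             b - Z *\<^sub>v x0 \<noteq> 0\<^sub>v (length ds + N) \<longrightarrow>
             vnorm (b - Z *\<^sub>v xk) / vnorm (b - Z *\<^sub>v x0) \<le>
               2 * (1 + sqrt (d * lambda_max (Mp_mat Ks) / lambda_min (A1_mat Ks ds)) + d + \<epsilon>) *
               ((sqrt (d + \<epsilon>) - sqrt C3) / (sqrt (d + \<epsilon>) + sqrt C3) + \<delta>) ^ (k - 1))))"
proof -
  define D where "D = DIM('a)"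
  define \<omega> where "\<omega> = unit_ball_vol D"
  have \<Omega>: "open \<Omega>" "\<Omega> \<noteq> {}" "lipschitz_boundary \<Omega>"
    using assms(1) by (auto simp: bounded_lipschitz_domain_def)
  obtain \<sigma> where \<sigma>: "\<sigma> > 0" "\<And>T K. T \<in> \<T> \<Longrightarrow> K \<in> T \<Longrightarrow> \<exists>x. cball x (\<sigma> * mesh_size T) \<subseteq> K"
    using assms(2) unfolding quasi_uniform_family_def by metis
  have mesh: "simplicial_mesh \<Omega> T" if "T \<in> \<T>" for T
    using assms(2) that by (simp add: quasi_uniform_family_def)
  have \<beta>2: "0 < 1 - \<beta>\<^sup>2" using assms(3,4) by (simp add: abs_square_less_1)
  \<comment> \<open>Read off from the failure of the threshold: with
    \<open>sp.gam \<ge> \<sigma> ^ D\<close> and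
    \<open>sp.nrm \<le> \<omega> * mesh_size T ^ D\<close> it yields
    \<open>1 \<le> C * mesh_size T ^ D\<close>. Neither \<open>lam\<close> nor an individual mesh
    enters.\<close>
  define C where "C = \<beta>\<^sup>2 * \<omega> / (\<rho> * \<sigma> ^ D * (1 - \<beta>\<^sup>2))"
  show ?thesis
  proof (rule exI[of _ C], intro allI impI ballI)
    fix lam :: real and T Ks and ds :: "'a dof list"
    assume lam: "0 < lam" and T: "T \<in> \<T>" and num: "numbering \<Omega> T Ks ds"
    define \<epsilon> where "\<epsilon> = \<mu> / (lam + \<mu>)"
    have \<epsilon>: "0 < \<epsilon>" "\<epsilon> < 1" using lam assms(7) by (auto simp: \<epsilon>_def divide_simps)
    interpret mesh_numbering T \<Omega> Ks ds
      by unfold_locales (use mesh[OF T] num \<Omega>(1) in \<open>auto simp: simplicial_mesh_def\<close>)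
    have T0: "T \<noteq> {}" using Union_T \<Omega>(2) closure_subset[of \<Omega>] by auto
    then obtain K where K: "K \<in> T" by blast
    have N0: "0 < length Ks" using Ks T0 by auto
    obtain i :: 'a where "i \<in> Basis" using nonempty_Basis by blast
    then have "Elem_Dof K i \<in> set ds" using K ds(2) by (auto simp: dofs_def)
    then have n0: "0 < length ds" by auto
    have Mp: "mat_diag (length Ks) (\<lambda>i. lvol (Ks ! i)) = Mp_mat Ks" by (simp add: Mp_mat_def)
    interpret sp: saddle_point "length ds" "length Ks" "A1_mat Ks ds" "B_mat Ks ds"
      "\<lambda>i. lvol (Ks ! i)" "real D" \<beta> \<epsilon> \<rho>
    proof (unfold_locales, unfold Mp)
      fix x :: "real vec" assume x: "x \<in> carrier_vec (length ds)"
      show "x \<noteq> 0\<^sub>v (length ds) \<Longrightarrow> 0 < scalar_prod x (A1_mat Ks ds *\<^sub>v x)"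
        using A1_nonneg[OF x] A1_definite[OF x] by force
      show "scalar_prod (one_vec (length Ks)) (B_mat Ks ds *\<^sub>v x) = 0" by (rule one_B[OF x])
      fix p :: "real vec" assume p: "p \<in> carrier_vec (length Ks)"
      show "(scalar_prod p (B_mat Ks ds *\<^sub>v x))\<^sup>2 \<le>
          real D * scalar_prod p (Mp_mat Ks *\<^sub>v p) * scalar_prod x (A1_mat Ks ds *\<^sub>v x)"
        using B_bound[OF p x] by (simp add: D_def)
    next
      fix p :: "real vec" assume "p \<in> carrier_vec (length Ks)"
        "scalar_prod (one_vec (length Ks)) (Mp_mat Ks *\<^sub>v p) = 0"
      then show "\<beta> * sqrt (scalar_prod p (Mp_mat Ks *\<^sub>v p)) \<le>
          (SUP v\<in>carrier_vec (length ds) - {0\<^sub>v (length ds)}.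
             scalar_prod p (B_mat Ks ds *\<^sub>v v) / sqrt (scalar_prod v (A1_mat Ks ds *\<^sub>v v)))"
        using assms(5)[OF T num] by (simp add: inf_sup_condition_def)
    next
      show "1 \<le> real D" by (simp add: D_def Suc_leI)
    qed (use n0 N0 A1_dim A1_sym B_dim lvol_T_pos Ks_nth assms(3,4,6) \<epsilon> in auto)
    have w: "sp.w = w_vec Ks" by (simp add: sp.w_def sp.nrm_def w_vec_def Mp)
    have gam: "sp.gam = gamma_const Ks" by (simp add: sp.gam_def gamma_const_def w)
    have Z: "sp.Z = preconditioned_mat \<epsilon> \<rho> Ks ds"
      by (simp add: sp.Z_def sp.P_def sp.S_def preconditioned_mat_def precond_mat_def
          system_mat_def S_hat_def w Mp)
    have C3: "sp.C3 = C3_const \<beta> Ks" by (simp add: sp.C3_def C3_const_def gam Mp)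
    have fac: "sp.fac = 1 + sqrt (real D * lambda_max (Mp_mat Ks) / lambda_min (A1_mat Ks ds)) +
        real D + \<epsilon>"
      by (simp add: sp.fac_def Mp)
    have b: "sp.b = real D + \<epsilon>" by (simp add: sp.b_def)
    have nrm: "sp.nrm \<le> \<omega> * mesh_size T ^ D"
      using vnorm_Mp_one_le[OF T0] by (simp add: sp.nrm_def Mp D_def \<omega>_def)
    have gamma_ge: "\<sigma> ^ D \<le> sp.gam"
      unfolding gam D_def by (rule gamma_const_ge[OF T0 \<sigma>(1)]) (use \<sigma>(2)[OF T] in blast)
    have gamma_eq: "gamma_const Ks = lvol \<Omega> / (sqrt (length Ks) * sqrt (\<Sum>K\<in>T. (lvol K)\<^sup>2))"
      using gamma_const_sum lvol_\<Omega>[OF negligible_frontier_lipschitz[OF \<Omega>(1,3)]] by simp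
    have "\<exists>\<delta>. \<bar>\<delta>\<bar> \<le> C * mesh_size T ^ D \<and>
      (\<forall>f x0 xk k. f \<in> carrier_vec (length ds + length Ks) \<longrightarrow> x0 \<in> carrier_vec (length ds + length
          Ks) \<longrightarrow>
        1 \<le> k \<longrightarrow> gmres_iterate sp.Z f x0 k xk \<longrightarrow> f - sp.Z *\<^sub>v x0 \<noteq> 0\<^sub>v (length ds + length Ks) \<longrightarrow>
        vnorm (f - sp.Z *\<^sub>v xk) / vnorm (f - sp.Z *\<^sub>v x0) \<le>
          2 * sp.fac * ((sqrt sp.b - sqrt sp.C3) / (sqrt sp.b + sqrt sp.C3) + \<delta>) ^ (k - 1))"
    \<comment> \<open>The threshold decides between \<open>\<delta> = 0\<close>, where the abstract
      bound applies, and \<open>\<delta> = 1\<close>, admissible because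
      \<open>C * mesh_size T ^ D\<close> is then at least 1. In the second case the rate plus 1 is
      at least 1, and the bound holds since GMRES never increases the residual.\<close>
    proof (cases "\<beta>\<^sup>2 * sp.nrm \<le> \<rho> * sp.gam * (1 - \<beta>\<^sup>2)")
      case True
      have "0 \<le> C * mesh_size T ^ D"
        using assms(6) \<sigma>(1) \<beta>2 mesh_size_nonneg[OF K] by (simp add: C_def \<omega>_def)
      then show ?thesis using sp.gmres_bound[OF True] by (intro exI[of _ 0]) auto
    next
      case False
      have "\<rho> * \<sigma> ^ D * (1 - \<beta>\<^sup>2) \<le> \<rho> * sp.gam * (1 - \<beta>\<^sup>2)"
        using gamma_ge assms(6) \<beta>2 by (intro mult_right_mono mult_left_mono) auto
      also have "\<dots> \<le> \<beta>\<^sup>2 * sp.nrm" using False by simp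
      also have "\<dots> \<le> \<beta>\<^sup>2 * (\<omega> * mesh_size T ^ D)" using nrm by (intro mult_left_mono) auto
      finally have large: "1 \<le> C * mesh_size T ^ D"
        using assms(6) \<sigma>(1) \<beta>2 by (simp add: C_def le_divide_eq mult.assoc)
      have ge: "1 \<le> 2 * sp.fac * ((sqrt sp.b - sqrt sp.C3) / (sqrt sp.b + sqrt sp.C3) + 1) ^ j"
          for j
      proof -
        have "1 \<le> ((sqrt sp.b - sqrt sp.C3) / (sqrt sp.b + sqrt sp.C3) + 1) ^ j"
          using sp.rate_nonneg by (intro one_le_power) simp
        then have "1 * 1 \<le> (2 * sp.fac) * ((sqrt sp.b - sqrt sp.C3) / (sqrt sp.b + sqrt sp.C3) +
            1) ^ j"
          using sp.fac_ge by (intro mult_mono) auto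
        then show ?thesis by simp
      qed
      show ?thesis
      proof (intro exI[of _ 1] conjI allI impI)
        show "\<bar>1\<bar> \<le> C * mesh_size T ^ D" using large by simp
        fix f x0 xk k
        assume "f \<in> carrier_vec (length ds + length Ks)" "x0 \<in> carrier_vec (length ds + length Ks)"
          "gmres_iterate sp.Z f x0 k xk" "f - sp.Z *\<^sub>v x0 \<noteq> 0\<^sub>v (length ds + length Ks)"
        from sp.gmres_ratio_le_1[OF this] ge
        show "vnorm (f - sp.Z *\<^sub>v xk) / vnorm (f - sp.Z *\<^sub>v x0) \<le>
            2 * sp.fac * ((sqrt sp.b - sqrt sp.C3) / (sqrt sp.b + sqrt sp.C3) + 1) ^ (k - 1)"
          by (rule order_trans)
      qed
    qed
    then show "let \<epsilon> = \<mu> / (lam + \<mu>);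
         d = DIM('a);
         N = length Ks;
         Z = preconditioned_mat \<epsilon> \<rho> Ks ds;
         C3 = C3_const \<beta> Ks
     in gamma_const Ks = lvol \<Omega> / (sqrt N * sqrt (\<Sum>K\<in>T. (lvol K)\<^sup>2)) \<and>
        (\<exists>\<delta>. \<bar>\<delta>\<bar> \<le> C * mesh_size T ^ d \<and>
          (\<forall>b x0 xk k.
             b \<in> carrier_vec (length ds + N) \<longrightarrow> x0 \<in> carrier_vec (length ds + N) \<longrightarrow>
             1 \<le> k \<longrightarrow> gmres_iterate Z b x0 k xk \<longrightarrow>
             b - Z *\<^sub>v x0 \<noteq> 0\<^sub>v (length ds + N) \<longrightarrow>
             vnorm (b - Z *\<^sub>v xk) / vnorm (b - Z *\<^sub>v x0) \<le>
               2 * (1 + sqrt (d * lambda_max (Mp_mat Ks) / lambda_min (A1_mat Ks ds)) + d + \<epsilon>) *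
               ((sqrt (d + \<epsilon>) - sqrt C3) / (sqrt (d + \<epsilon>) + sqrt C3) + \<delta>) ^ (k - 1)))"
      unfolding Let_def Z C3 fac b \<epsilon>_def[symmetric] D_def[symmetric] using gamma_eq by blast
  qed
qed

end
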